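(* Let $(\Omega,\mathcal{A},T,\mu,\mathcal{F},\|\cdot\|,\chi)$ fulfill Property $\mathfrak{D}$ and let $F(x)=\mu(\chi\le x)$. Assume that $1-F(x)=L(x)/x^{\alpha}$ where $0<\alpha<1$ and $L$ is slowly varying. Let $(f_n)_{n\in\mathbb{N}}$ be a positive valued sequence and assume that $F(f_n)>0$ for all $n\in\mathbb{N}$. If there exists $\psi\in\Psi$ such that $$\frac{f_n^{\alpha}}{L(f_n)}=o\left(\frac{n}{\log\psi(\lfloor\log n\rfloor)}\right)\qquad(n\to\infty),$$ then $$\lim_{n\to\infty}\frac{\mathsf{T}_n^{f_n}\chi}{\int\mathsf{T}_n^{f_n}\chi\,\mathrm{d}\mu}=1\quad\mu\text{-almost surely.}$$
   Context: Transfer operator. For a non-singular transformation $T$ of a probability space $(\Omega,\mathcal{A},\mu)$, $\widehat T:\mathcal{L}^1\to\mathcal{L}^1$ is the unique operator with $\int \widehat T f\cdot g\,\mathrm{d}\mu=\int f\cdot g\circ T\,\mathrm{d}\mu$ for all $f\in\mathcal{L}^1$, $g\in\mathcal{L}^\infty$. $|\cdot|_\infty$ is the $\mathcal{L}^\infty$ norm. Spectral gap. A bounded linear operator $U$ on a Banach space has a spectral gap if $U=\lambda P+N$ with $\lambda\in\mathbb{C}$ and $P,N$ bounded linear operators such that $P^2=P$, $\dim \mathrm{Im}(P)=1$, $\rho(N)<|\lambda|$ ($\rho$ = spectral radius), and $PN=NP=0$. Property $\mathfrak{C}$. Let $\mathcal{F}$ be a subset of the measurable functions forming a Banach algebra with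 respect to a norm $\|\cdot\|$. $(\Omega,\mathcal{A},T,\mu,\mathcal{F},\|\cdot\|)$ has Property $\mathfrak{C}$ if: $\mu$ is a $T$-invariant, mixing probability measure; $\mathcal{F}$ contains the constant functions and $\|f\|\ge|f|_\infty$ for all $f\in\mathcal{F}$; there is $K_0>0$ with $\|\widehat T f\|\le K_0\|f\|$ for all $f\in\mathcal{F}$; $\widehat T$ has a spectral gap on $\mathcal{F}$ with respect to $\|\cdot\|$. Property $\mathfrak{D}$. Let $\chi:\Omega\to\mathbb{R}_{\ge0}$ be measurable and ${}^{\ell}\chi:=\chi\cdot\mathbb{1}_{\{\chi\le\ell\}}$ for $\ell\ge0$. $(\Omega,\mathcal{A},T,\mu,\mathcal{F},\|\cdot\|,\chi)$ has Property $\mathfrak{D}$ if $(\Omega,\mathcal{A},T,\mu,\mathcal{F},\|\cdot\|)$ has Property $\mathfrak{C}$ and there are $K_1,K_2>0$ such that for all $\ell>0$: $\|{}^{\ell}\chi\|\le K_1\ell$ and $\|\mathbb{1}_{\{\chi>\ell\}}\|\le K_2$. Truncated sums. $\mathsf{T}_n^{f_n}\chi:={}^{f_n}\chi+{}^{f_n}\chi\circ T+\dots+{}^{f_n}\chi\circ T^{n-1}$. Further notation. $\Psi:=\{u:\mathbb{N}\to\mathbb{R}^+:\ \sum_{n=1}^\infty 1/u(n)<\infty\}$. $\lfloor x\rfloor$ is the largest integer not exceeding $x$. $L$ is slowly varying if $\lim_{x\to\infty}L(cx)/L(x)=1$ for every $c>0$.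
   Formalization: Added hypothesis: there is c>0 with μ(0<χ≤c)>0 and f_n≥c for all large n; without it the claim fails, e.g. for the doubling map with χ(x)=x^(-1/α)-1 and f_n=e^(-n), where the ratio tends to 0. *)

theory Defs
  imports "HOL-Probability.Probability"
begin

section \<open>Banach algebras of measurable functions\<close>

text \<open>Functions are complex valued, so that spectra make sense, and they are identified when they
  agree almost everywhere.  Instead of passing to a quotient, a space of classes is represented by
  the set \<open>F\<close> of all representatives of its elements, \<open>nrm\<close> is a function of representatives that
  vanishes exactly on the null functions, and equality of elements is \<open>ae_eq\<close>.  That \<open>nrm\<close> and
  bounded operators respect \<open>ae_eq\<close> follows from the axioms below.\<close>

abbreviation ae_eq :: "'a measure \<Rightarrow> ('a \<Rightarrow> complex) \<Rightarrow> ('a \<Rightarrow> complex) \<Rightarrow> bool" where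
  "ae_eq M f g \<equiv> (AE x in M. f x = g x)"

definition function_banach_algebra ::
    "'a measure \<Rightarrow> ('a \<Rightarrow> complex) set \<Rightarrow> (('a \<Rightarrow> complex) \<Rightarrow> real) \<Rightarrow> bool" where
  "function_banach_algebra M F nrm \<longleftrightarrow>
     F \<subseteq> borel_measurable M \<and>
     (\<forall>f\<in>F. \<forall>g\<in>borel_measurable M. ae_eq M f g \<longrightarrow> g \<in> F) \<and>
     (\<lambda>x. 0) \<in> F \<and>
     (\<forall>f\<in>F. \<forall>g\<in>F. (\<lambda>x. f x + g x) \<in> F) \<and>
     (\<forall>c. \<forall>f\<in>F. (\<lambda>x. c * f x) \<in> F) \<and>
     (\<forall>f\<in>F. \<forall>g\<in>F. (\<lambda>x. f x * g x) \<in> F) \<and>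
     (\<forall>f\<in>F. 0 \<le> nrm f) \<and>
     (\<forall>f\<in>F. nrm f = 0 \<longleftrightarrow> ae_eq M f (\<lambda>x. 0)) \<and>
     (\<forall>f\<in>F. \<forall>g\<in>F. nrm (\<lambda>x. f x + g x) \<le> nrm f + nrm g) \<and>
     (\<forall>c. \<forall>f\<in>F. nrm (\<lambda>x. c * f x) = cmod c * nrm f) \<and>
     (\<forall>f\<in>F. \<forall>g\<in>F. nrm (\<lambda>x. f x * g x) \<le> nrm f * nrm g) \<and>
     (\<forall>X :: nat \<Rightarrow> 'a \<Rightarrow> complex.
        (\<forall>n. X n \<in> F) \<and> (\<forall>e>0. \<exists>K. \<forall>m\<ge>K. \<forall>n\<ge>K. nrm (\<lambda>x. X m x - X n x) < e) \<longrightarrow>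
        (\<exists>f\<in>F. (\<lambda>n. nrm (\<lambda>x. X n x - f x)) \<longlonglongrightarrow> 0))"

section \<open>Bounded operators, spectral radius and spectral gap\<close>

definition bounded_operator ::
    "'a measure \<Rightarrow> ('a \<Rightarrow> complex) set \<Rightarrow> (('a \<Rightarrow> complex) \<Rightarrow> real) \<Rightarrow>
     (('a \<Rightarrow> complex) \<Rightarrow> ('a \<Rightarrow> complex)) \<Rightarrow> bool" where
  "bounded_operator M F nrm V \<longleftrightarrow>
     (\<forall>f\<in>F. V f \<in> F) \<and>
     (\<forall>f\<in>F. \<forall>g\<in>F. ae_eq M (V (\<lambda>x. f x + g x)) (\<lambda>x. V f x + V g x)) \<and>
     (\<forall>c. \<forall>f\<in>F. ae_eq M (V (\<lambda>x. c * f x)) (\<lambda>x. c * V f x)) \<and>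
     (\<exists>C. \<forall>f\<in>F. nrm (V f) \<le> C * nrm f)"

definition operator_spectrum ::
    "'a measure \<Rightarrow> ('a \<Rightarrow> complex) set \<Rightarrow> (('a \<Rightarrow> complex) \<Rightarrow> real) \<Rightarrow>
     (('a \<Rightarrow> complex) \<Rightarrow> ('a \<Rightarrow> complex)) \<Rightarrow> complex set" where
  "operator_spectrum M F nrm V =
     {z. \<not> (\<exists>W. bounded_operator M F nrm W \<and>
              (\<forall>f\<in>F. ae_eq M (W (\<lambda>x. z * f x - V f x)) f) \<and>
              (\<forall>f\<in>F. ae_eq M (\<lambda>x. z * W f x - V (W f) x) f))}"

definition operator_spectral_radius ::
    "'a measure \<Rightarrow> ('a \<Rightarrow> complex) set \<Rightarrow> (('a \<Rightarrow> complex) \<Rightarrow> real) \<Rightarrow>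
     (('a \<Rightarrow> complex) \<Rightarrow> ('a \<Rightarrow> complex)) \<Rightarrow> ennreal" where
  "operator_spectral_radius M F nrm V = (SUP z\<in>operator_spectrum M F nrm V. ennreal (cmod z))"

text \<open>The condition on \<open>e\<close> says that the image of \<open>P\<close> is spanned by its nonzero element \<open>P e\<close>,
  i.e. that it is one-dimensional.\<close>

definition has_spectral_gap ::
    "'a measure \<Rightarrow> ('a \<Rightarrow> complex) set \<Rightarrow> (('a \<Rightarrow> complex) \<Rightarrow> real) \<Rightarrow>
     (('a \<Rightarrow> complex) \<Rightarrow> ('a \<Rightarrow> complex)) \<Rightarrow> bool" where
  "has_spectral_gap M F nrm U \<longleftrightarrow> bounded_operator M F nrm U \<and>
     (\<exists>a P N. bounded_operator M F nrm P \<and> bounded_operator M F nrm N \<and>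
        (\<forall>f\<in>F. ae_eq M (U f) (\<lambda>x. a * P f x + N f x)) \<and>
        (\<forall>f\<in>F. ae_eq M (P (P f)) (P f)) \<and>
        (\<exists>e\<in>F. \<not> ae_eq M (P e) (\<lambda>x. 0) \<and> (\<forall>f\<in>F. \<exists>c. ae_eq M (P f) (\<lambda>x. c * P e x))) \<and>
        operator_spectral_radius M F nrm N < ennreal (cmod a) \<and>
        (\<forall>f\<in>F. ae_eq M (P (N f)) (\<lambda>x. 0)) \<and>
        (\<forall>f\<in>F. ae_eq M (N (P f)) (\<lambda>x. 0)))"

section \<open>The transfer operator\<close>

definition sup_norm :: "'a measure \<Rightarrow> ('a \<Rightarrow> complex) \<Rightarrow> ereal" where
  "sup_norm M f = esssup M (\<lambda>x. ereal (cmod (f x)))"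

definition Linfty :: "'a measure \<Rightarrow> ('a \<Rightarrow> complex) set" where
  "Linfty M = {g \<in> borel_measurable M. sup_norm M g < \<infinity>}"

text \<open>For non-singular \<open>T\<close> and integrable \<open>f\<close>, a function \<open>h\<close> as below exists and is unique up to
  null sets; the choice operator only picks a representative.\<close>

definition transfer_operator ::
    "'a measure \<Rightarrow> ('a \<Rightarrow> 'a) \<Rightarrow> ('a \<Rightarrow> complex) \<Rightarrow> ('a \<Rightarrow> complex)" where
  "transfer_operator M T f =
     (SOME h. integrable M h \<and>
        (\<forall>g\<in>Linfty M. (\<integral>x. h x * g x \<partial>M) = (\<integral>x. f x * g (T x) \<partial>M)))"

section \<open>Properties C and D\<close>

definition measure_invariant :: "'a measure \<Rightarrow> ('a \<Rightarrow> 'a) \<Rightarrow> bool" where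
  "measure_invariant M T \<longleftrightarrow> T \<in> measurable M M \<and> distr M M T = M"

definition mixing :: "'a measure \<Rightarrow> ('a \<Rightarrow> 'a) \<Rightarrow> bool" where
  "mixing M T \<longleftrightarrow>
     (\<forall>A\<in>sets M. \<forall>B\<in>sets M.
        (\<lambda>n. measure M (A \<inter> ((T ^^ n) -` B \<inter> space M))) \<longlonglongrightarrow> measure M A * measure M B)"

definition property_C ::
    "'a measure \<Rightarrow> ('a \<Rightarrow> 'a) \<Rightarrow> ('a \<Rightarrow> complex) set \<Rightarrow> (('a \<Rightarrow> complex) \<Rightarrow> real) \<Rightarrow> bool" where
  "property_C M T F nrm \<longleftrightarrow>
     prob_space M \<and> measure_invariant M T \<and> mixing M T \<and>
     function_banach_algebra M F nrm \<and>
     (\<forall>c. (\<lambda>x. c) \<in> F) \<and>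
     (\<forall>f\<in>F. sup_norm M f \<le> ereal (nrm f)) \<and>
     (\<exists>K0>0. \<forall>f\<in>F. transfer_operator M T f \<in> F \<and> nrm (transfer_operator M T f) \<le> K0 * nrm f) \<and>
     has_spectral_gap M F nrm (transfer_operator M T)"

definition trunc :: "real \<Rightarrow> ('a \<Rightarrow> real) \<Rightarrow> 'a \<Rightarrow> real" where
  "trunc l chi x = chi x * indicator {y. chi y \<le> l} x"

definition property_D ::
    "'a measure \<Rightarrow> ('a \<Rightarrow> 'a) \<Rightarrow> ('a \<Rightarrow> complex) set \<Rightarrow> (('a \<Rightarrow> complex) \<Rightarrow> real) \<Rightarrow>
     ('a \<Rightarrow> real) \<Rightarrow> bool" where
  "property_D M T F nrm chi \<longleftrightarrow>
     property_C M T F nrm \<and>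
     chi \<in> borel_measurable M \<and> (\<forall>x\<in>space M. 0 \<le> chi x) \<and>
     (\<exists>K1>0. \<exists>K2>0. \<forall>l>0.
        (\<lambda>x. complex_of_real (trunc l chi x)) \<in> F \<and>
        nrm (\<lambda>x. complex_of_real (trunc l chi x)) \<le> K1 * l \<and>
        indicator {x. chi x > l} \<in> F \<and>
        nrm (indicator {x. chi x > l}) \<le> K2)"

definition truncated_sum :: "('a \<Rightarrow> 'a) \<Rightarrow> ('a \<Rightarrow> real) \<Rightarrow> real \<Rightarrow> nat \<Rightarrow> 'a \<Rightarrow> real" where
  "truncated_sum T chi l n x = (\<Sum>k<n. trunc l chi ((T ^^ k) x))"

section \<open>Growth conditions\<close>

text \<open>The sequences in \<open>Psi_class\<close> are indexed from 1; their value at 0 is irrelevant.\<close>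

definition Psi_class :: "(nat \<Rightarrow> real) set" where
  "Psi_class = {u. (\<forall>n\<ge>1. 0 < u n) \<and> summable (\<lambda>n. 1 / u (Suc n))}"

definition slowly_varying :: "(real \<Rightarrow> real) \<Rightarrow> bool" where
  "slowly_varying L \<longleftrightarrow> (\<forall>c>0. ((\<lambda>x. L (c * x) / L x) \<longlongrightarrow> 1) at_top)"

end

(*  Write G(t) = mu(chi > t) and let N_n(t) be the number of k < n with chi(T^k x) > t.  Layer by
    layer, the truncated sum at level l is the integral of N_n over (0,l] minus l N_n(l), and its
    mean is n times the same expression in G.  So it is enough to compare N_n(t) with n G(t)
    simultaneously for all t <= f_n, and then to absorb the term l G(l) into the mean, which is
    possible because G is regularly varying with index -alpha < 0.

    The spectral gap gives exponential decay of correlations.  For A = {chi > t} the moment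
    generating function of N_n(t) is the integral of the n-th iterate on 1 of g |-> U((1 + u 1_A) g),
    U the transfer operator.  For small u these iterates stay norm-close to constants, relative to
    their integrals, which yields the Chernoff bound exp(- c n p) with c independent of t, because
    the norm of 1_A is bounded.  A union bound over geometric grids of values of G and of n costs
    a constant factor times 1 / psi(floor(log n)) per block of n, which is summable.

    The decay of the powers of N is Gelfand's formula for the spectral radius, obtained
    from averages of the resolvent over roots of unity instead of from complex analysis.  *)

theory Submission
  imports Defs
begin

section \<open>The spectral radius bounds the powers of an operator\<close>

text \<open>Every estimate is relative: a deviation is measured against \<open>n G(t)\<close>, an
  iterate against its integral. This lets one rate \<open>c\<close> serve arbitrarily rare events.
  It also uses that \<open>nrm\<close> dominates the essential supremum: an error bounded in norm,
  once integrated over A, gains the factor mu(A).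

  The uncountably many levels cost no union bound. Visit counts decrease in the level, so the levels
  with \<open>G t \<le> p\<close>, and likewise those with \<open>G t \<ge> p\<close>, give nested
  events, whose union obeys the bound of a single member. Only the values p remain to be summed
  over. The smallest p of a block is of order ln psi / n, where the Chernoff bound is 1 / psi; for
  larger p the exponents grow geometrically.

  The growth condition says that ln psi is o(n G(f_n)), so every level up to f_n lies above this
  smallest p.

  The spectral radius is a supremum over the spectrum, so the decay of powers has to come from the
  mere existence of resolvents. Compactness bounds them uniformly on an annulus, and the radius at
  which powers are controlled is then lowered in steps of fixed length.\<close>

lemma real_affine_iteration_bound:
  fixes x y b w :: real
  assumes "\<And>b. P b \<Longrightarrow> P (y / 3 + b / 3)" "P b" "\<And>b. P b \<Longrightarrow> x \<le> b * w"
  shows "x \<le> y / 2 * w"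
proof -
  \<comment> \<open>\<open>y / 2\<close> is the fixed point of the affine map, and each application
    shrinks the distance to it by the factor 1/3.\<close>
  have P: "P (y / 2 + (b - y / 2) * (1 / 3) ^ j)" for j
  proof (induction j)
    case (Suc j)
    have "y / 3 + (y / 2 + (b - y / 2) * c) / 3 = y / 2 + (b - y / 2) * (1 / 3 * c)" for c
      by (simp add: field_simps)
    from assms(1)[OF Suc, unfolded this] show ?case by (simp only: power_Suc)
  qed (use assms(2) in simp)
  have "(\<lambda>j. (1 / 3 :: real) ^ j) \<longlonglongrightarrow> 0"
    by (rule LIMSEQ_power_zero) auto
  then have "(\<lambda>j. (y / 2 + (b - y / 2) * (1 / 3) ^ j) * w) \<longlonglongrightarrow> (y / 2 + (b - y / 2) * 0) * w"
    by (intro tendsto_mult tendsto_add tendsto_const)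
  then have "x \<le> (y / 2 + (b - y / 2) * 0) * w"
    by (rule LIMSEQ_le_const) (use P assms(3) in blast)
  then show ?thesis by simp
qed

section \<open>Normed algebra and bounded operators modulo null functions\<close>

locale function_algebra =
  fixes M :: "'a measure" and F :: "('a \<Rightarrow> complex) set" and nrm :: "('a \<Rightarrow> complex) \<Rightarrow> real"
  assumes fba: "function_banach_algebra M F nrm"
begin

abbreviation "bop \<equiv> bounded_operator M F nrm"

lemma F_measurable: "f \<in> F \<Longrightarrow> f \<in> borel_measurable M"
  and F_add: "f \<in> F \<Longrightarrow> g \<in> F \<Longrightarrow> (\<lambda>x. f x + g x) \<in> F"
  and F_scale: "f \<in> F \<Longrightarrow> (\<lambda>x. c * f x) \<in> F"
  and F_mult: "f \<in> F \<Longrightarrow> g \<in> F \<Longrightarrow> (\<lambda>x. f x * g x) \<in> F"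
  and nrm_nonneg: "f \<in> F \<Longrightarrow> 0 \<le> nrm f"
  and nrm_eq_0_iff: "f \<in> F \<Longrightarrow> nrm f = 0 \<longleftrightarrow> ae_eq M f (\<lambda>x. 0)"
  and nrm_add: "f \<in> F \<Longrightarrow> g \<in> F \<Longrightarrow> nrm (\<lambda>x. f x + g x) \<le> nrm f + nrm g"
  and nrm_scale: "f \<in> F \<Longrightarrow> nrm (\<lambda>x. c * f x) = cmod c * nrm f"
  and nrm_mult: "f \<in> F \<Longrightarrow> g \<in> F \<Longrightarrow> nrm (\<lambda>x. f x * g x) \<le> nrm f * nrm g"
  using fba unfolding function_banach_algebra_def by blast+

lemma F_diff: "f \<in> F \<Longrightarrow> g \<in> F \<Longrightarrow> (\<lambda>x. f x - g x) \<in> F"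
  using F_add[of f "\<lambda>x. (-1) * g x"] F_scale[of g "-1"] by simp

lemma nrm_diff: "f \<in> F \<Longrightarrow> g \<in> F \<Longrightarrow> nrm (\<lambda>x. f x - g x) \<le> nrm f + nrm g"
  using nrm_add[of f "\<lambda>x. (-1) * g x"] F_scale[of g "-1"] nrm_scale[of g "-1"] by simp

lemma nrm_cong:
  assumes "f \<in> F" "g \<in> F" "ae_eq M f g"
  shows "nrm f = nrm g"
proof -
  have le: "nrm f \<le> nrm g" if "f \<in> F" "g \<in> F" "ae_eq M f g" for f g
  proof -
    have "ae_eq M (\<lambda>x. f x - g x) (\<lambda>x. 0)" using that(3) by eventually_elim simp
    then have "nrm (\<lambda>x. f x - g x) = 0" using nrm_eq_0_iff F_diff that by blast
    with nrm_add[OF that(2) F_diff[OF that(1,2)]] show ?thesis by simp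
  qed
  have "ae_eq M g f" using assms(3) by eventually_elim simp
  with le assms show ?thesis by (meson antisym)
qed

lemmas F_intros = F_add F_scale F_diff F_mult

lemma bop_F: "bop V \<Longrightarrow> f \<in> F \<Longrightarrow> V f \<in> F"
  and bop_add: "bop V \<Longrightarrow> f \<in> F \<Longrightarrow> g \<in> F \<Longrightarrow> ae_eq M (V (\<lambda>x. f x + g x)) (\<lambda>x. V f x + V g x)"
  and bop_scale: "bop V \<Longrightarrow> f \<in> F \<Longrightarrow> ae_eq M (V (\<lambda>x. c * f x)) (\<lambda>x. c * V f x)"
  unfolding bounded_operator_def by blast+

lemma bop_bound:
  assumes "bop V"
  obtains C where "C > 0" "\<And>f. f \<in> F \<Longrightarrow> nrm (V f) \<le> C * nrm f"
proof -
  from assms obtain C where C: "\<And>f. f \<in> F \<Longrightarrow> nrm (V f) \<le> C * nrm f"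
    unfolding bounded_operator_def by blast
  have "nrm (V f) \<le> (max C 1) * nrm f" if "f \<in> F" for f
    using C[OF that] nrm_nonneg[OF that] mult_right_mono[of C "max C 1" "nrm f"] by simp
  then show ?thesis by (intro that[of "max C 1"]) auto
qed

lemma bop_diff:
  assumes "bop V" "f \<in> F" "g \<in> F"
  shows "ae_eq M (V (\<lambda>x. f x - g x)) (\<lambda>x. V f x - V g x)"
proof -
  have "ae_eq M (V (\<lambda>x. f x + (-1) * g x)) (\<lambda>x. V f x + V (\<lambda>x. (-1) * g x) x)"
    using assms by (intro bop_add F_intros)
  with bop_scale[OF assms(1,3), of "-1"]
  show ?thesis by (simp, eventually_elim) simp
qed

lemma bop_cong:
  assumes "bop V" "f \<in> F" "g \<in> F" "ae_eq M f g"
  shows "ae_eq M (V f) (V g)"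
proof -
  obtain C where C: "C > 0" "\<And>f. f \<in> F \<Longrightarrow> nrm (V f) \<le> C * nrm f"
    using bop_bound[OF assms(1)] by blast
  let ?d = "\<lambda>x. f x - g x"
  have "?d \<in> F" using assms F_diff by blast
  moreover have "ae_eq M ?d (\<lambda>x. 0)" using assms(4) by eventually_elim simp
  ultimately have "nrm ?d = 0" using nrm_eq_0_iff by blast
  with C(2)[OF \<open>?d \<in> F\<close>] have "nrm (V ?d) = 0"
    using nrm_nonneg[OF bop_F[OF assms(1) \<open>?d \<in> F\<close>]] by simp
  then have "ae_eq M (V ?d) (\<lambda>x. 0)"
    using nrm_eq_0_iff bop_F assms(1) \<open>?d \<in> F\<close> by blast
  with bop_diff[OF assms(1-3)] show ?thesis by eventually_elim simp
qed

lemma bopI: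
  assumes "\<And>f. f \<in> F \<Longrightarrow> V f \<in> F"
    "\<And>f g. f \<in> F \<Longrightarrow> g \<in> F \<Longrightarrow> ae_eq M (V (\<lambda>x. f x + g x)) (\<lambda>x. V f x + V g x)"
    "\<And>c f. f \<in> F \<Longrightarrow> ae_eq M (V (\<lambda>x. c * f x)) (\<lambda>x. c * V f x)"
    "\<And>f. f \<in> F \<Longrightarrow> nrm (V f) \<le> C * nrm f"
  shows "bop V"
  unfolding bounded_operator_def using assms by blast

lemma bop_comp:
  assumes "bop V" "bop W" shows "bop (\<lambda>f. V (W f))"
proof -
  obtain C where C: "C > 0" "\<And>f. f \<in> F \<Longrightarrow> nrm (V f) \<le> C * nrm f"
    using bop_bound[OF assms(1)] by blast
  obtain D where D: "D > 0" "\<And>f. f \<in> F \<Longrightarrow> nrm (W f) \<le> D * nrm f"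
    using bop_bound[OF assms(2)] by blast
  show ?thesis
  proof (rule bopI)
    fix f g assume fg: "f \<in> F" "g \<in> F"
    have "ae_eq M (V (W (\<lambda>x. f x + g x))) (V (\<lambda>x. W f x + W g x))"
      using fg by (intro bop_cong[OF assms(1)] bop_add[OF assms(2)] bop_F[OF assms(2)] F_intros)
    moreover have "ae_eq M (V (\<lambda>x. W f x + W g x)) (\<lambda>x. V (W f) x + V (W g) x)"
      using fg by (intro bop_add[OF assms(1)] bop_F[OF assms(2)])
    ultimately show "ae_eq M (V (W (\<lambda>x. f x + g x))) (\<lambda>x. V (W f) x + V (W g) x)"
      by eventually_elim simp
  next
    fix c f assume f: "f \<in> F"
    have "ae_eq M (V (W (\<lambda>x. c * f x))) (V (\<lambda>x. c * W f x))"
      using f by (intro bop_cong[OF assms(1)] bop_scale[OF assms(2)] bop_F[OF assms(2)] F_intros)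
    moreover have "ae_eq M (V (\<lambda>x. c * W f x)) (\<lambda>x. c * V (W f) x)"
      using f by (intro bop_scale[OF assms(1)] bop_F[OF assms(2)])
    ultimately show "ae_eq M (V (W (\<lambda>x. c * f x))) (\<lambda>x. c * V (W f) x)"
      by eventually_elim simp
  next
    fix f assume f: "f \<in> F"
    then show "V (W f) \<in> F" using assms bop_F by blast
    have "nrm (V (W f)) \<le> C * nrm (W f)" using C(2) f assms bop_F by blast
    also have "\<dots> \<le> C * (D * nrm f)" using D(2)[OF f] C(1) by simp
    finally show "nrm (V (W f)) \<le> (C * D) * nrm f" by (simp add: mult.assoc)
  qed
qed

lemma bop_funpow: "bop V \<Longrightarrow> bop (V ^^ n)"
proof (induction n)
  case 0
  show ?case unfolding bounded_operator_def by (auto intro: exI[of _ 1])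
next
  case (Suc n)
  from bop_comp[OF Suc.prems Suc.IH[OF Suc.prems]] show ?case by (simp add: comp_def)
qed

lemma funpow_bound:
  assumes "bop V" "0 \<le> C" "\<And>f. f \<in> F \<Longrightarrow> nrm (V f) \<le> C * nrm f" "f \<in> F"
  shows "nrm ((V ^^ n) f) \<le> C ^ n * nrm f"
proof (induction n)
  case (Suc n)
  have "(V ^^ n) f \<in> F" using bop_funpow bop_F assms by blast
  then have "nrm ((V ^^ Suc n) f) \<le> C * nrm ((V ^^ n) f)" using assms(3) by simp
  also have "\<dots> \<le> C * (C ^ n * nrm f)" using Suc assms(2) by (intro mult_left_mono)
  finally show ?case by (simp add: mult.assoc)
qed simp

section \<open>Resolvents and their uniform bounds on compact sets\<close>

definition resolvent_at :: "(('a \<Rightarrow> complex) \<Rightarrow> ('a \<Rightarrow> complex)) \<Rightarrow> complex \<Rightarrow>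
    (('a \<Rightarrow> complex) \<Rightarrow> ('a \<Rightarrow> complex)) \<Rightarrow> bool" where
  "resolvent_at V z W \<longleftrightarrow> bop W \<and>
     (\<forall>f\<in>F. ae_eq M (W (\<lambda>x. z * f x - V f x)) f) \<and>
     (\<forall>f\<in>F. ae_eq M (\<lambda>x. z * W f x - V (W f) x) f)"

text \<open>Apply \<open>W\<close> to \<open>(z - V) W' f = (z - z') W' f + f\<close>:
  \<open>W\<close> enters as a left inverse, \<open>W'\<close> as a right inverse.\<close>

lemma resolvent_identity:
  assumes V: "bop V" and W: "resolvent_at V z W" and W': "resolvent_at V z' W'" and f: "f \<in> F"
  shows "ae_eq M (\<lambda>x. W' f x - W f x) (\<lambda>x. (z - z') * W (W' f) x)"
proof -
  have b: "bop W" "bop W'" using W W' unfolding resolvent_at_def by auto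
  have F': "W' f \<in> F" "V (W' f) \<in> F" using b V f bop_F by auto
  have "ae_eq M (\<lambda>x. z' * W' f x - V (W' f) x) f"
    using W' f unfolding resolvent_at_def by blast
  then have "ae_eq M (\<lambda>x. z * W' f x - V (W' f) x) (\<lambda>x. (z - z') * W' f x + f x)"
    by eventually_elim (simp add: algebra_simps)
  then have "ae_eq M (W (\<lambda>x. z * W' f x - V (W' f) x)) (W (\<lambda>x. (z - z') * W' f x + f x))"
    using b F' f by (intro bop_cong[of W] F_intros)
  moreover have "ae_eq M (W (\<lambda>x. z * W' f x - V (W' f) x)) (W' f)"
    using W F' unfolding resolvent_at_def by blast
  moreover have "ae_eq M (W (\<lambda>x. (z - z') * W' f x + f x)) (\<lambda>x. W (\<lambda>x. (z - z') * W' f x) x + W f x)"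
    using b F' f by (intro bop_add[of W] F_intros)
  moreover have "ae_eq M (W (\<lambda>x. (z - z') * W' f x)) (\<lambda>x. (z - z') * W (W' f) x)"
    using b F' f by (intro bop_scale[of W])
  ultimately show ?thesis by eventually_elim simp
qed

text \<open>\<open>W' f\<close> is left on the right side on purpose: no bound for \<open>W'\<close>
  is assumed, so a bound at one point can be carried to its neighbours.\<close>

lemma resolvent_diff_bound:
  assumes V: "bop V" and W: "resolvent_at V z W" and W': "resolvent_at V z' W'" and f: "f \<in> F"
    and C: "\<And>f. f \<in> F \<Longrightarrow> nrm (W f) \<le> C * nrm f"
  shows "nrm (\<lambda>x. W' f x - W f x) \<le> cmod (z - z') * (C * nrm (W' f))"
proof -
  have b: "bop W" "bop W'" using W W' unfolding resolvent_at_def by auto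
  have F': "W' f \<in> F" "W (W' f) \<in> F" "W f \<in> F" using b f bop_F by auto
  have "nrm (\<lambda>x. W' f x - W f x) = nrm (\<lambda>x. (z - z') * W (W' f) x)"
    using resolvent_identity[OF V W W' f] F' by (intro nrm_cong F_intros)
  also have "\<dots> = cmod (z - z') * nrm (W (W' f))" using nrm_scale F' by blast
  also have "\<dots> \<le> cmod (z - z') * (C * nrm (W' f))"
    using C[OF F'(1)] by (intro mult_left_mono) auto
  finally show ?thesis .
qed

text \<open>Each \<open>W z\<close> has a bound of its own, with no regularity in \<open>z\<close>
  assumed. The resolvent identity makes the bound local, and a finite subcover makes it
  uniform.\<close>

lemma resolvent_bounded_on_compact:
  assumes V: "bop V" and K: "compact K" and W: "\<And>z. z \<in> K \<Longrightarrow> resolvent_at V z (W z)"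
  obtains C where "C > 0" "\<And>z f. z \<in> K \<Longrightarrow> f \<in> F \<Longrightarrow> nrm (W z f) \<le> C * nrm f"
proof -
  have b: "bop (W z)" if "z \<in> K" for z using W that unfolding resolvent_at_def by auto
  have "\<exists>C>0. \<forall>f\<in>F. nrm (W z f) \<le> C * nrm f" if "z \<in> K" for z
    using bop_bound[OF b[OF that]] by metis
  then obtain c where c: "\<And>z. z \<in> K \<Longrightarrow> c z > 0"
      "\<And>z f. z \<in> K \<Longrightarrow> f \<in> F \<Longrightarrow> nrm (W z f) \<le> c z * nrm f" by metis
  have near: "nrm (W z' f) \<le> 2 * c z * nrm f"
    if z: "z \<in> K" "z' \<in> K" "z' \<in> ball z (1 / (2 * c z))" and f: "f \<in> F" for z z' f
  proof -
    have F: "W z f \<in> F" "W z' f \<in> F" using b z f bop_F by blast+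
    have "nrm (\<lambda>x. W z' f x - W z f x) \<le> cmod (z - z') * (c z * nrm (W z' f))"
      using resolvent_diff_bound[OF V W[OF z(1)] W[OF z(2)] f c(2)[OF z(1)]] .
    also have "\<dots> = (cmod (z - z') * c z) * nrm (W z' f)" by simp
    \<comment> \<open>The radius of the ball is chosen for this factor 1/2: half of
      \<open>nrm (W z' f)\<close> is absorbed, leaving twice the bound at \<open>z\<close>.\<close>
    also have "cmod (z - z') * c z \<le> 1 / 2"
      using z(3) c(1)[OF z(1)] by (simp add: dist_norm field_simps)
    then have "(cmod (z - z') * c z) * nrm (W z' f) \<le> 1 / 2 * nrm (W z' f)"
      using nrm_nonneg[OF F(2)] by (intro mult_right_mono)
    finally have "nrm (\<lambda>x. W z' f x - W z f x) \<le> 1 / 2 * nrm (W z' f)" .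
    with nrm_add[OF F(1) F_diff[OF F(2,1)]] c(2)[OF z(1) f] show ?thesis by simp
  qed
  have "K \<subseteq> (\<Union>z\<in>K. ball z (1 / (2 * c z)))" using c(1) by force
  then obtain D where D: "D \<subseteq> K" "finite D" "K \<subseteq> (\<Union>z\<in>D. ball z (1 / (2 * c z)))"
    using K by (meson compactE_image open_ball)
  define C where "C = 1 + (\<Sum>z\<in>D. 2 * c z)"
  have "nrm (W z' f) \<le> C * nrm f" if zf: "z' \<in> K" "f \<in> F" for z' f
  proof -
    obtain z where z: "z \<in> D" "z' \<in> ball z (1 / (2 * c z))" using D(3) zf(1) by blast
    have "2 * c z \<le> (\<Sum>z\<in>D. 2 * c z)"
      using z D c(1) by (intro member_le_sum) (auto intro: less_imp_le)
    then have "2 * c z \<le> C" unfolding C_def by simp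
    then have "2 * c z * nrm f \<le> C * nrm f" using nrm_nonneg zf by (intro mult_right_mono) auto
    with near[of z z' f] z D zf show ?thesis by force
  qed
  moreover have "C > 0" unfolding C_def using D c(1)
    by (intro add_pos_nonneg sum_nonneg) (auto intro!: less_imp_le)
  ultimately show ?thesis using that by blast
qed

text \<open>For \<open>n = 2 ^ k\<close> this is the mean of \<open>(1 - \<omega> N / z)\<inverse>\<close> over the \<open>n\<close>-th roots of unity
  \<open>\<omega>\<close>, hence a right inverse of \<open>1 - N\<^sup>n / z\<^sup>n\<close>.\<close>
primrec root_mean ::
    "(complex \<Rightarrow> ('a \<Rightarrow> complex) \<Rightarrow> 'a \<Rightarrow> complex) \<Rightarrow> nat \<Rightarrow> complex \<Rightarrow> ('a \<Rightarrow> complex) \<Rightarrow> 'a \<Rightarrow> complex"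
  where
  "root_mean W 0 z f = (\<lambda>x. z * W z f x)"
| "root_mean W (Suc k) z f =
     (\<lambda>x. (1 / 2) * (root_mean W k z f x + root_mean W k (cis (pi / 2 ^ k) * z) f x))"

section \<open>Means of resolvents over roots of unity in an annulus\<close>

context
  fixes N W r R C
  assumes N: "bop N" and r: "0 < r" "r \<le> R"
    and W: "\<And>z. r \<le> cmod z \<Longrightarrow> cmod z \<le> R \<Longrightarrow> resolvent_at N z (W z)"
    and C: "C > 0" "\<And>z f. r \<le> cmod z \<Longrightarrow> cmod z \<le> R \<Longrightarrow> f \<in> F \<Longrightarrow> nrm (W z f) \<le> C * nrm f"
begin

lemma W_F: "r \<le> cmod z \<Longrightarrow> cmod z \<le> R \<Longrightarrow> f \<in> F \<Longrightarrow> W z f \<in> F"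
  using W unfolding resolvent_at_def by (blast intro: bop_F)

lemma root_mean_F: "r \<le> cmod z \<Longrightarrow> cmod z \<le> R \<Longrightarrow> f \<in> F \<Longrightarrow> root_mean W k z f \<in> F"
proof (induction k arbitrary: z)
  case 0 then show ?case by (auto intro!: F_intros W_F)
next
  case (Suc k) 
  then show ?case unfolding root_mean.simps by (intro F_intros Suc) (auto simp: norm_mult)
qed

lemma root_mean_bound:
  "r \<le> cmod z \<Longrightarrow> cmod z \<le> R \<Longrightarrow> f \<in> F \<Longrightarrow> nrm (root_mean W k z f) \<le> R * C * nrm f"
proof (induction k arbitrary: z)
  case 0
  have "nrm (root_mean W 0 z f) = cmod z * nrm (W z f)" using 0 W_F nrm_scale by simp
  also have "\<dots> \<le> R * (C * nrm f)" using 0 C W_F nrm_nonneg r by (intro mult_mono) auto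
  finally show ?case by simp
next
  case (Suc k) 
  let ?a = "root_mean W k z f" and ?b = "root_mean W k (cis (pi / 2 ^ k) * z) f"
  have F: "?a \<in> F" "?b \<in> F" using Suc.prems by (auto intro!: root_mean_F simp: norm_mult)
  have "nrm (root_mean W (Suc k) z f) = 1 / 2 * nrm (\<lambda>x. ?a x + ?b x)"
    unfolding root_mean.simps by (subst nrm_scale) (use F F_add in auto)
  also have "\<dots> \<le> 1 / 2 * (nrm ?a + nrm ?b)" using nrm_add F by simp
  also have "\<dots> \<le> 1 / 2 * (R * C * nrm f + R * C * nrm f)"
    using Suc by (intro mult_left_mono add_mono Suc) (auto simp: norm_mult)
  also have "\<dots> = R * C * nrm f" by simp
  finally show ?case .
qed

text \<open>The constant does not depend on \<open>k\<close>, since rotations are isometries that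
  stay in the annulus and averaging preserves a Lipschitz bound. This independence is what makes the
  later descent of the radius proceed in equal steps.\<close>

lemma root_mean_Lipschitz:
  "r \<le> cmod z \<Longrightarrow> cmod z \<le> R \<Longrightarrow> r \<le> cmod z' \<Longrightarrow> cmod z' \<le> R \<Longrightarrow> f \<in> F \<Longrightarrow>
   nrm (\<lambda>x. root_mean W k z f x - root_mean W k z' f x) \<le> (C + R * C * C) * cmod (z - z') * nrm f"
proof (induction k arbitrary: z z')
  case 0
  have F: "W z f \<in> F" "W z' f \<in> F" using W_F 0 by auto
  have "nrm (\<lambda>x. root_mean W 0 z f x - root_mean W 0 z' f x) =
      nrm (\<lambda>x. (z - z') * W z f x + z' * (W z f x - W z' f x))"
    by (simp add: algebra_simps)
  also have "\<dots> \<le> nrm (\<lambda>x. (z - z') * W z f x) + nrm (\<lambda>x. z' * (W z f x - W z' f x))"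
    using F by (intro nrm_add F_intros)
  also have "nrm (\<lambda>x. (z - z') * W z f x) = cmod (z - z') * nrm (W z f)" using F nrm_scale by auto
  also have "\<dots> \<le> cmod (z - z') * (C * nrm f)" using C 0 by (intro mult_left_mono) auto
  also have "nrm (\<lambda>x. z' * (W z f x - W z' f x)) = cmod z' * nrm (\<lambda>x. W z f x - W z' f x)"
    using F nrm_scale F_diff by auto
  also have "\<dots> \<le> R * (cmod (z' - z) * (C * nrm (W z f)))"
    
    using 0 C F r resolvent_diff_bound[OF N W W, of z' z f C]
    by (intro mult_mono nrm_nonneg F_intros) auto
  also have "\<dots> \<le> R * (cmod (z' - z) * (C * (C * nrm f)))"
    using 0 C r by (intro mult_left_mono) auto
  finally show ?case by (simp add: algebra_simps norm_minus_commute)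
next
  case (Suc k)
  define w where "w = cis (pi / 2 ^ k)"
  have w: "cmod w = 1" unfolding w_def by simp
  let ?a = "\<lambda>z. root_mean W k z f"
  let ?d = "\<lambda>z z' x. ?a z x - ?a z' x"
  have F: "?a z \<in> F" "?a z' \<in> F" "?a (w * z) \<in> F" "?a (w * z') \<in> F"
    using Suc.prems w by (auto intro!: root_mean_F simp: norm_mult)
  have "nrm (\<lambda>x. root_mean W (Suc k) z f x - root_mean W (Suc k) z' f x) =
     nrm (\<lambda>x. (1 / 2) * (?d z z' x + ?d (w * z) (w * z') x))"
    by (simp add: w_def algebra_simps)
  also have "\<dots> = 1 / 2 * nrm (\<lambda>x. ?d z z' x + ?d (w * z) (w * z') x)"
    using F by (subst nrm_scale) (auto intro!: F_intros)
  also have "\<dots> \<le> 1 / 2 * (nrm (?d z z') + nrm (?d (w * z) (w * z')))"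
    using F by (intro mult_left_mono nrm_add F_intros) auto
  also have "\<dots> \<le> 1 / 2 * ((C + R * C * C) * cmod (z - z') * nrm f +
      (C + R * C * C) * cmod (w * z - w * z') * nrm f)"
    using Suc.prems w by (intro mult_left_mono add_mono Suc.IH) (auto simp: norm_mult)
  also have "cmod (w * z - w * z') = cmod (z - z')"
    using w by (metis mult_1 norm_mult right_diff_distrib)
  also have "1 / 2 * ((C + R * C * C) * cmod (z - z') * nrm f + (C + R * C * C) * cmod (z - z') * nrm f)
    = (C + R * C * C) * cmod (z - z') * nrm f" by simp
  finally show ?case .
qed

text \<open>Write \<open>p = z ^ 2 ^ k\<close> and \<open>Q = N ^^ 2 ^ k\<close>. The rotation has
  \<open>2 ^ k\<close>-th power -1, so the two means act as p / (p - Q) and p / (p + Q), and their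
  average as p^2 / (p^2 - Q^2).\<close>

lemma root_mean_inverse:
  "r \<le> cmod z \<Longrightarrow> cmod z \<le> R \<Longrightarrow> f \<in> F \<Longrightarrow>
   ae_eq M (\<lambda>x. z ^ 2 ^ k * root_mean W k z f x - (N ^^ 2 ^ k) (root_mean W k z f) x)
     (\<lambda>x. z ^ 2 ^ k * f x)"
proof (induction k arbitrary: z)
  case 0
  have "ae_eq M (N (\<lambda>x. z * W z f x)) (\<lambda>x. z * N (W z f) x)"
    using N W_F 0 by (intro bop_scale) auto
  moreover have "ae_eq M (\<lambda>x. z * W z f x - N (W z f) x) f"
    using W 0 unfolding resolvent_at_def by blast
  ultimately show ?case
    by (simp, eventually_elim) (metis right_diff_distrib)
next
  case (Suc k)
  define w where "w = cis (pi / 2 ^ k)"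
  have w: "cmod w = 1" unfolding w_def by simp
  have "w ^ 2 ^ k = -1" unfolding w_def by (simp add: Complex.DeMoivre)
  then have wz: "(w * z) ^ 2 ^ k = - (z ^ 2 ^ k)" by (simp add: power_mult_distrib)
  define p where "p = z ^ 2 ^ k"
  define Q where "Q = N ^^ 2 ^ k"
  have Q: "bop Q" unfolding Q_def using N bop_funpow by blast
  define a b where "a = root_mean W k z f" and "b = root_mean W k (w * z) f"
  have F: "a \<in> F" "b \<in> F" "Q a \<in> F" "Q b \<in> F" "f \<in> F"
    using Suc.prems w Q unfolding a_def b_def by (auto intro!: root_mean_F bop_F[OF Q] simp: norm_mult)
  have Qa: "ae_eq M (Q (\<lambda>x. p * a x - Q a x)) (\<lambda>x. p * Q a x - Q (Q a) x)"
    if "a \<in> F" for a p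
  proof -
    have "Q a \<in> F" using Q that bop_F by blast
    then have "ae_eq M (Q (\<lambda>x. p * a x - Q a x)) (\<lambda>x. Q (\<lambda>x. p * a x) x - Q (Q a) x)"
      using that Q by (intro bop_diff F_intros)
    with bop_scale[OF Q that, of p] show ?thesis by eventually_elim simp
  qed
  have 1: "ae_eq M (\<lambda>x. p * a x - Q a x) (\<lambda>x. p * f x)"
    unfolding p_def Q_def a_def using Suc by blast
  have 2: "ae_eq M (\<lambda>x. (-p) * b x - Q b x) (\<lambda>x. (-p) * f x)"
    using Suc.IH[of "w * z"] Suc.prems w unfolding p_def Q_def b_def wz by (simp add: norm_mult)
  have 3: "ae_eq M (Q (\<lambda>x. p * a x - Q a x)) (Q (\<lambda>x. p * f x))"
    using F by (intro bop_cong[OF Q] 1 F_intros)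
  have 4: "ae_eq M (Q (\<lambda>x. (-p) * b x - Q b x)) (Q (\<lambda>x. (-p) * f x))"
    using F by (intro bop_cong[OF Q] 2 F_intros)
  have 5: "ae_eq M (Q (\<lambda>x. a x + b x)) (\<lambda>x. Q a x + Q b x)" using F by (intro bop_add Q)
  have 6: "ae_eq M (Q (\<lambda>x. (1/2) * (a x + b x))) (\<lambda>x. (1/2) * Q (\<lambda>x. a x + b x) x)"
    using F by (intro bop_scale Q F_intros)
  have 7: "ae_eq M (Q (\<lambda>x. (1/2) * (a x + b x))) (\<lambda>x. (1/2) * (Q a x + Q b x))"
    using 5 6 by eventually_elim simp
  have 8: "ae_eq M (Q (Q (\<lambda>x. (1/2) * (a x + b x)))) (Q (\<lambda>x. (1/2) * (Q a x + Q b x)))"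
    using F by (intro bop_cong[OF Q] 7 F_intros bop_F[OF Q])
  have 9: "ae_eq M (Q (\<lambda>x. Q a x + Q b x)) (\<lambda>x. Q (Q a) x + Q (Q b) x)" using F by (intro bop_add Q)
  have 10: "ae_eq M (Q (\<lambda>x. (1/2) * (Q a x + Q b x))) (\<lambda>x. (1/2) * Q (\<lambda>x. Q a x + Q b x) x)"
    using F by (intro bop_scale Q F_intros)
  have "ae_eq M (\<lambda>x. p * p * ((1/2) * (a x + b x)) - Q (Q (\<lambda>x. (1/2) * (a x + b x))) x)
     (\<lambda>x. p * p * f x)"
    using Qa[OF F(1), of p] Qa[OF F(2), of "-p"] 1 2 3 4 8 9 10
      bop_scale[OF Q F(5), of p] bop_scale[OF Q F(5), of "-p"]
  proof eventually_elim
    case (elim x)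
    have t: "Q (Q (\<lambda>x. (1/2) * (a x + b x))) x = (1/2) * (Q (Q a) x + Q (Q b) x)"
      using elim(7,8,9) by simp
    have "p * Q a x - Q (Q a) x = p * Q f x" using elim(1,5,10) by simp
    then have i: "Q (Q a) x = p * Q a x - p * Q f x" by (simp add: algebra_simps)
    have "(-p) * Q b x - Q (Q b) x = (-p) * Q f x" using elim(2,6,11) by metis
    then have ii: "Q (Q b) x = p * Q f x - p * Q b x" by (simp add: algebra_simps)
    have iii: "Q a x = p * a x - p * f x" "Q b x = p * f x - p * b x"
      using elim(3,4) by (simp_all add: algebra_simps)
    show ?case unfolding t i ii iii by (simp add: field_simps)
  qed
  moreover have "N ^^ 2 ^ Suc k = (\<lambda>f. Q (Q f))"
    unfolding Q_def by (simp add: mult_2 funpow_add comp_def)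
  moreover have "root_mean W (Suc k) z f = (\<lambda>x. (1/2) * (a x + b x))"
    unfolding a_def b_def w_def by simp
  moreover have "z ^ 2 ^ Suc k = p * p" unfolding p_def by (simp add: mult_2 power_add)
  ultimately show ?case by simp
qed

text \<open>At radius \<open>s\<close> the powers of \<open>N / s\<close> become small, so the root
  mean is nearly the identity. By the Lipschitz bound it is still so at \<open>s'\<close>, and there
  the inverse relation compares the power of \<open>N\<close> with the power of \<open>s'\<close>.
  The allowed drop \<open>s - s'\<close> depends on \<open>C\<close> and \<open>R\<close> only, not
  on \<open>k\<close>.\<close>

lemma radius_step:
  assumes s: "r \<le> s'" "s' \<le> s" "s \<le> R" "(C + R * C * C) * (s - s') \<le> 1 / 6"
    and k: "\<And>f. f \<in> F \<Longrightarrow> nrm ((N ^^ 2 ^ k) f) \<le> s ^ 2 ^ k / 2 * nrm f"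
  shows "\<exists>k. \<forall>f\<in>F. nrm ((N ^^ 2 ^ k) f) \<le> s' ^ 2 ^ k / 2 * nrm f"
proof -
  have s0: "s > 0" "s' > 0" using r s by auto
  have "(\<lambda>j. R * C * (1 / 2) ^ j) \<longlonglongrightarrow> R * C * 0"
    by (intro tendsto_intros LIMSEQ_power_zero) auto
  then have "eventually (\<lambda>j. R * C * (1 / 2) ^ j < 1 / 6) sequentially"
    by (rule order_tendstoD) auto
  \<comment> \<open>The error of the root mean at \<open>s\<close> is thus at most 1/6; the move to
    \<open>s'\<close> adds at most another 1/6.\<close>
  then obtain j where j: "R * C * (1 / 2) ^ j < 1 / 6"
    by (auto simp: eventually_sequentially)
  define n :: nat where "n = 2 ^ (k + j)"
  have Nn: "N ^^ n = (N ^^ 2 ^ k) ^^ 2 ^ j" unfolding n_def by (simp add: power_add funpow_mult mult.commute)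
  have bn: "bop (N ^^ n)" using N bop_funpow by blast
  have small: "nrm ((N ^^ n) f) \<le> s ^ n * (1 / 2) ^ j * nrm f" if "f \<in> F" for f
  proof -
    have "nrm ((N ^^ n) f) \<le> (s ^ 2 ^ k / 2) ^ 2 ^ j * nrm f"
      unfolding Nn using that s0 by (intro funpow_bound k bop_funpow N) auto
    also have "(s ^ 2 ^ k / 2) ^ 2 ^ j = s ^ n * (1 / 2) ^ 2 ^ j"
      unfolding n_def by (simp add: power_divide power_add power_mult)
    also have "\<dots> * nrm f \<le> s ^ n * (1 / 2) ^ j * nrm f"
      using s0 that by (intro mult_right_mono mult_left_mono power_decreasing nrm_nonneg) 
         (auto intro: less_imp_le[OF less_exp])
    finally show ?thesis .
  qed
  define z z' where "z = complex_of_real s" and "z' = complex_of_real s'"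
  have z: "r \<le> cmod z" "cmod z \<le> R" "r \<le> cmod z'" "cmod z' \<le> R" "z \<noteq> 0" "cmod z = s" "cmod z' = s'"
    using s r unfolding z_def z'_def by auto
  have zz': "cmod (z - z') = s - s'"
    using s unfolding z_def z'_def by (metis of_real_diff norm_of_real abs_of_nonneg diff_ge_0_iff_ge)
  have close: "nrm (\<lambda>x. f x - root_mean W (k + j) z' f x) \<le> 1 / 3 * nrm f" if f: "f \<in> F" for f
  proof -
    let ?S = "root_mean W (k + j) z f" and ?S' = "root_mean W (k + j) z' f"
    have F: "?S \<in> F" "?S' \<in> F" "(N ^^ n) ?S \<in> F" using z f root_mean_F bop_F[OF bn] by blast+
    have "ae_eq M (\<lambda>x. z ^ n * ?S x - (N ^^ n) ?S x) (\<lambda>x. z ^ n * f x)"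
      unfolding n_def using z f by (intro root_mean_inverse)
    then have "ae_eq M (\<lambda>x. ?S x - f x) (\<lambda>x. (1 / z ^ n) * (N ^^ n) ?S x)"
      by eventually_elim (simp add: field_simps z(5))
    then have "nrm (\<lambda>x. ?S x - f x) = nrm (\<lambda>x. (1 / z ^ n) * (N ^^ n) ?S x)"
      using F f by (intro nrm_cong F_intros)
    also have "\<dots> = (1 / s ^ n) * nrm ((N ^^ n) ?S)"
      using F s0 z(6) by (subst nrm_scale) (auto simp: norm_divide norm_power)
    also have "\<dots> \<le> (1 / s ^ n) * (s ^ n * (1 / 2) ^ j * nrm ?S)"
      using small F s0 by (intro mult_left_mono) auto
    also have "\<dots> = (1 / 2) ^ j * nrm ?S" using s0 by simp
    also have "\<dots> \<le> (1 / 2) ^ j * (R * C * nrm f)"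
      using z f by (intro mult_left_mono root_mean_bound) auto
    also have "\<dots> = (R * C * (1 / 2) ^ j) * nrm f" by simp
    also have "\<dots> \<le> 1 / 6 * nrm f" using j nrm_nonneg[OF f] by (intro mult_right_mono) auto
    finally have 1: "nrm (\<lambda>x. ?S x - f x) \<le> 1 / 6 * nrm f" .
    have "nrm (\<lambda>x. ?S x - ?S' x) \<le> (C + R * C * C) * (s - s') * nrm f"
      using root_mean_Lipschitz[OF z(1-4) f] zz' by simp
    also have "\<dots> \<le> 1 / 6 * nrm f" using s(4) nrm_nonneg[OF f] by (intro mult_right_mono) auto
    finally have 2: "nrm (\<lambda>x. ?S x - ?S' x) \<le> 1 / 6 * nrm f" .
    have "nrm (\<lambda>x. f x - ?S' x) = nrm (\<lambda>x. (?S x - ?S' x) - (?S x - f x))" by simp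
    also have "\<dots> \<le> nrm (\<lambda>x. ?S x - ?S' x) + nrm (\<lambda>x. ?S x - f x)"
      using F f by (intro nrm_diff F_intros)
    finally show ?thesis using 1 2 by simp
  qed
  \<comment> \<open>With S' the root mean at \<open>s'\<close>,
    \<open>N^n f = N^n (f - S' f) + s'^n (S' f - f)\<close>. Both differences have norm at most a
    third of \<open>nrm f\<close>, so a bound \<open>b\<close> improves to a third of
    \<open>s'^n + b\<close>.\<close>
  have improve: "\<forall>f\<in>F. nrm ((N ^^ n) f) \<le> (s' ^ n / 3 + b / 3) * nrm f"
    if b: "\<forall>f\<in>F. nrm ((N ^^ n) f) \<le> b * nrm f" "0 \<le> b" for b
  proof
    fix f assume f: "f \<in> F"
    let ?S' = "root_mean W (k + j) z' f"
    have F: "?S' \<in> F" "(N ^^ n) ?S' \<in> F" "(N ^^ n) f \<in> F" "(\<lambda>x. f x - ?S' x) \<in> F"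
      "(N ^^ n) (\<lambda>x. f x - ?S' x) \<in> F"
      using z f root_mean_F bop_F[OF bn] F_diff by blast+
    have "ae_eq M (\<lambda>x. z' ^ n * ?S' x - (N ^^ n) ?S' x) (\<lambda>x. z' ^ n * f x)"
      unfolding n_def using z f by (intro root_mean_inverse)
    with bop_diff[OF bn f F(1)]
    have "ae_eq M ((N ^^ n) f) (\<lambda>x. (N ^^ n) (\<lambda>x. f x - ?S' x) x - z' ^ n * (f x - ?S' x))"
      by eventually_elim (simp add: algebra_simps)
    then have "nrm ((N ^^ n) f) = nrm (\<lambda>x. (N ^^ n) (\<lambda>x. f x - ?S' x) x - z' ^ n * (f x - ?S' x))"
      using F f by (intro nrm_cong F_intros)
    also have "\<dots> \<le> nrm ((N ^^ n) (\<lambda>x. f x - ?S' x)) + nrm (\<lambda>x. z' ^ n * (f x - ?S' x))"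
      using F f by (intro nrm_diff F_intros)
    also have "nrm (\<lambda>x. z' ^ n * (f x - ?S' x)) = s' ^ n * nrm (\<lambda>x. f x - ?S' x)"
      using F s0 z(7) by (subst nrm_scale) (auto simp: norm_power)
    also have "\<dots> \<le> s' ^ n * (1 / 3 * nrm f)" using close[OF f] s0 by (intro mult_left_mono) auto
    also have "nrm ((N ^^ n) (\<lambda>x. f x - ?S' x)) \<le> b * nrm (\<lambda>x. f x - ?S' x)" using b F by blast
    also have "\<dots> \<le> b * (1 / 3 * nrm f)" using close[OF f] b by (intro mult_left_mono) auto
    finally show "nrm ((N ^^ n) f) \<le> (s' ^ n / 3 + b / 3) * nrm f" by (simp add: algebra_simps)
  qed
  obtain b where b: "b > 0" "\<And>f. f \<in> F \<Longrightarrow> nrm ((N ^^ n) f) \<le> b * nrm f"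
    using bop_bound[OF bn] by blast
  have "\<forall>f\<in>F. nrm ((N ^^ n) f) \<le> s' ^ n / 2 * nrm f"
  proof
    fix f assume f: "f \<in> F"
    \<comment> \<open>Iterating the improvement from the crude bound \<open>b\<close> reaches the
      fixed point \<open>s' ^ n / 2\<close> in the limit, so a least operator bound need not be
      introduced.\<close>
    show "nrm ((N ^^ n) f) \<le> s' ^ n / 2 * nrm f"
      by (rule real_affine_iteration_bound[where b = b and
          P = "\<lambda>b. 0 \<le> b \<and> (\<forall>f\<in>F. nrm ((N ^^ n) f) \<le> b * nrm f)"])
        (use improve s0 b f in auto)
  qed
  then show ?thesis unfolding n_def by blast
qed

end

section \<open>Descent of the radius and geometric decay of all powers\<close>

lemma nonneg_step_down:
  fixes P :: "real \<Rightarrow> bool"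
  assumes "P R" "r \<le> R" "d > 0" and step: "\<And>s s'. P s \<Longrightarrow> r \<le> s' \<Longrightarrow> s' \<le> s \<Longrightarrow> s \<le> R \<Longrightarrow> s - s' \<le> d \<Longrightarrow> P s'"
  shows "P r"
proof -
  have "P (max r (R - real n * d))" for n
  proof (induction n)
    case (Suc n)
    define y where "y = R - real n * d"
    have y: "R - real (Suc n) * d = y - d" unfolding y_def by (simp add: algebra_simps)
    have "y \<le> R" unfolding y_def using assms(3) by simp
    have P: "P (max r y)" using Suc unfolding y_def .
    show ?case unfolding y
      by (rule step[OF P]) (use \<open>y \<le> R\<close> assms(2,3) in \<open>auto simp: max_def\<close>)
  qed (use assms in \<open>simp add: max_def\<close>)
  moreover obtain n where "(R - r) / d \<le> real n" using real_arch_simple by blast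
  then have "R - r \<le> real n * d" using assms(3) by (simp add: pos_divide_le_eq)
  then have "max r (R - real n * d) = r" by simp
  ultimately show ?thesis by metis
qed

text \<open>The descent runs from \<open>R\<close>, where the operator bound suffices, to a radius
  \<open>r\<close> strictly between the spectral radius and \<open>\<rho>\<close>; every point of
  modulus at least \<open>r\<close> has a resolvent. At \<open>r\<close> a single power is
  controlled, and division with remainder extends this to all powers.\<close>

lemma power_bound_of_spectral_radius:
  assumes N: "bop N" and rad: "operator_spectral_radius M F nrm N < ennreal \<rho>"
  obtains r C where "0 < r" "r < \<rho>" "C > 0" "\<And>n f. f \<in> F \<Longrightarrow> nrm ((N ^^ n) f) \<le> C * r ^ n * nrm f"
proof -
  from rad obtain q where q: "operator_spectral_radius M F nrm N < q" "q < ennreal \<rho>"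
    using dense by blast
  define r where "r = enn2real q"
  have qr: "q = ennreal r" using q unfolding r_def by (metis ennreal_enn2real ennreal_less_top order_less_trans)
  \<comment> \<open>Holds even if the spectrum is empty and the supremum is 0, because
    \<open>q\<close> lies strictly above it.\<close>
  have "0 < q" using q(1) by (metis gr_zeroI not_less_zero)
  then have r: "0 < r" using qr by simp
  have "r < \<rho>" using q(2) r unfolding qr by (simp add: ennreal_less_iff)
  have "\<exists>W. resolvent_at N z W" if "r \<le> cmod z" for z
  proof -
    have "z \<notin> operator_spectrum M F nrm N"
    proof
      assume "z \<in> operator_spectrum M F nrm N"
      then have "ennreal (cmod z) \<le> operator_spectral_radius M F nrm N"
        unfolding operator_spectral_radius_def by (intro SUP_upper)
      also have "\<dots> < ennreal r" using q qr by simp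
      finally show False using that r by (simp add: ennreal_less_iff)
    qed
    then show ?thesis unfolding operator_spectrum_def resolvent_at_def by blast
  qed
  then obtain W where W: "\<And>z. r \<le> cmod z \<Longrightarrow> resolvent_at N z (W z)" by metis
  obtain B where B: "B > 0" "\<And>f. f \<in> F \<Longrightarrow> nrm (N f) \<le> B * nrm f" using bop_bound[OF N] by blast
  \<comment> \<open>Twice the bound of \<open>N\<close>, so that the descent can start with the
    first power, \<open>k = 0\<close>.\<close>
  define R where "R = max r (2 * B)"
  have "compact (cball 0 R - ball (0::complex) r)"
    by (intro compact_diff compact_cball open_ball)
  then obtain C where C: "C > 0" "\<And>z f. z \<in> cball 0 R - ball 0 r \<Longrightarrow> f \<in> F \<Longrightarrow> nrm (W z f) \<le> C * nrm f"
    using resolvent_bounded_on_compact[OF N, of "cball 0 R - ball 0 r" W] W by auto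
  let ?P = "\<lambda>s. \<exists>k. \<forall>f\<in>F. nrm ((N ^^ 2 ^ k) f) \<le> s ^ 2 ^ k / 2 * nrm f"
  \<comment> \<open>The largest drop that \<open>radius_step\<close> permits, the same at every
    radius.\<close>
  define d where "d = 1 / (6 * (C + R * C * C))"
  have R: "R > 0" "r \<le> R" unfolding R_def using r by auto
  have pos: "C + R * C * C > 0" using C R by (simp add: add_pos_pos)
  have "?P r"
  proof (rule nonneg_step_down[where P = ?P and R = R and d = d])
    have "nrm ((N ^^ 2 ^ 0) f) \<le> R ^ 2 ^ 0 / 2 * nrm f" if "f \<in> F" for f
    proof -
      have "B * nrm f \<le> R / 2 * nrm f" unfolding R_def using that nrm_nonneg by (intro mult_right_mono) auto
      with B(2)[OF that] show ?thesis by simp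
    qed
    then show "?P R" by blast
    show "d > 0" unfolding d_def using pos by simp
    show "?P s'" if s: "?P s" "r \<le> s'" "s' \<le> s" "s \<le> R" "s - s' \<le> d" for s s'
    proof -
      from s(1) obtain k where k: "\<And>f. f \<in> F \<Longrightarrow> nrm ((N ^^ 2 ^ k) f) \<le> s ^ 2 ^ k / 2 * nrm f" by blast
      have "(C + R * C * C) * (s - s') \<le> 1 / 6"
        using s(5) pos unfolding d_def by (simp add: field_simps)
      from radius_step[OF N r R(2) W C(1) C(2) s(2-4) this k] show ?thesis by auto
    qed
  qed (use R in auto)
  then obtain k where k: "\<And>f. f \<in> F \<Longrightarrow> nrm ((N ^^ 2 ^ k) f) \<le> r ^ 2 ^ k / 2 * nrm f" by blast
  define n :: nat where "n = 2 ^ k"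
  have Nn: "nrm ((N ^^ n) f) \<le> r ^ n * nrm f" if "f \<in> F" for f
  proof -
    have "r ^ n / 2 * nrm f \<le> r ^ n * nrm f" using r nrm_nonneg[OF that] by (intro mult_right_mono) auto
    with k[OF that] show ?thesis unfolding n_def by linarith
  qed
  \<comment> \<open>Pays for the fewer than \<open>n\<close> left-over applications of
    \<open>N\<close>, each costing \<open>B\<close> instead of \<open>r\<close>.\<close>
  define D where "D = (\<Sum>i<n. (B / r) ^ i)"
  have n: "n > 0" unfolding n_def by simp
  have D: "(B / r) ^ i \<le> D" if "i < n" for i
    unfolding D_def using that B r by (intro member_le_sum) auto
  have D0: "D > 0" using D[of 0] n by simp
  have "nrm ((N ^^ m) f) \<le> D * r ^ m * nrm f" if f: "f \<in> F" for m f
  proof -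
    let ?q = "m div n" and ?i = "m mod n"
    have "N ^^ m = N ^^ (?i + n * ?q)" by simp
    also have "\<dots> = (\<lambda>f. (N ^^ ?i) (((N ^^ n) ^^ ?q) f))"
      unfolding funpow_add funpow_mult by (simp add: comp_def)
    finally have e: "(N ^^ m) f = (N ^^ ?i) (((N ^^ n) ^^ ?q) f)" by metis
    have g: "((N ^^ n) ^^ ?q) f \<in> F" using N bop_funpow bop_F f by blast
    have "nrm ((N ^^ m) f) \<le> B ^ ?i * nrm (((N ^^ n) ^^ ?q) f)"
      unfolding e using N B g by (intro funpow_bound) auto
    also have "\<dots> \<le> B ^ ?i * ((r ^ n) ^ ?q * nrm f)"
      using N B f r by (intro mult_left_mono funpow_bound Nn bop_funpow) auto
    also have "\<dots> = (B / r) ^ ?i * (r ^ ?i * (r ^ n) ^ ?q) * nrm f"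
      using r by (simp add: power_divide)
    also have "r ^ ?i * (r ^ n) ^ ?q = r ^ m"
      by (metis mod_mult_div_eq power_add power_mult)
    also have "(B / r) ^ ?i * r ^ m * nrm f \<le> D * r ^ m * nrm f"
      using D[of ?i] n r nrm_nonneg[OF f] by (intro mult_right_mono) auto
    finally show ?thesis .
  qed
  with D0 r \<open>r < \<rho>\<close> that show ?thesis by blast
qed

end

section \<open>Decay of correlations\<close>

lemma Linfty_iff:
  "g \<in> Linfty M \<longleftrightarrow> g \<in> borel_measurable M \<and> (\<exists>B. AE x in M. cmod (g x) \<le> B)"
proof (intro iffI conjI)
  assume g: "g \<in> Linfty M"
  then show "g \<in> borel_measurable M" unfolding Linfty_def by simp
  define s where "s = sup_norm M g"
  have "s < \<infinity>" using g unfolding Linfty_def s_def by simp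
  then have "s \<le> ereal (real_of_ereal (max s 0))" by (cases s) (auto simp: max_def)
  moreover have "AE x in M. ereal (cmod (g x)) \<le> s" unfolding s_def sup_norm_def by (rule esssup_AE)
  ultimately have "AE x in M. cmod (g x) \<le> real_of_ereal (max s 0)"
    by (auto elim!: eventually_mono dest: order_trans)
  then show "\<exists>B. AE x in M. cmod (g x) \<le> B" by blast
next
  assume "g \<in> borel_measurable M \<and> (\<exists>B. AE x in M. cmod (g x) \<le> B)"
  then obtain B where B: "AE x in M. cmod (g x) \<le> B" and [measurable]: "g \<in> borel_measurable M" by blast
  from B have "sup_norm M g \<le> ereal B" unfolding sup_norm_def by (intro esssup_I) auto
  then have "sup_norm M g < \<infinity>" by (rule order_le_less_trans) simp
  then show "g \<in> Linfty M" unfolding Linfty_def by simp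
qed

lemma integrable_mult_Linfty:
  assumes f: "integrable M f" and g: "g \<in> Linfty M"
  shows "integrable M (\<lambda>x. f x * g x :: complex)"
proof -
  from g obtain B where B: "AE x in M. cmod (g x) \<le> B" and g[measurable]: "g \<in> borel_measurable M"
    unfolding Linfty_iff by blast
  show ?thesis
  proof (rule Bochner_Integration.integrable_bound)
    show "integrable M (\<lambda>x. B * cmod (f x))" using f by auto
    show "(\<lambda>x. f x * g x) \<in> borel_measurable M" using f by measurable
    show "AE x in M. norm (f x * g x) \<le> norm (B * cmod (f x))"
      using B
    proof eventually_elim
      case (elim x)
      then have "cmod (f x) * cmod (g x) \<le> cmod (f x) * \<bar>B\<bar>" by (intro mult_left_mono) auto
      then show ?case by (simp add: norm_mult mult.commute)
    qed
  qed
qed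

text \<open>The function sought is the Radon-Nikodym derivative of the image under \<open>T\<close>
  of the measure with density \<open>f\<close>. Invariance makes preimages of null sets null, which
  gives absolute continuity.\<close>

lemma (in prob_space) transfer_exists_nonneg:
  fixes f :: "'a \<Rightarrow> real"
  assumes T[measurable]: "T \<in> measurable M M" and inv: "distr M M T = M"
    and f: "integrable M f" "\<And>x. 0 \<le> f x"
  shows "\<exists>h :: 'a \<Rightarrow> real. integrable M h \<and>
    (\<forall>g \<in> borel_measurable M. (\<integral>x. h x *\<^sub>R g x \<partial>M) = (\<integral>x. f x *\<^sub>R (g (T x) :: complex) \<partial>M))"
proof -
  have [measurable]: "f \<in> borel_measurable M" using f by simp
  define \<nu> where "\<nu> = distr (density M f) M T"
  have s: "sets \<nu> = sets M" unfolding \<nu>_def by simp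
  have em: "emeasure \<nu> A = (\<integral>\<^sup>+x. ennreal (f x) * indicator (T -` A \<inter> space M) x \<partial>M)"
    if [measurable]: "A \<in> sets M" for A
    unfolding \<nu>_def by (simp add: emeasure_distr emeasure_density)
  have "absolutely_continuous M \<nu>"
    unfolding absolutely_continuous_def
  proof
    fix A assume A: "A \<in> null_sets M"
    then have [measurable]: "A \<in> sets M" by auto
    have "emeasure M (T -` A \<inter> space M) = emeasure (distr M M T) A" by (simp add: emeasure_distr)
    also have "\<dots> = 0" using A unfolding inv by auto
    finally have "T -` A \<inter> space M \<in> null_sets M" by auto
    then have "AE x in M. x \<notin> T -` A \<inter> space M" by (rule AE_not_in)
    then have "(\<integral>\<^sup>+x. ennreal (f x) * indicator (T -` A \<inter> space M) x \<partial>M) = (\<integral>\<^sup>+x. 0 \<partial>M)"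
      by (intro nn_integral_cong_AE) (auto elim: eventually_mono)
    then show "A \<in> null_sets \<nu>" using em[of A] s by (auto simp: null_sets_def)
  qed
  from Radon_Nikodym[OF this s] obtain h where h[measurable]: "h \<in> borel_measurable M" "density M h = \<nu>"
    by blast
  have "(\<integral>\<^sup>+x. h x \<partial>M) = emeasure \<nu> (space M)"
    unfolding h(2)[symmetric] by (simp add: emeasure_density cong: nn_integral_cong)
  also have "\<dots> = (\<integral>\<^sup>+x. ennreal (f x) \<partial>M)"
    by (subst em) (auto intro!: nn_integral_cong simp: measurable_space[OF T])
  also have "\<dots> < \<infinity>" using f by (simp add: nn_integral_eq_integral)
  finally have fin: "(\<integral>\<^sup>+x. h x \<partial>M) < \<infinity>" .
  then have "AE x in M. h x \<noteq> \<infinity>" by (intro nn_integral_PInf_AE) auto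
  then have ae: "AE x in M. h x = ennreal (enn2real (h x))"
    by eventually_elim (simp add: less_top)
  have int: "integrable M (\<lambda>x. enn2real (h x))"
  proof (rule integrableI_bounded)
    have "(\<integral>\<^sup>+x. ennreal (norm (enn2real (h x))) \<partial>M) = (\<integral>\<^sup>+x. h x \<partial>M)"
      using ae by (intro nn_integral_cong_AE) (auto elim: eventually_mono)
    with fin show "(\<integral>\<^sup>+x. ennreal (norm (enn2real (h x))) \<partial>M) < \<infinity>" by simp
  qed simp
  have d: "density M (\<lambda>x. ennreal (enn2real (h x))) = \<nu>"
    unfolding h(2)[symmetric] using ae by (intro density_cong) (auto elim: eventually_mono)
  have "(\<integral>x. enn2real (h x) *\<^sub>R g x \<partial>M) = (\<integral>x. f x *\<^sub>R (g (T x) :: complex) \<partial>M)"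
    if [measurable]: "g \<in> borel_measurable M" for g
  proof -
    have "(\<integral>x. enn2real (h x) *\<^sub>R g x \<partial>M) = integral\<^sup>L \<nu> g"
      unfolding d[symmetric] by (intro integral_density[symmetric]) auto
    also have "\<dots> = (\<integral>x. g (T x) \<partial>density M f)"
      unfolding \<nu>_def by (intro integral_distr) auto
    also have "\<dots> = (\<integral>x. f x *\<^sub>R g (T x) \<partial>M)"
      using f by (intro integral_density) auto
    finally show ?thesis .
  qed
  with int show ?thesis by blast
qed

text \<open>Ensures that the choice in \<open>transfer_operator\<close> picks a function with the
  duality property. The complex case is assembled from the positive and negative parts of the real
  and imaginary parts.\<close>

lemma (in prob_space) transfer_exists:
  assumes T[measurable]: "T \<in> measurable M M" and inv: "distr M M T = M" and f: "integrable M f"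
  shows "\<exists>h. integrable M h \<and>
    (\<forall>g\<in>Linfty M. (\<integral>x. h x * g x \<partial>M) = (\<integral>x. f x * g (T x) \<partial>M))"
proof -
  let ?f = "\<lambda>k x. [max 0 (Re (f x)), max 0 (- Re (f x)), max 0 (Im (f x)), max 0 (- Im (f x))] ! k"
  have fi: "integrable M (?f k)" if "k < 4" for k
  proof -
    have "k = 0 \<or> k = 1 \<or> k = 2 \<or> k = 3" using that by linarith
    then show ?thesis using f by auto
  qed
  define Q where "Q k h \<longleftrightarrow> integrable M h \<and> (\<forall>g \<in> borel_measurable M.
    (\<integral>x. h x *\<^sub>R g x \<partial>M) = (\<integral>x. ?f k x *\<^sub>R (g (T x) :: complex) \<partial>M))"
    for k and h :: "'a \<Rightarrow> real"
  have "\<exists>h. Q k h" if k: "k < 4" for k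
    unfolding Q_def
  proof (rule transfer_exists_nonneg[OF T inv fi[OF k]])
    have "k = 0 \<or> k = 1 \<or> k = 2 \<or> k = 3" using that by linarith
    then show "0 \<le> ?f k x" for x by auto
  qed
  then obtain h where Q: "\<And>k. k < 4 \<Longrightarrow> Q k (h k)" by metis
  have h: "integrable M (h k)"
    "g \<in> borel_measurable M \<Longrightarrow>
      (\<integral>x. h k x *\<^sub>R g x \<partial>M) = (\<integral>x. ?f k x *\<^sub>R (g (T x) :: complex) \<partial>M)"
    if "k < 4" for k g
    using Q[OF that] unfolding Q_def by blast+
  define c where "c k = [1, -1, \<i>, -\<i>] ! k" for k :: nat
  define H where "H x = (\<Sum>k<4. c k * complex_of_real (h k x))" for x
  have fsum: "f x = (\<Sum>k<4. c k * complex_of_real (?f k x))" for x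
    unfolding c_def by (simp add: numeral_eq_Suc complex_eq_iff max_def)
  show ?thesis
  proof (intro exI[of _ H] conjI ballI)
    show "integrable M H" unfolding H_def using h(1)
      by (intro Bochner_Integration.integrable_sum integrable_mult_right integrable_of_real) auto
    fix g assume g: "g \<in> Linfty M"
    then have [measurable]: "g \<in> borel_measurable M" unfolding Linfty_def by simp
    from g obtain B where B: "AE x in M. cmod (g x) \<le> B" unfolding Linfty_iff by blast
    have gT: "(\<lambda>x. g (T x)) \<in> Linfty M"
      unfolding Linfty_iff
    proof
      show "(\<lambda>x. g (T x)) \<in> borel_measurable M" by measurable
      have "AE x in distr M M T. cmod (g x) \<le> B" using B unfolding inv .
      from AE_distrD[OF T this] show "\<exists>B. AE x in M. cmod (g (T x)) \<le> B" by blast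
    qed
    have lin: "(\<integral>x. (\<Sum>k<4. c k * complex_of_real (u k x)) * g' x \<partial>M) =
        (\<Sum>k<4. c k * (\<integral>x. u k x *\<^sub>R g' x \<partial>M))"
      if u: "\<And>k. k < 4 \<Longrightarrow> integrable M (u k)" and g': "g' \<in> Linfty M" for u :: "nat \<Rightarrow> 'a \<Rightarrow> real" and g'
    proof -
      have "integrable M (\<lambda>x. c k * (complex_of_real (u k x) * g' x))" if "k < 4" for k
        using integrable_mult_Linfty[OF integrable_of_real[OF u[OF that]] g'] by (rule integrable_mult_right)
      then have "(\<integral>x. (\<Sum>k<4. c k * (complex_of_real (u k x) * g' x)) \<partial>M) =
          (\<Sum>k<4. \<integral>x. c k * (complex_of_real (u k x) * g' x) \<partial>M)"
        by (intro Bochner_Integration.integral_sum) simp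
      then show ?thesis
        by (simp only: sum_distrib_right mult.assoc integral_mult_right_zero scaleR_conv_of_real)
    qed
    have "(\<integral>x. H x * g x \<partial>M) = (\<Sum>k<4. c k * (\<integral>x. h k x *\<^sub>R g x \<partial>M))"
      unfolding H_def using h(1) g by (rule lin)
    also have "\<dots> = (\<Sum>k<4. c k * (\<integral>x. ?f k x *\<^sub>R g (T x) \<partial>M))"
      by (intro sum.cong refl) (simp add: h(2))
    also have "\<dots> = (\<integral>x. (\<Sum>k<4. c k * complex_of_real (?f k x)) * g (T x) \<partial>M)"
      by (rule lin[OF fi gT, symmetric])
    also have "\<dots> = (\<integral>x. f x * g (T x) \<partial>M)"
      by (simp only: fsum[symmetric])
    finally show "(\<integral>x. H x * g x \<partial>M) = (\<integral>x. f x * g (T x) \<partial>M)" .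
  qed
qed

section \<open>Duality, invariance and the fixed function 1\<close>

locale property_C_system =
  fixes M :: "'a measure" and T :: "'a \<Rightarrow> 'a" and F :: "('a \<Rightarrow> complex) set" and nrm
  assumes property_C: "property_C M T F nrm"

sublocale property_C_system \<subseteq> prob_space M
  using property_C unfolding property_C_def by blast

sublocale property_C_system \<subseteq> function_algebra M F nrm
  using property_C unfolding property_C_def function_algebra_def by blast

context property_C_system
begin

abbreviation "U \<equiv> transfer_operator M T"

lemma T_measurable[measurable]: "T \<in> measurable M M" and T_invariant: "distr M M T = M"
  and F_const: "(\<lambda>x. c) \<in> F"
  and sup_norm_le: "f \<in> F \<Longrightarrow> sup_norm M f \<le> ereal (nrm f)"
  and spectral_gap: "has_spectral_gap M F nrm U"
  using property_C unfolding property_C_def measure_invariant_def by blast+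

lemma bop_U: "bop U"
  using spectral_gap unfolding has_spectral_gap_def by blast

lemma AE_norm_le: "f \<in> F \<Longrightarrow> AE x in M. cmod (f x) \<le> nrm f"
proof -
  assume f: "f \<in> F"
  have "AE x in M. ereal (cmod (f x)) \<le> sup_norm M f" unfolding sup_norm_def by (rule esssup_AE)
  then show ?thesis by eventually_elim (use sup_norm_le[OF f] in \<open>force dest: order_trans\<close>)
qed

lemma F_Linfty: "f \<in> F \<Longrightarrow> f \<in> Linfty M"
  unfolding Linfty_iff using AE_norm_le F_measurable by blast

lemma F_integrable: "f \<in> F \<Longrightarrow> integrable M f"
  using AE_norm_le F_measurable by (intro integrable_const_bound)

lemma norm_integral_le:
  assumes "f \<in> F" shows "cmod (\<integral>x. f x \<partial>M) \<le> nrm f"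
proof -
  have "cmod (\<integral>x. f x \<partial>M) \<le> (\<integral>x. cmod (f x) \<partial>M)" by (rule integral_norm_bound)
  also have "\<dots> \<le> (\<integral>x. nrm f \<partial>M)"
    using AE_norm_le F_integrable assms by (intro integral_mono_AE) auto
  finally show ?thesis by (simp add: prob_space)
qed

lemma AE_T: "AE x in M. P x \<Longrightarrow> AE x in M. P (T x)"
proof -
  assume "AE x in M. P x"
  then have "AE x in distr M M T. P x" unfolding T_invariant .
  from AE_distrD[OF T_measurable this] show ?thesis .
qed

lemma Linfty_T: "g \<in> Linfty M \<Longrightarrow> (\<lambda>x. g (T x)) \<in> Linfty M"
  unfolding Linfty_iff using AE_T by fastforce

lemma integral_T: "g \<in> borel_measurable M \<Longrightarrow> (\<integral>x. g (T x) \<partial>M) = (\<integral>x. g x \<partial>M)"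
  for g :: "'a \<Rightarrow> 'b::{banach, second_countable_topology}"
  using integral_distr[OF T_measurable, of g] T_invariant by simp

lemma integral_U:
  assumes "f \<in> F" "g \<in> Linfty M"
  shows "(\<integral>x. U f x * g x \<partial>M) = (\<integral>x. f x * g (T x) \<partial>M)"
  using someI_ex[OF transfer_exists[OF T_measurable T_invariant F_integrable[OF assms(1)]]] assms(2)
  unfolding transfer_operator_def by blast

lemma integral_U_funpow:
  assumes "f \<in> F" "g \<in> Linfty M"
  shows "(\<integral>x. (U ^^ n) f x * g x \<partial>M) = (\<integral>x. f x * g ((T ^^ n) x) \<partial>M)"
  using assms(2)
proof (induction n arbitrary: g)
  case (Suc n)
  have "(\<integral>x. (U ^^ Suc n) f x * g x \<partial>M) = (\<integral>x. (U ^^ n) f x * g (T x) \<partial>M)"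
    using integral_U[OF bop_F[OF bop_funpow[OF bop_U] assms(1)] Suc.prems, of n] by simp
  also have "\<dots> = (\<integral>x. f x * g (T ((T ^^ n) x)) \<partial>M)"
    using Suc.IH[OF Linfty_T[OF Suc.prems]] .
  finally show ?case by simp
qed simp

lemma AE_zero_if_square_integral_zero:
  assumes "f \<in> F" "(\<integral>x. f x * cnj (f x) \<partial>M) = 0"
  shows "ae_eq M f (\<lambda>x. 0)"
proof -
  have [measurable]: "f \<in> borel_measurable M" using assms F_measurable by simp
  have i: "integrable M (\<lambda>x. (cmod (f x))\<^sup>2)"
  proof (rule integrable_const_bound[where B = "(nrm f)\<^sup>2"])
    show "AE x in M. norm ((cmod (f x))\<^sup>2) \<le> (nrm f)\<^sup>2"
      using AE_norm_le[OF assms(1)] by eventually_elim (auto intro: power_mono)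
  qed simp
  have "(\<integral>x. f x * cnj (f x) \<partial>M) = (\<integral>x. complex_of_real ((cmod (f x))\<^sup>2) \<partial>M)"
    by (simp only: complex_norm_square)
  also have "\<dots> = complex_of_real (\<integral>x. (cmod (f x))\<^sup>2 \<partial>M)" by (rule integral_complex_of_real)
  finally have "(\<integral>x. (cmod (f x))\<^sup>2 \<partial>M) = 0" using assms(2) by (metis of_real_eq_0_iff)
  then have "AE x in M. (cmod (f x))\<^sup>2 = 0"
    using integral_nonneg_eq_0_iff_AE[OF i] by simp
  then show ?thesis by eventually_elim simp
qed

lemma cnj_Linfty: "f \<in> F \<Longrightarrow> (\<lambda>x. cnj (f x)) \<in> Linfty M"
proof -
  assume f: "f \<in> F"
  have [measurable]: "cnj \<in> borel_measurable borel"
    by (intro borel_measurable_continuous_onI continuous_intros)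
  have "(\<lambda>x. cnj (f x)) \<in> borel_measurable M" using F_measurable[OF f] by measurable
  then show ?thesis using AE_norm_le[OF f] unfolding Linfty_iff by auto
qed

text \<open>By duality and invariance \<open>U 1 - 1\<close> integrates to 0 against every bounded
  function; its own conjugate is an admissible test function, so its square integral
  vanishes.\<close>

lemma U_one: "ae_eq M (U (\<lambda>x. 1)) (\<lambda>x. 1)"
proof -
  let ?d = "\<lambda>x. U (\<lambda>x. 1) x - 1"
  have U: "U (\<lambda>x. 1) \<in> F" and d: "?d \<in> F" using bop_F[OF bop_U] F_const F_diff by auto
  note g = cnj_Linfty[OF d]
  have "(\<integral>x. ?d x * cnj (?d x) \<partial>M) = (\<integral>x. U (\<lambda>x. 1) x * cnj (?d x) - 1 * cnj (?d x) \<partial>M)"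
    by (simp add: algebra_simps)
  also have "\<dots> = (\<integral>x. U (\<lambda>x. 1) x * cnj (?d x) \<partial>M) - (\<integral>x. 1 * cnj (?d x) \<partial>M)"
    using g U F_integrable by (intro Bochner_Integration.integral_diff integrable_mult_Linfty) auto
  also have "(\<integral>x. U (\<lambda>x. 1) x * cnj (?d x) \<partial>M) = (\<integral>x. 1 * cnj (?d (T x)) \<partial>M)"
    using g F_const by (intro integral_U) auto
  also have "\<dots> = (\<integral>x. 1 * cnj (?d x) \<partial>M)"
    using integral_T[of "\<lambda>x. cnj (?d x)"] g unfolding Linfty_iff by simp
  finally have "(\<integral>x. ?d x * cnj (?d x) \<partial>M) = 0" by simp
  from AE_zero_if_square_integral_zero[OF d this] show ?thesis by eventually_elim simp
qed

lemma U_funpow_one: "ae_eq M ((U ^^ n) (\<lambda>x. 1)) (\<lambda>x. 1)"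
proof (induction n)
  case (Suc n)
  have "ae_eq M (U ((U ^^ n) (\<lambda>x. 1))) (U (\<lambda>x. 1))"
    using Suc F_const by (intro bop_cong[OF bop_U] bop_F[OF bop_funpow[OF bop_U]])
  with U_one show ?case by (simp, eventually_elim) simp
qed simp

section \<open>Identification of the leading eigenvalue and its projection\<close>

lemma U_funpow_decomposition:
  assumes P: "bop P" and N: "bop N"
    and U: "\<And>f. f \<in> F \<Longrightarrow> ae_eq M (U f) (\<lambda>x. a * P f x + N f x)"
    and PP: "\<And>f. f \<in> F \<Longrightarrow> ae_eq M (P (P f)) (P f)"
    and PN: "\<And>f. f \<in> F \<Longrightarrow> ae_eq M (P (N f)) (\<lambda>x. 0)"
    and NP: "\<And>f. f \<in> F \<Longrightarrow> ae_eq M (N (P f)) (\<lambda>x. 0)"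
    and f: "f \<in> F"
  shows "ae_eq M ((U ^^ Suc n) f) (\<lambda>x. a ^ Suc n * P f x + (N ^^ Suc n) f x)"
proof (induction n)
  \<comment> \<open>The formula starts at exponent 1: at exponent 0 the right side would be
    \<open>P f + f\<close>.\<close>
  case 0
  show ?case using U[OF f] by simp
next
  case (Suc n)
  let ?g = "(U ^^ Suc n) f" and ?N = "(N ^^ Suc n) f" and ?a = "a ^ Suc n"
  have F: "?g \<in> F" "P f \<in> F" "?N \<in> F" "(N ^^ n) f \<in> F"
    using f bop_F[OF bop_funpow[OF bop_U]] bop_F[OF P] bop_F[OF bop_funpow[OF N]] by blast+
  have aP: "(\<lambda>x. ?a * P f x) \<in> F" using F by (intro F_intros)
  have g: "ae_eq M (V ?g) (\<lambda>x. ?a * V (P f) x + V ?N x)" if V: "bop V" for V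
  proof -
    have "ae_eq M (V ?g) (V (\<lambda>x. ?a * P f x + ?N x))"
      using F aP by (intro bop_cong[OF V] Suc F_intros)
    with bop_add[OF V aP F(3)] bop_scale[OF V F(2), of ?a] show ?thesis by eventually_elim simp
  qed
  have "ae_eq M (U ?g) (\<lambda>x. a * (?a * P f x) + N ?N x)"
    using U[OF F(1)] g[OF P] g[OF N] PP[OF f] PN[OF F(4)] NP[OF f]
    by eventually_elim simp
  then show ?case by (simp add: mult.assoc)
qed

text \<open>The gap itself does not say what \<open>a\<close> and \<open>P\<close> are. Since
  \<open>U\<close> fixes 1, \<open>P 1 = a P 1\<close>; once \<open>P 1\<close> is nonzero,
  \<open>a = 1\<close> and \<open>r < 1\<close>. Then \<open>1 - P 1 = N^n 1\<close> tends to 0, so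
  the range of \<open>P\<close> consists of the constants, and preservation of the integral forces
  \<open>P f\<close> to be the integral of \<open>f\<close>. What remains of \<open>U^n f\<close> is
  \<open>N^n f\<close>.\<close>

theorem decay_of_correlations:
  obtains \<theta> C where "0 < \<theta>" "\<theta> < 1" "C > 0"
    "\<And>n f. f \<in> F \<Longrightarrow> nrm (\<lambda>x. (U ^^ n) f x - (\<integral>x. f x \<partial>M)) \<le> C * \<theta> ^ n * nrm f"
proof -
  from spectral_gap have "\<exists>a P N. bop P \<and> bop N \<and>
      (\<forall>f\<in>F. ae_eq M (U f) (\<lambda>x. a * P f x + N f x)) \<and>
      (\<forall>f\<in>F. ae_eq M (P (P f)) (P f)) \<and>
      (\<exists>e\<in>F. \<not> ae_eq M (P e) (\<lambda>x. 0) \<and> (\<forall>f\<in>F. \<exists>c. ae_eq M (P f) (\<lambda>x. c * P e x))) \<and>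
      operator_spectral_radius M F nrm N < ennreal (cmod a) \<and>
      (\<forall>f\<in>F. ae_eq M (P (N f)) (\<lambda>x. 0)) \<and>
      (\<forall>f\<in>F. ae_eq M (N (P f)) (\<lambda>x. 0))"
    unfolding has_spectral_gap_def by (rule conjunct2)
  then obtain a P N where P: "bop P" and N: "bop N"
    and U: "\<forall>f\<in>F. ae_eq M (U f) (\<lambda>x. a * P f x + N f x)"
    and PP: "\<forall>f\<in>F. ae_eq M (P (P f)) (P f)"
    and ex_e: "\<exists>e\<in>F. \<not> ae_eq M (P e) (\<lambda>x. 0) \<and> (\<forall>f\<in>F. \<exists>c. ae_eq M (P f) (\<lambda>x. c * P e x))"
    and rad: "operator_spectral_radius M F nrm N < ennreal (cmod a)"
    and PN: "\<forall>f\<in>F. ae_eq M (P (N f)) (\<lambda>x. 0)"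
    and NP: "\<forall>f\<in>F. ae_eq M (N (P f)) (\<lambda>x. 0)"
    by (elim exE conjE) (rule that)
  from ex_e obtain e where e: "e \<in> F" "\<not> ae_eq M (P e) (\<lambda>x. 0)"
      "\<forall>f\<in>F. \<exists>c. ae_eq M (P f) (\<lambda>x. c * P e x)"
    by (elim bexE conjE) (rule that)
  note U = U[rule_format] and PP = PP[rule_format] and PN = PN[rule_format] and NP = NP[rule_format]
    and e = e(1,2) e(3)[rule_format]
  obtain r C where r: "0 < r" "r < cmod a" and C: "C > 0"
    "\<And>n f. f \<in> F \<Longrightarrow> nrm ((N ^^ n) f) \<le> C * r ^ n * nrm f"
    by (rule power_bound_of_spectral_radius[OF N rad]) blast
  have dec: "ae_eq M ((U ^^ Suc n) f) (\<lambda>x. a ^ Suc n * P f x + (N ^^ Suc n) f x)" if "f \<in> F" for f n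
    using U_funpow_decomposition[of P N a f n] P N U PP PN NP that by blast
  let ?one = "\<lambda>x::'a. 1::complex"
  have one: "?one \<in> F" by (rule F_const)
  have F: "P f \<in> F" "N f \<in> F" "(N ^^ n) f \<in> F" "(U ^^ n) f \<in> F" if "f \<in> F" for f n
    using that bop_F[OF P] bop_F[OF N] bop_F[OF bop_funpow[OF N]] bop_F[OF bop_funpow[OF bop_U]] by blast+
  have dec1: "ae_eq M ?one (\<lambda>x. a ^ Suc n * P ?one x + (N ^^ Suc n) ?one x)" for n
    using dec[OF one, of n] U_funpow_one[of "Suc n"] by eventually_elim simp
  have lim0: "(\<lambda>n. K * (s / t) ^ Suc n) \<longlonglongrightarrow> 0" if "0 \<le> s" "s < t" for K s t :: real
  proof -
    have "(\<lambda>n. (s / t) ^ n) \<longlonglongrightarrow> 0" using that by (intro LIMSEQ_power_zero) auto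
    then have "(\<lambda>n. K * (s / t) ^ Suc n) \<longlonglongrightarrow> K * 0"
      by (intro tendsto_mult tendsto_const LIMSEQ_Suc)
    then show ?thesis by simp
  qed
  have "ae_eq M (P ?one) (\<lambda>x. a * P ?one x)"
  proof -
    have "ae_eq M ?one (\<lambda>x. a * P ?one x + N ?one x)" using dec1[of 0] by simp
    then have "ae_eq M (P ?one) (P (\<lambda>x. a * P ?one x + N ?one x))"
      using F one by (intro bop_cong[OF P] F_intros)
    with bop_add[OF P F_scale[OF F(1)[OF one]] F(2)[OF one], of a] bop_scale[OF P F(1)[OF one], of a]
      PP[OF one] PN[OF one] show ?thesis by eventually_elim simp
  qed
  then have aP1: "AE x in M. (a - 1) * P ?one x = 0" by eventually_elim (simp add: algebra_simps)
  \<comment> \<open>If \<open>P 1 = 0\<close>, then \<open>1 = N^n 1\<close> forces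
    \<open>r \<ge> 1\<close>, hence |a| > 1. Tested against the conjugate of \<open>P e\<close>,
    \<open>U^n e\<close> stays bounded by duality and \<open>N^n e\<close> is of order
    \<open>r^n\<close>, while their difference is \<open>a^n\<close> times the square integral of
    \<open>P e\<close>. So \<open>P e = 0\<close>, against the choice of \<open>e\<close>.\<close>
  have notzero: "\<not> ae_eq M (P ?one) (\<lambda>x. 0)"
  proof
    assume zero: "ae_eq M (P ?one) (\<lambda>x. 0)"
    have le: "nrm ?one \<le> (C * nrm ?one) * r ^ Suc n" for n
    proof -
      have "ae_eq M ?one ((N ^^ Suc n) ?one)" using dec1[of n] zero by eventually_elim simp
      then have "nrm ?one = nrm ((N ^^ Suc n) ?one)" by (intro nrm_cong one F(3)[OF one])
      with C(2)[OF one, of "Suc n"] show ?thesis by (simp add: mult_ac)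
    qed
    have "r \<ge> 1"
    proof (rule ccontr)
      assume "\<not> r \<ge> 1"
      then have "(\<lambda>n. (C * nrm ?one) * (r / 1) ^ Suc n) \<longlonglongrightarrow> 0" using r by (intro lim0) auto
      then have "nrm ?one \<le> 0" using le by (intro LIMSEQ_le_const[of _ 0]) auto
      then have "nrm ?one = 0" using nrm_nonneg[OF one] by simp
      then have "ae_eq M ?one (\<lambda>x. 0)" using nrm_eq_0_iff[OF one] by simp
      then have "AE x in M. False" by eventually_elim simp
      then show False by simp
    qed
    define K where "K = nrm e * nrm (P e)"
    let ?g = "\<lambda>x. cnj (P e x)"
    have Pe: "P e \<in> F" using F e by blast
    have g: "?g \<in> Linfty M" using cnj_Linfty Pe by blast
    have ge: "AE x in M. cmod (?g x) \<le> nrm (P e)" using AE_norm_le[OF Pe] by simp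
    have bnd: "cmod (\<integral>x. f x * h x \<partial>M) \<le> nrm f * nrm (P e)"
      if "f \<in> F" "h \<in> Linfty M" "AE x in M. cmod (h x) \<le> nrm (P e)" for f h
    proof -
      have "cmod (\<integral>x. f x * h x \<partial>M) \<le> (\<integral>x. cmod (f x * h x) \<partial>M)" by (rule integral_norm_bound)
      also have "\<dots> \<le> (\<integral>x. nrm f * nrm (P e) \<partial>M)"
      proof (rule integral_mono_AE)
        show "integrable M (\<lambda>x. cmod (f x * h x))"
          using integrable_mult_Linfty[OF F_integrable[OF that(1)] that(2)] by (rule integrable_norm)
        show "AE x in M. cmod (f x * h x) \<le> nrm f * nrm (P e)"
          using AE_norm_le[OF that(1)] that(3)
          by eventually_elim (auto simp: norm_mult intro: mult_mono')
      qed simp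
      finally show ?thesis by (simp add: prob_space)
    qed
    define I where "I = (\<integral>x. P e x * ?g x \<partial>M)"
    have "cmod I \<le> K * (1 / cmod a) ^ Suc n + (K * C) * (r / cmod a) ^ Suc n" for n
    proof -
      let ?m = "Suc n"
      have h: "(\<lambda>x. ?g ((T ^^ ?m) x)) \<in> Linfty M" "AE x in M. cmod (?g ((T ^^ ?m) x)) \<le> nrm (P e)"
      proof -
        have "(\<lambda>x. ?g ((T ^^ m) x)) \<in> Linfty M \<and> (AE x in M. cmod (?g ((T ^^ m) x)) \<le> nrm (P e))" for m
        proof (induction m)
          case (Suc m)
          with Linfty_T[of "\<lambda>x. ?g ((T ^^ m) x)"] AE_T[of "\<lambda>x. cmod (?g ((T ^^ m) x)) \<le> nrm (P e)"]
          show ?case by (simp add: funpow_swap1)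
        qed (use g ge in simp)
        then show "(\<lambda>x. ?g ((T ^^ ?m) x)) \<in> Linfty M" "AE x in M. cmod (?g ((T ^^ ?m) x)) \<le> nrm (P e)"
          by blast+
      qed
      have N': "(N ^^ ?m) e \<in> F" using F e by blast
      have meas[measurable]: "(U ^^ ?m) e \<in> borel_measurable M" "(N ^^ ?m) e \<in> borel_measurable M"
        "P e \<in> borel_measurable M" "?g \<in> borel_measurable M"
        using F_measurable F(4)[OF e(1), of ?m] N' Pe g unfolding Linfty_iff by blast+
      have "(\<integral>x. (U ^^ ?m) e x * ?g x \<partial>M) = (\<integral>x. a ^ ?m * (P e x * ?g x) + (N ^^ ?m) e x * ?g x \<partial>M)"
      proof (rule integral_cong_AE)
        show "AE x in M. (U ^^ ?m) e x * ?g x = a ^ ?m * (P e x * ?g x) + (N ^^ ?m) e x * ?g x"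
          using dec[OF e(1), of n] by eventually_elim (simp only: distrib_right mult.assoc)
      qed measurable
      also have "\<dots> = a ^ ?m * I + (\<integral>x. (N ^^ ?m) e x * ?g x \<partial>M)"
        unfolding I_def
        using integrable_mult_Linfty[OF F_integrable[OF Pe] g] integrable_mult_Linfty[OF F_integrable[OF N'] g]
        by (subst Bochner_Integration.integral_add) auto
      finally have "a ^ ?m * I = (\<integral>x. e x * ?g ((T ^^ ?m) x) \<partial>M) - (\<integral>x. (N ^^ ?m) e x * ?g x \<partial>M)"
        unfolding integral_U_funpow[OF e(1) g, of ?m] by (simp only: eq_diff_eq)
      then have "cmod a ^ ?m * cmod I \<le> cmod (\<integral>x. e x * ?g ((T ^^ ?m) x) \<partial>M) + cmod (\<integral>x. (N ^^ ?m) e x * ?g x \<partial>M)"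
        by (metis norm_mult norm_power norm_triangle_ineq4)
      also have "cmod (\<integral>x. e x * ?g ((T ^^ ?m) x) \<partial>M) \<le> K"
        unfolding K_def by (rule bnd[OF e(1) h])
      also have "cmod (\<integral>x. (N ^^ ?m) e x * ?g x \<partial>M) \<le> nrm ((N ^^ ?m) e) * nrm (P e)"
        by (rule bnd[OF N' g ge])
      also have "\<dots> \<le> (C * r ^ ?m * nrm e) * nrm (P e)"
        using C(2)[OF e(1)] nrm_nonneg[OF Pe] by (intro mult_right_mono)
      also have "\<dots> = K * C * r ^ ?m" unfolding K_def by simp
      finally have "cmod a ^ ?m * cmod I \<le> K + K * C * r ^ ?m" by simp
      moreover have "cmod a ^ ?m > 0" using r by (intro zero_less_power) linarith
      ultimately have "cmod I \<le> (K + K * C * r ^ ?m) / cmod a ^ ?m"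
        by (simp only: pos_le_divide_eq mult.commute)
      then show ?thesis by (simp only: power_divide add_divide_distrib power_one times_divide_eq_right mult_1_right)
    qed
    moreover have "(\<lambda>n. K * (1 / cmod a) ^ Suc n + (K * C) * (r / cmod a) ^ Suc n) \<longlonglongrightarrow> 0 + 0"
      using r \<open>r \<ge> 1\<close> by (intro tendsto_add lim0) auto
    ultimately have "cmod I \<le> 0 + 0" by (intro LIMSEQ_le_const) auto
    then have "I = 0" by simp
    then have "ae_eq M (P e) (\<lambda>x. 0)" unfolding I_def using AE_zero_if_square_integral_zero[OF Pe] by simp
    with e(2) show False by simp
  qed
  have a: "a = 1"
  proof (rule ccontr)
    assume "a \<noteq> 1"
    with aP1 have "ae_eq M (P ?one) (\<lambda>x. 0)" by (auto elim: eventually_mono)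
    with notzero show False by simp
  qed
  have r1: "r < 1" using r a by simp
  have "nrm (\<lambda>x. 1 - P ?one x) \<le> (C * nrm ?one) * (r / 1) ^ Suc n" for n
  proof -
    have "ae_eq M (\<lambda>x. 1 - P ?one x) ((N ^^ Suc n) ?one)"
      using dec1[of n] by eventually_elim (simp add: a algebra_simps)
    then have "nrm (\<lambda>x. 1 - P ?one x) = nrm ((N ^^ Suc n) ?one)"
      by (intro nrm_cong F_diff one F(1)[OF one] F(3)[OF one])
    with C(2)[OF one, of "Suc n"] show ?thesis by (simp add: mult_ac)
  qed
  moreover have "(\<lambda>n. (C * nrm ?one) * (r / 1) ^ Suc n) \<longlonglongrightarrow> 0" using r r1 by (intro lim0) auto
  ultimately have "nrm (\<lambda>x. 1 - P ?one x) \<le> 0" by (intro LIMSEQ_le_const) auto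
  moreover have "(\<lambda>x. 1 - P ?one x) \<in> F" using one F(1)[OF one] by (intro F_intros)
  ultimately have "ae_eq M (\<lambda>x. 1 - P ?one x) (\<lambda>x. 0)"
    using nrm_eq_0_iff nrm_nonneg by (metis antisym)
  then have P1: "ae_eq M (P ?one) ?one" by eventually_elim simp
  obtain c1 where c1: "ae_eq M (P ?one) (\<lambda>x. c1 * P e x)" using e(3)[OF one] by blast
  have "c1 \<noteq> 0"
  proof
    assume "c1 = 0"
    with c1 have "ae_eq M (P ?one) (\<lambda>x. 0)" by simp
    with notzero show False by simp
  qed
  have Pe1: "AE x in M. P e x = 1 / c1"
    using P1 c1 by eventually_elim (use \<open>c1 \<noteq> 0\<close> in \<open>simp add: field_simps\<close>)
  have Pf: "ae_eq M (P f) (\<lambda>x. \<integral>x. f x \<partial>M)" if f: "f \<in> F" for f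
  proof -
    obtain c where "ae_eq M (P f) (\<lambda>x. c * P e x)" using e(3)[OF f] by blast
    with Pe1 have c: "AE x in M. P f x = c * (1 / c1)" by eventually_elim simp
    define d where "d = c * (1 / c1)"
    have "cmod ((\<integral>x. f x \<partial>M) - d) \<le> (C * nrm f) * (r / 1) ^ Suc n" for n
    proof -
      have N': "(N ^^ Suc n) f \<in> F" using F f by blast
      have meas[measurable]: "(U ^^ Suc n) f \<in> borel_measurable M" "(N ^^ Suc n) f \<in> borel_measurable M"
        using F_measurable F(4)[OF f, of "Suc n"] N' by blast+
      have "(\<integral>x. f x \<partial>M) = (\<integral>x. (U ^^ Suc n) f x \<partial>M)"
        using integral_U_funpow[OF f F_Linfty[OF one], of "Suc n"] by simp
      also have "\<dots> = (\<integral>x. d + (N ^^ Suc n) f x \<partial>M)"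
      proof (rule integral_cong_AE)
        show "AE x in M. (U ^^ Suc n) f x = d + (N ^^ Suc n) f x"
          using dec[OF f, of n] c by eventually_elim (simp add: a d_def)
      qed measurable
      also have "\<dots> = d + (\<integral>x. (N ^^ Suc n) f x \<partial>M)"
        using F_integrable[OF N'] by (subst Bochner_Integration.integral_add) (auto simp: prob_space)
      finally have "cmod ((\<integral>x. f x \<partial>M) - d) = cmod (\<integral>x. (N ^^ Suc n) f x \<partial>M)" by simp
      also have "\<dots> \<le> nrm ((N ^^ Suc n) f)" by (rule norm_integral_le[OF N'])
      finally show ?thesis using C(2)[OF f, of "Suc n"] by (simp add: mult_ac)
    qed
    moreover have "(\<lambda>n. (C * nrm f) * (r / 1) ^ Suc n) \<longlonglongrightarrow> 0" using r r1 by (intro lim0) auto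
    ultimately have "cmod ((\<integral>x. f x \<partial>M) - d) \<le> 0" by (intro LIMSEQ_le_const) auto
    then have "d = (\<integral>x. f x \<partial>M)" by simp
    with c show ?thesis by (simp add: d_def)
  qed
  \<comment> \<open>The second entry covers \<open>n = 0\<close>, where the remainder is
    \<open>f\<close> minus its integral.\<close>
  define C' where "C' = max C (1 + nrm ?one)"
  have "nrm (\<lambda>x. (U ^^ n) f x - (\<integral>x. f x \<partial>M)) \<le> C' * r ^ n * nrm f" if f: "f \<in> F" for n f
  proof (cases n)
    case 0
    have "nrm (\<lambda>x. f x - (\<integral>x. f x \<partial>M) * ?one x) \<le> nrm f + cmod (\<integral>x. f x \<partial>M) * nrm ?one"
      using nrm_diff[OF f F_scale[OF one]] nrm_scale[OF one] by metis
    also have "\<dots> \<le> nrm f + nrm f * nrm ?one"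
      using norm_integral_le[OF f] nrm_nonneg[OF one] by (intro add_left_mono mult_right_mono)
    also have "\<dots> = (1 + nrm ?one) * nrm f" by (simp add: algebra_simps)
    also have "\<dots> \<le> C' * nrm f" unfolding C'_def using nrm_nonneg[OF f] by (intro mult_right_mono) auto
    finally show ?thesis using 0 by simp
  next
    case (Suc m)
    have "ae_eq M (\<lambda>x. (U ^^ n) f x - (\<integral>x. f x \<partial>M)) ((N ^^ n) f)"
      using dec[OF f, of m] Pf[OF f] unfolding Suc by eventually_elim (simp add: a)
    then have "nrm (\<lambda>x. (U ^^ n) f x - (\<integral>x. f x \<partial>M)) = nrm ((N ^^ n) f)"
      using F(3,4)[OF f] F_const by (intro nrm_cong F_diff) auto
    also have "\<dots> \<le> C * r ^ n * nrm f" by (rule C(2)[OF f])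
    also have "\<dots> \<le> C' * r ^ n * nrm f"
      unfolding C'_def using r nrm_nonneg[OF f] by (intro mult_right_mono) auto
    finally show ?thesis .
  qed
  moreover have "C' > 0" unfolding C'_def using C by simp
  ultimately show ?thesis using that r r1 by blast
qed

end

section \<open>Deviations of visit counts\<close>

definition visits :: "('a \<Rightarrow> 'a) \<Rightarrow> 'a set \<Rightarrow> nat \<Rightarrow> 'a \<Rightarrow> nat" where
  "visits T A n x = (\<Sum>k<n. of_bool ((T ^^ k) x \<in> A))"

lemma visits_Suc: "visits T A (Suc n) x = of_bool (x \<in> A) + visits T A n (T x)"
  unfolding visits_def by (subst sum.lessThan_Suc_shift) (simp add: funpow_swap1)

lemma visits_0[simp]: "visits T A 0 x = 0"
  unfolding visits_def by simp

lemma visits_le: "visits T A n x \<le> n"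
proof -
  have "visits T A n x \<le> (\<Sum>k<n. 1)" unfolding visits_def by (intro sum_mono) auto
  then show ?thesis by simp
qed

lemma visits_mono: "m \<le> n \<Longrightarrow> visits T A m x \<le> visits T A n x"
  unfolding visits_def by (intro sum_mono2) auto

lemma visits_subset: "A \<subseteq> B \<Longrightarrow> visits T A n x \<le> visits T B n x"
  unfolding visits_def by (intro sum_mono) auto

context property_C_system
begin

lemma measurable_funpow_T[measurable]: "T ^^ n \<in> measurable M M"
  by (induction n) (auto simp: measurable_comp[OF _ T_measurable])

lemma measurable_visits[measurable]:
  assumes [measurable]: "Measurable.pred M (\<lambda>x. x \<in> A)"
  shows "visits T A n \<in> measurable M (count_space UNIV)"
proof -
  have "(\<lambda>x. (of_bool ((T ^^ k) x \<in> A) :: nat)) \<in> measurable M (count_space UNIV)" for k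
    unfolding of_bool_def by measurable
  then show ?thesis unfolding visits_def[abs_def] by measurable
qed

lemma pred_of_indicator_F:
  assumes "indicator A \<in> F"
  shows "Measurable.pred M (\<lambda>x. x \<in> A)"
proof -
  have [measurable]: "(indicator A :: 'a \<Rightarrow> complex) \<in> borel_measurable M"
    using F_measurable[OF assms] .
  have "Measurable.pred M (\<lambda>x. (indicator A x :: complex) = 1)" by measurable
  then show ?thesis by (simp add: indicator_eq_1_iff)
qed

section \<open>Moment generating function of a visit count by a tilted operator\<close>

context
  fixes A :: "'a set" and u :: real and \<theta> C K B :: real
  assumes A: "indicator A \<in> F" "nrm (indicator A) \<le> K"
    and u: "\<bar>u\<bar> \<le> 1 / 2" and pos: "0 < \<theta>" "\<theta> < 1" "C > 0" "K > 0" "B > 0"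
    and decay: "\<And>n f. f \<in> F \<Longrightarrow> nrm (\<lambda>x. (U ^^ n) f x - (\<integral>x. f x \<partial>M)) \<le> C * \<theta> ^ n * nrm f"
    and small: "(C * K + 1) * \<bar>u\<bar> \<le> (1 - \<theta>) / 2"
    and B: "C * K * nrm (\<lambda>x. 1) \<le> (1 - \<theta>) / 2 * B"
begin

text \<open>The base \<open>1 + u\<close>, in place of an exponential, makes the factor of one step
  affine in the indicator and hence multiplication by an element of the algebra.\<close>

definition weight :: "nat \<Rightarrow> 'a \<Rightarrow> real" where
  "weight n x = (1 + u) ^ visits T A n x"

definition tilted :: "('a \<Rightarrow> complex) \<Rightarrow> 'a \<Rightarrow> complex" where
  "tilted f = U (\<lambda>x. f x + complex_of_real u * (indicator A x * f x))"

lemma pred_A[measurable]: "Measurable.pred M (\<lambda>x. x \<in> A)"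
  using pred_of_indicator_F A by blast

lemma weight_measurable[measurable]: "weight n \<in> borel_measurable M"
proof -
  have "(\<lambda>x. (\<lambda>m. (1 + u) ^ m) (visits T A n x)) \<in> borel_measurable M"
    by (rule measurable_compose[OF measurable_visits[OF pred_A]]) simp
  then show ?thesis unfolding weight_def[abs_def] .
qed

lemma weight_pos: "0 < weight n x"
  unfolding weight_def using u by (intro zero_less_power) linarith

lemma weight_le: "weight n x \<le> 2 ^ n"
proof -
  have "weight n x \<le> 2 ^ visits T A n x" unfolding weight_def using u by (intro power_mono) linarith+
  also have "\<dots> \<le> 2 ^ n" using visits_le by (intro power_increasing) auto
  finally show ?thesis .
qed

lemma weight_Suc: "weight (Suc n) x = (1 + u * indicator A x) * weight n (T x)"
  unfolding weight_def visits_Suc by (simp add: power_add indicator_def)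

lemma weight_integrable: "integrable M (weight n)"
  using weight_le weight_pos by (intro integrable_const_bound[where B = "2 ^ n"]) (auto simp: less_imp_le)

lemma weight_Linfty: "(\<lambda>x. complex_of_real (weight n x)) \<in> Linfty M"
  unfolding Linfty_iff using weight_le weight_pos
  by (auto intro!: exI[of _ "2 ^ n"] simp: less_imp_le)

lemma perturbed_F: "f \<in> F \<Longrightarrow> (\<lambda>x. f x + complex_of_real u * (indicator A x * f x)) \<in> F"
  using A by (intro F_intros)

lemma tilted_F: "f \<in> F \<Longrightarrow> tilted f \<in> F"
  unfolding tilted_def using bop_F[OF bop_U perturbed_F] .

lemma tilted_funpow_F: "f \<in> F \<Longrightarrow> (tilted ^^ n) f \<in> F"
  by (induction n) (auto simp: tilted_F)

text \<open>Duality peels off the step at time 0: its factor stays inside the argument of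
  \<open>U\<close>, the others pass to the test function \<open>weight n\<close> composed with
  \<open>T\<close>.\<close>

lemma integral_tilted_funpow:
  "f \<in> F \<Longrightarrow> (\<integral>x. (tilted ^^ n) f x \<partial>M) = (\<integral>x. f x * complex_of_real (weight n x) \<partial>M)"
proof (induction n arbitrary: f)
  case 0
  then show ?case by (simp add: weight_def)
next
  case (Suc n)
  have "(\<integral>x. (tilted ^^ Suc n) f x \<partial>M) = (\<integral>x. (tilted ^^ n) (tilted f) x \<partial>M)"
    by (simp only: funpow_Suc_right comp_apply)
  also have "\<dots> = (\<integral>x. tilted f x * complex_of_real (weight n x) \<partial>M)"
    using Suc.IH[OF tilted_F[OF Suc.prems]] .
  also have "\<dots> = (\<integral>x. (f x + complex_of_real u * (indicator A x * f x)) * complex_of_real (weight n (T x)) \<partial>M)"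
    unfolding tilted_def by (rule integral_U[OF perturbed_F[OF Suc.prems] weight_Linfty])
  also have "\<dots> = (\<integral>x. f x * complex_of_real (weight (Suc n) x) \<partial>M)"
    unfolding weight_Suc by (intro Bochner_Integration.integral_cong refl) (simp add: indicator_def algebra_simps)
  finally show ?case .
qed

definition mgf :: "nat \<Rightarrow> real" where "mgf n = (\<integral>x. weight n x \<partial>M)"
definition tilted_one :: "nat \<Rightarrow> 'a \<Rightarrow> complex" where "tilted_one n = (tilted ^^ n) (\<lambda>x. 1)"

lemma tilted_one_F: "tilted_one n \<in> F" unfolding tilted_one_def by (rule tilted_funpow_F[OF F_const])

lemma tilted_one_Suc: "tilted_one (Suc n) = U (\<lambda>x. tilted_one n x + complex_of_real u * (indicator A x * tilted_one n x))"
  unfolding tilted_one_def by (simp add: tilted_def)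

lemma integral_tilted_one: "(\<integral>x. tilted_one n x \<partial>M) = complex_of_real (mgf n)"
  unfolding tilted_one_def mgf_def using integral_tilted_funpow[OF F_const, of n 1]
  by (simp add: integral_complex_of_real)

lemma mgf_nonneg: "0 \<le> mgf n"
  unfolding mgf_def using weight_pos by (intro Bochner_Integration.integral_nonneg) (simp add: less_imp_le)

text \<open>For negative \<open>u\<close> the sequence \<open>mgf\<close> may decrease. Errors
  relative to \<open>mgf n\<close> are restated relative to \<open>mgf (Suc n)\<close> at the price
  of this factor.\<close>

lemma mgf_Suc_ge: "(1 - \<bar>u\<bar>) * mgf n \<le> mgf (Suc n)"
proof -
  have i: "integrable M (\<lambda>x. weight n (T x))"
    using weight_le weight_pos by (intro integrable_const_bound[where B = "2 ^ n"]) (auto simp: less_imp_le)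
  have "(1 - \<bar>u\<bar>) * mgf n = (\<integral>x. (1 - \<bar>u\<bar>) * weight n (T x) \<partial>M)"
    unfolding mgf_def using integral_T[OF weight_measurable, of n] by simp
  also have "\<dots> \<le> mgf (Suc n)"
    unfolding mgf_def
  proof (rule integral_mono)
    fix x
    show "(1 - \<bar>u\<bar>) * weight n (T x) \<le> weight (Suc n) x"
      unfolding weight_Suc using weight_pos[of n "T x"]
      by (intro mult_right_mono) (auto simp: indicator_def less_imp_le)
  qed (use i weight_integrable in auto)
  finally show ?thesis .
qed

lemma indicator_tilted_one_F: "(\<lambda>x. indicator A x * tilted_one n x) \<in> F"
  using A tilted_one_F by (intro F_intros)

lemma mgf_Suc_eq: "complex_of_real (mgf (Suc n)) = complex_of_real (mgf n) + complex_of_real u * (\<integral>x. indicator A x * tilted_one n x \<partial>M)"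
proof -
  have "complex_of_real (mgf (Suc n)) = (\<integral>x. tilted_one (Suc n) x * 1 \<partial>M)" using integral_tilted_one[of "Suc n"] by simp
  also have "\<dots> = (\<integral>x. (tilted_one n x + complex_of_real u * (indicator A x * tilted_one n x)) * 1 \<partial>M)"
    unfolding tilted_one_Suc by (rule integral_U[OF perturbed_F[OF tilted_one_F] F_Linfty[OF F_const]])
  also have "\<dots> = (\<integral>x. tilted_one n x \<partial>M) + complex_of_real u * (\<integral>x. indicator A x * tilted_one n x \<partial>M)"
    using F_integrable[OF tilted_one_F, of n] F_integrable[OF indicator_tilted_one_F, of n]
    by (simp add: Bochner_Integration.integral_add)
  finally show ?thesis unfolding integral_tilted_one .
qed

text \<open>All \<open>m\<close> are treated at once because the step from \<open>k\<close> to
  \<open>k + 1\<close> uses \<open>m + 1\<close>. It produces two errors: the old one, shrunk by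
  \<open>\<theta>\<close>, and that of the perturbation, controlled by \<open>decay\<close> since
  multiplication by the indicator costs at most \<open>K\<close>. The factor \<open>mgf k\<close>
  keeps the estimate from deteriorating as \<open>k\<close> grows.\<close>

lemma tilted_one_close: "nrm (\<lambda>x. (U ^^ m) (tilted_one k) x - complex_of_real (mgf k)) \<le> B * \<bar>u\<bar> * \<theta> ^ m * mgf k"
proof (induction k arbitrary: m)
  case 0
  have "mgf 0 = 1" unfolding mgf_def weight_def by (simp add: prob_space)
  moreover have "tilted_one 0 = (\<lambda>x. 1)" unfolding tilted_one_def by simp
  ultimately have "ae_eq M (\<lambda>x. (U ^^ m) (tilted_one 0) x - complex_of_real (mgf 0)) (\<lambda>x. 0)"
    using U_funpow_one[of m] by (auto elim: eventually_mono)
  moreover have "(\<lambda>x. (U ^^ m) (tilted_one 0) x - complex_of_real (mgf 0)) \<in> F"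
    by (intro F_diff bop_F[OF bop_funpow[OF bop_U]] tilted_one_F F_const)
  ultimately have "nrm (\<lambda>x. (U ^^ m) (tilted_one 0) x - complex_of_real (mgf 0)) = 0" using nrm_eq_0_iff by blast
  then show ?case using pos mgf_nonneg by simp
next
  case (Suc k)
  let ?w = "\<lambda>x. indicator A x * tilted_one k x" and ?I = "\<integral>x. indicator A x * tilted_one k x \<partial>M"
  let ?Um = "U ^^ Suc m" and ?\<kappa> = "nrm (\<lambda>x. 1)"
  have bU: "bop ?Um" using bop_funpow[OF bop_U] .
  have F: "tilted_one k \<in> F" "?w \<in> F" "(\<lambda>x. complex_of_real u * ?w x) \<in> F" "?Um (tilted_one k) \<in> F" "?Um ?w \<in> F" "(U ^^ m) (tilted_one (Suc k)) \<in> F"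
    by (intro tilted_one_F indicator_tilted_one_F F_scale bop_F[OF bU] bop_F[OF bop_funpow[OF bop_U]])+
  have "(U ^^ m) (tilted_one (Suc k)) = ?Um (\<lambda>x. tilted_one k x + complex_of_real u * ?w x)"
    unfolding tilted_one_Suc by (simp only: funpow_Suc_right comp_apply)
  with bop_add[OF bU F(1) F(3)]
  have "ae_eq M ((U ^^ m) (tilted_one (Suc k))) (\<lambda>x. ?Um (tilted_one k) x + ?Um (\<lambda>x. complex_of_real u * ?w x) x)" by metis
  with bop_scale[OF bU F(2), of "complex_of_real u"]
  have "ae_eq M (\<lambda>x. (U ^^ m) (tilted_one (Suc k)) x - complex_of_real (mgf (Suc k)))
      (\<lambda>x. (?Um (tilted_one k) x - complex_of_real (mgf k)) + complex_of_real u * (?Um ?w x - ?I))"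
    unfolding mgf_Suc_eq by eventually_elim (simp only: right_diff_distrib add_diff_add)
  then have "nrm (\<lambda>x. (U ^^ m) (tilted_one (Suc k)) x - complex_of_real (mgf (Suc k))) =
      nrm (\<lambda>x. (?Um (tilted_one k) x - complex_of_real (mgf k)) + complex_of_real u * (?Um ?w x - ?I))"
    by (intro nrm_cong F_add F_diff F_scale F F_const)
  also have "\<dots> \<le> nrm (\<lambda>x. ?Um (tilted_one k) x - complex_of_real (mgf k)) + nrm (\<lambda>x. complex_of_real u * (?Um ?w x - ?I))"
    by (intro nrm_add F_diff F_scale F F_const)
  also have "nrm (\<lambda>x. complex_of_real u * (?Um ?w x - ?I)) = \<bar>u\<bar> * nrm (\<lambda>x. ?Um ?w x - ?I)"
    using nrm_scale[OF F_diff[OF F(5) F_const]] by simp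
  also have "\<dots> \<le> \<bar>u\<bar> * (C * \<theta> ^ Suc m * nrm ?w)"
    using decay[OF F(2), of "Suc m"] by (intro mult_left_mono) auto
  also have "nrm (\<lambda>x. ?Um (tilted_one k) x - complex_of_real (mgf k)) \<le> B * \<bar>u\<bar> * \<theta> ^ Suc m * mgf k" by (rule Suc.IH)
  finally have 1: "nrm (\<lambda>x. (U ^^ m) (tilted_one (Suc k)) x - complex_of_real (mgf (Suc k))) \<le>
    B * \<bar>u\<bar> * \<theta> ^ Suc m * mgf k + \<bar>u\<bar> * (C * \<theta> ^ Suc m * nrm ?w)" by simp
  have "nrm (tilted_one k) = nrm (\<lambda>x. (tilted_one k x - complex_of_real (mgf k)) + complex_of_real (mgf k) * 1)" by simp
  also have "\<dots> \<le> nrm (\<lambda>x. tilted_one k x - complex_of_real (mgf k)) + nrm (\<lambda>x. complex_of_real (mgf k) * 1)"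
    by (intro nrm_add F_diff F_const F)
  also have "nrm (\<lambda>x. tilted_one k x - complex_of_real (mgf k)) \<le> B * \<bar>u\<bar> * mgf k" using Suc.IH[of 0] by simp
  also have "nrm (\<lambda>x. complex_of_real (mgf k) * 1) = mgf k * ?\<kappa>"
    by (subst nrm_scale[OF F_const]) (simp add: mgf_nonneg)
  finally have "nrm (tilted_one k) \<le> (B * \<bar>u\<bar> + ?\<kappa>) * mgf k" by (simp add: algebra_simps)
  then have "K * nrm (tilted_one k) \<le> K * ((B * \<bar>u\<bar> + ?\<kappa>) * mgf k)" using pos by (intro mult_left_mono) auto
  moreover have "nrm ?w \<le> K * nrm (tilted_one k)"
    using nrm_mult[OF A(1) F(1)] mult_right_mono[OF A(2) nrm_nonneg[OF F(1)]] by linarith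
  ultimately have "nrm ?w \<le> K * ((B * \<bar>u\<bar> + ?\<kappa>) * mgf k)" by linarith
  then have "\<bar>u\<bar> * (C * \<theta> ^ Suc m * nrm ?w) \<le> \<bar>u\<bar> * (C * \<theta> ^ Suc m * (K * ((B * \<bar>u\<bar> + ?\<kappa>) * mgf k)))"
    using pos by (intro mult_left_mono) auto
  with 1 have 2: "nrm (\<lambda>x. (U ^^ m) (tilted_one (Suc k)) x - complex_of_real (mgf (Suc k))) \<le>
    \<bar>u\<bar> * \<theta> ^ m * (\<theta> * (B + C * K * (B * \<bar>u\<bar>) + C * K * ?\<kappa>)) * mgf k"
    by (simp add: algebra_simps)
  \<comment> \<open>The gap \<open>1 - \<theta>\<close> is spent in halves: one, by
    \<open>small\<close>, on the terms with \<open>\<bar>u\<bar>\<close>, including the loss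
    \<open>1 - \<bar>u\<bar>\<close> from \<open>mgf_Suc_ge\<close>, which is the summand 1 in
    \<open>C * K + 1\<close>; the other, by the choice of \<open>B\<close>, on the norm of the
    constant 1.\<close>
  have "\<theta> * (B + C * K * (B * \<bar>u\<bar>) + C * K * ?\<kappa>) \<le> B * (1 - \<bar>u\<bar>)"
  proof -
    have x: "0 \<le> C * K * (B * \<bar>u\<bar>)" "0 \<le> C * K * ?\<kappa>" using pos nrm_nonneg[OF F_const] by auto
    have "\<theta> * (B + C * K * (B * \<bar>u\<bar>) + C * K * ?\<kappa>) \<le> \<theta> * B + C * K * (B * \<bar>u\<bar>) + C * K * ?\<kappa>"
      using mult_right_mono[OF less_imp_le[OF pos(2)] x(1)] mult_right_mono[OF less_imp_le[OF pos(2)] x(2)]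
      by (simp add: distrib_left)
    also have "\<dots> \<le> \<theta> * B + C * K * (B * \<bar>u\<bar>) + (1 - \<theta>) / 2 * B" using B by simp
    also have "\<dots> = \<theta> * B + ((C * K + 1) * \<bar>u\<bar>) * B - B * \<bar>u\<bar> + (1 - \<theta>) / 2 * B"
      by (simp add: algebra_simps)
    also have "\<dots> \<le> \<theta> * B + ((1 - \<theta>) / 2) * B - B * \<bar>u\<bar> + (1 - \<theta>) / 2 * B"
      using mult_right_mono[OF small, of B] pos by linarith
    also have "\<dots> = B * (1 - \<bar>u\<bar>)" by (simp add: field_simps)
    finally show ?thesis .
  qed
  then have "\<bar>u\<bar> * \<theta> ^ m * (\<theta> * (B + C * K * (B * \<bar>u\<bar>) + C * K * ?\<kappa>)) * mgf k \<le> \<bar>u\<bar> * \<theta> ^ m * (B * (1 - \<bar>u\<bar>)) * mgf k"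
    using pos mgf_nonneg by (intro mult_right_mono mult_left_mono) auto
  also have "\<dots> = B * \<bar>u\<bar> * \<theta> ^ m * ((1 - \<bar>u\<bar>) * mgf k)" by (simp add: mult_ac)
  also have "\<dots> \<le> B * \<bar>u\<bar> * \<theta> ^ m * mgf (Suc k)"
    using mgf_Suc_ge[of k] pos by (intro mult_left_mono) auto
  finally show ?case using 2 by simp
qed

text \<open>The increment is \<open>u\<close> times the integral of \<open>tilted_one n\<close> over
  \<open>A\<close>. Replacing the integrand by the constant \<open>mgf n\<close> costs at most
  \<open>B * \<bar>u\<bar> * mgf n\<close> almost everywhere, so integration over \<open>A\<close>
  brings the measure of \<open>A\<close> into the error too.\<close>

lemma mgf_Suc_le:
  "mgf (Suc n) \<le> mgf n * (1 + measure M {x \<in> space M. x \<in> A} * (u + B * u\<^sup>2))"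
proof -
  let ?mu = "measure M {x \<in> space M. x \<in> A}"
  let ?d = "\<lambda>x. tilted_one n x - complex_of_real (mgf n)"
  have dF: "?d \<in> F" by (intro F_diff tilted_one_F F_const)
  have mA: "(\<integral>x. indicator A x \<partial>M) = ?mu"
  proof -
    have "(\<integral>x. indicator A x \<partial>M) = (\<integral>x. indicator {x \<in> space M. x \<in> A} x \<partial>M :: real)"
      by (intro Bochner_Integration.integral_cong refl) (simp add: indicator_def)
    then show ?thesis by simp
  qed
  have iA: "integrable M (\<lambda>x. indicator A x :: real)"
    by (intro integrable_const_bound[where B = 1]) (auto simp: indicator_def)
  have idF: "(\<lambda>x. indicator A x * ?d x) \<in> F" by (intro F_mult A dF)
  have "AE x in M. cmod (?d x) \<le> B * \<bar>u\<bar> * mgf n"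
    using AE_norm_le[OF dF] tilted_one_close[of 0 n] by (auto elim: eventually_mono)
  then have ae: "AE x in M. cmod (indicator A x * ?d x) \<le> (B * \<bar>u\<bar> * mgf n) * indicator A x"
    by eventually_elim (auto simp: indicator_def)
  have "cmod (\<integral>x. indicator A x * ?d x \<partial>M) \<le> (\<integral>x. cmod (indicator A x * ?d x) \<partial>M)"
    by (rule integral_norm_bound)
  also have "\<dots> \<le> (\<integral>x. (B * \<bar>u\<bar> * mgf n) * indicator A x \<partial>M)"
    by (intro integral_mono_AE ae integrable_mult_right iA integrable_norm F_integrable[OF idF])
  also have "\<dots> = B * \<bar>u\<bar> * mgf n * ?mu" using mA by simp
  finally have 1: "cmod (\<integral>x. indicator A x * ?d x \<partial>M) \<le> B * \<bar>u\<bar> * mgf n * ?mu" .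
  have "(\<integral>x. indicator A x * tilted_one n x \<partial>M) = (\<integral>x. indicator A x * ?d x + complex_of_real (mgf n * indicator A x) \<partial>M)"
    by (intro Bochner_Integration.integral_cong refl) (simp add: indicator_def)
  also have "\<dots> = (\<integral>x. indicator A x * ?d x \<partial>M) + (\<integral>x. complex_of_real (mgf n * indicator A x) \<partial>M)"
    by (intro Bochner_Integration.integral_add F_integrable[OF idF] integrable_of_real integrable_mult_right iA)
  also have "(\<integral>x. complex_of_real (mgf n * indicator A x) \<partial>M) = complex_of_real (\<integral>x. mgf n * indicator A x \<partial>M)"
    by (rule integral_complex_of_real)
  finally have "complex_of_real (mgf (Suc n) - mgf n - u * (mgf n * ?mu)) =
      complex_of_real u * (\<integral>x. indicator A x * ?d x \<partial>M)"
    using mgf_Suc_eq[of n] mA by (simp add: algebra_simps)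
  from arg_cong[OF this, of cmod]
  have "\<bar>mgf (Suc n) - mgf n - u * (mgf n * ?mu)\<bar> = \<bar>u\<bar> * cmod (\<integral>x. indicator A x * ?d x \<partial>M)"
    by (simp only: norm_mult norm_of_real)
  also have "\<dots> \<le> \<bar>u\<bar> * (B * \<bar>u\<bar> * mgf n * ?mu)" using 1 by (intro mult_left_mono) auto
  also have "\<dots> = B * (\<bar>u\<bar> * \<bar>u\<bar>) * mgf n * ?mu" by (simp add: mult_ac)
  also have "\<bar>u\<bar> * \<bar>u\<bar> = u\<^sup>2" by (simp add: power2_eq_square)
  finally have "mgf (Suc n) - mgf n - u * (mgf n * ?mu) \<le> B * u\<^sup>2 * mgf n * ?mu" by linarith
  then show ?thesis by (simp add: algebra_simps)
qed

lemma mgf_le_exp: "mgf n \<le> exp (real n * measure M {x \<in> space M. x \<in> A} * (u + B * u\<^sup>2))"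
proof (induction n)
  case 0
  show ?case unfolding mgf_def weight_def by (simp add: prob_space)
next
  case (Suc n)
  let ?c = "measure M {x \<in> space M. x \<in> A} * (u + B * u\<^sup>2)"
  have "mgf (Suc n) \<le> mgf n * (1 + ?c)" by (rule mgf_Suc_le)
  also have "\<dots> \<le> mgf n * exp ?c" using mgf_nonneg exp_ge_add_one_self by (intro mult_left_mono)
  also have "\<dots> \<le> exp (real n * measure M {x \<in> space M. x \<in> A} * (u + B * u\<^sup>2)) * exp ?c"
    using Suc by (intro mult_right_mono) auto
  also have "\<dots> = exp (real (Suc n) * measure M {x \<in> space M. x \<in> A} * (u + B * u\<^sup>2))"
    by (simp add: exp_add[symmetric] algebra_simps)
  finally show ?case .
qed

text \<open>Markov's inequality for \<open>weight n\<close>. A negative \<open>u\<close> makes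
  \<open>ln (1 + u)\<close> negative, so that events of too few visits are covered by the same
  statement.\<close>

lemma prob_visits_le:
  assumes E: "E \<in> events" "\<And>x. x \<in> E \<Longrightarrow> t \<le> ln (1 + u) * real (visits T A n x)"
  shows "prob E \<le> exp (real n * measure M {x \<in> space M. x \<in> A} * (u + B * u\<^sup>2) - t)"
proof -
  have "1 + u > 0" using u by linarith
  have "exp t * prob E = (\<integral>x. exp t * indicator E x \<partial>M)" using E(1) by simp
  also have "\<dots> \<le> (\<integral>x. weight n x \<partial>M)"
  proof (rule integral_mono[OF _ weight_integrable])
    show "integrable M (\<lambda>x. exp t * indicator E x)" using E(1)
      by (intro integrable_mult_right integrable_real_indicator) (auto simp: less_top[symmetric])
    fix x
    have "exp t \<le> weight n x" if "x \<in> E"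
    proof -
      have "weight n x = exp (ln (1 + u) * real (visits T A n x))"
        unfolding weight_def using \<open>1 + u > 0\<close>
        by (metis exp_of_nat2_mult exp_ln)
      with E(2)[OF that] show ?thesis by simp
    qed
    then show "exp t * indicator E x \<le> weight n x" using weight_pos by (auto simp: indicator_def less_imp_le)
  qed
  also have "\<dots> \<le> exp (real n * measure M {x \<in> space M. x \<in> A} * (u + B * u\<^sup>2))"
    using mgf_le_exp[of n] unfolding mgf_def .
  finally show ?thesis by (simp add: exp_diff field_simps)
qed

end

text \<open>\<open>p\<close> bounds the measure of \<open>A\<close> from one side only, so one value
  of \<open>p\<close> can serve many levels. The rate depends on the sets through \<open>K\<close>
  alone.\<close>

theorem visits_deviation:
  assumes K: "K > 0" and e: "0 < e" "e < 1"
  obtains c where "c > 0"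
    "\<And>A n p. indicator A \<in> F \<Longrightarrow> nrm (indicator A) \<le> K \<Longrightarrow> p > 0 \<Longrightarrow> measure M {x \<in> space M. x \<in> A} \<le> p \<Longrightarrow>
       prob {x \<in> space M. (1 + e) * (real n * p) \<le> real (visits T A n x)} \<le> exp (- c * (real n * p))"
    "\<And>A n p. indicator A \<in> F \<Longrightarrow> nrm (indicator A) \<le> K \<Longrightarrow> p > 0 \<Longrightarrow> p \<le> measure M {x \<in> space M. x \<in> A} \<Longrightarrow>
       prob {x \<in> space M. real (visits T A n x) \<le> (1 - e) * (real n * p)} \<le> exp (- c * (real n * p))"
proof -
  obtain \<theta> C where \<theta>: "0 < \<theta>" "\<theta> < 1" and C: "C > 0"
    and decay: "\<And>n f. f \<in> F \<Longrightarrow> nrm (\<lambda>x. (U ^^ n) f x - (\<integral>x. f x \<partial>M)) \<le> C * \<theta> ^ n * nrm f"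
    by (rule decay_of_correlations) blast
  let ?\<kappa> = "nrm (\<lambda>x. 1)"
  define B where "B = 2 * C * K * ?\<kappa> / (1 - \<theta>) + 1"
  have B0: "2 * C * K * ?\<kappa> / (1 - \<theta>) \<ge> 0" using C K \<theta> nrm_nonneg[OF F_const] by simp
  then have "B > 0" unfolding B_def by simp
  have "C * K * ?\<kappa> = (1 - \<theta>) / 2 * (2 * C * K * ?\<kappa> / (1 - \<theta>))" using \<theta> by simp
  also have "\<dots> \<le> (1 - \<theta>) / 2 * B" unfolding B_def using \<theta> by (intro mult_left_mono) auto
  finally have B: "C * K * ?\<kappa> \<le> (1 - \<theta>) / 2 * B" .
  \<comment> \<open>The entries serve, in order, the condition
    \<open>\<bar>u\<bar> \<le> 1 / 2\<close>, the closeness of the tilted iterates to constants, and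
    a quadratic loss of at most half the linear gain \<open>e * w\<close>.\<close>
  define w where "w = min (1 / 2) (min ((1 - \<theta>) / 2 / (C * K + 1)) (e / 2 / (B + 2)))"
  have CK: "C * K + 1 > 0" using C K by (simp add: add_pos_pos)
  have w: "w > 0" unfolding w_def using CK \<theta> e \<open>B > 0\<close> by auto
  have w2: "w \<le> 1 / 2" unfolding w_def by (rule min.cobounded1)
  note w = w w2
  have "w \<le> (1 - \<theta>) / 2 / (C * K + 1)" "w \<le> e / 2 / (B + 2)" unfolding w_def by auto
  then have w': "(C * K + 1) * w \<le> (1 - \<theta>) / 2" "(B + 2) * w \<le> e / 2"
    using CK \<open>B > 0\<close> by (simp_all only: pos_le_divide_eq mult.commute[of w] add_pos_pos zero_less_numeral)
  have main: "prob E \<le> exp (real n * measure M {x \<in> space M. x \<in> A} * (u + B * u\<^sup>2) - t)"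
    if "indicator A \<in> F" "nrm (indicator A) \<le> K" "\<bar>u\<bar> = w" "E \<in> events"
      "\<And>x. x \<in> E \<Longrightarrow> t \<le> ln (1 + u) * real (visits T A n x)" for A u E t n
    using that w(2) w'(1) by (intro prob_visits_le[OF _ _ _ \<theta> C K \<open>B > 0\<close> decay _ B]) auto
  \<comment> \<open>\<open>B\<close> comes from the moment generating function; the summand 2 pays
    for the quadratic remainders in the lower bounds for \<open>ln (1 + w)\<close> and
    \<open>ln (1 - w)\<close>.\<close>
  have q: "(B + 2) * w\<^sup>2 \<le> e / 2 * w" using mult_right_mono[OF w'(2), of w] w(1) by (simp add: power2_eq_square mult_ac)
  show ?thesis
  proof (rule that)
    show "e / 2 * w > 0" using e w by simp
    fix A :: "'a set" and n and p :: real
    assume A: "indicator A \<in> F" "nrm (indicator A) \<le> K" and p: "p > 0"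
    let ?mu = "measure M {x \<in> space M. x \<in> A}"
    have [measurable]: "Measurable.pred M (\<lambda>x. x \<in> A)" using pred_of_indicator_F[OF A(1)] .
    have np: "0 \<le> real n * p" using p by simp
    {
      assume le: "?mu \<le> p"
      let ?E = "{x \<in> space M. (1 + e) * (real n * p) \<le> real (visits T A n x)}"
      have ln: "w - w\<^sup>2 \<le> ln (1 + w)" using w by (intro ln_one_plus_pos_lower_bound) auto
      have ww: "w\<^sup>2 \<le> w" using w by (simp add: power2_eq_square)
      have "prob ?E \<le> exp (real n * ?mu * (w + B * w\<^sup>2) - (w - w\<^sup>2) * ((1 + e) * (real n * p)))"
      proof (rule main[OF A])
        show "?E \<in> events" by measurable
        fix x assume "x \<in> ?E"
        then show "(w - w\<^sup>2) * ((1 + e) * (real n * p)) \<le> ln (1 + w) * real (visits T A n x)"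
          using ln ww np e by (intro mult_mono) auto
      qed (use w in auto)
      also have "\<dots> \<le> exp (- (e / 2 * w) * (real n * p))"
      proof -
        have "real n * ?mu * (w + B * w\<^sup>2) \<le> real n * p * (w + B * w\<^sup>2)"
          using le w \<open>B > 0\<close> by (intro mult_right_mono mult_left_mono) auto
        moreover have "e * w\<^sup>2 \<le> 1 * w\<^sup>2" using e by (intro mult_right_mono) auto
        then have "(w + B * w\<^sup>2) - (w - w\<^sup>2) * (1 + e) \<le> (B + 2) * w\<^sup>2 - e * w" by (simp add: algebra_simps)
        then have "(w + B * w\<^sup>2) - (w - w\<^sup>2) * (1 + e) \<le> - (e / 2 * w)" using q by simp
        then have "real n * p * ((w + B * w\<^sup>2) - (w - w\<^sup>2) * (1 + e)) \<le> real n * p * (- (e / 2 * w))"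
          using np by (rule mult_left_mono)
        ultimately show ?thesis by (simp add: algebra_simps)
      qed
      finally show "prob ?E \<le> exp (- (e / 2 * w) * (real n * p))" .
    }
    {
      assume le: "p \<le> ?mu"
      let ?E = "{x \<in> space M. real (visits T A n x) \<le> (1 - e) * (real n * p)}"
      have ln: "- w - 2 * w\<^sup>2 \<le> ln (1 - w)" using w by (intro ln_one_minus_pos_lower_bound) auto
      have "prob ?E \<le> exp (real n * ?mu * (- w + B * (- w)\<^sup>2) - (- w - 2 * w\<^sup>2) * ((1 - e) * (real n * p)))"
      proof (rule main[OF A])
        show "?E \<in> events" by measurable
        fix x assume x: "x \<in> ?E"
        have "(- w - 2 * w\<^sup>2) * ((1 - e) * (real n * p)) \<le> (- w - 2 * w\<^sup>2) * real (visits T A n x)"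
          using x w zero_le_power2[of w] by (intro mult_left_mono_neg) (simp, linarith)
        also have "\<dots> \<le> ln (1 - w) * real (visits T A n x)" using ln by (intro mult_right_mono) auto
        finally show "(- w - 2 * w\<^sup>2) * ((1 - e) * (real n * p)) \<le> ln (1 + (- w)) * real (visits T A n x)" by simp
      qed (use w in auto)
      also have "\<dots> \<le> exp (- (e / 2 * w) * (real n * p))"
      proof -
        \<comment> \<open>This makes the exponent coefficient \<open>- w + B * w\<^sup>2\<close>
          nonpositive, the sign needed to replace the measure of \<open>A\<close> by the smaller
          \<open>p\<close>.\<close>
        have "B * w\<^sup>2 \<le> (B + 2) * w\<^sup>2" by (intro mult_right_mono) auto
        moreover have "e / 2 * w \<le> 1 * w" using e w by (intro mult_right_mono) auto
        ultimately have "B * w\<^sup>2 \<le> w" using q by linarith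
        then have "real n * ?mu * (- w + B * w\<^sup>2) \<le> real n * p * (- w + B * w\<^sup>2)"
          using le by (intro mult_right_mono_neg mult_left_mono) auto
        moreover have "0 \<le> e * w\<^sup>2" using e by (intro mult_nonneg_nonneg) auto
        then have "(- w + B * w\<^sup>2) + (w + 2 * w\<^sup>2) * (1 - e) \<le> (B + 2) * w\<^sup>2 - e * w" by (simp add: algebra_simps)
        then have "(- w + B * w\<^sup>2) + (w + 2 * w\<^sup>2) * (1 - e) \<le> - (e / 2 * w)" using q by simp
        then have "real n * p * ((- w + B * w\<^sup>2) + (w + 2 * w\<^sup>2) * (1 - e)) \<le> real n * p * (- (e / 2 * w))"
          using np by (rule mult_left_mono)
        ultimately show ?thesis by (simp add: algebra_simps)
      qed
      finally show "prob ?E \<le> exp (- (e / 2 * w) * (real n * p))" .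
    }
  qed
qed

end

section \<open>Uniform deviations over all levels\<close>

lemma countable_cofinal_real:
  fixes S :: "real set"
  obtains D where "countable D" "D \<subseteq> S" "\<And>s. s \<in> S \<Longrightarrow> \<exists>d\<in>D. s \<le> d"
proof (cases "\<exists>m\<in>S. \<forall>s\<in>S. s \<le> m")
  case True
  then obtain m where "m \<in> S" "\<forall>s\<in>S. s \<le> m" by blast
  then show ?thesis by (intro that[of "{m}"]) auto
next
  case False
  define d where "d q = (SOME s. s \<in> S \<and> real_of_rat q \<le> s)" for q
  define Q where "Q = {q. \<exists>s\<in>S. real_of_rat q \<le> s}"
  have d: "d q \<in> S \<and> real_of_rat q \<le> d q" if "q \<in> Q" for q
  proof -
    have "\<exists>s. s \<in> S \<and> real_of_rat q \<le> s" using that unfolding Q_def by blast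
    then show ?thesis unfolding d_def by (rule someI_ex)
  qed
  show ?thesis
  proof (rule that[of "d ` Q"])
    show "countable (d ` Q)" by simp
    show "d ` Q \<subseteq> S" using d by blast
    fix s assume "s \<in> S"
    with False obtain s' where s': "s' \<in> S" "s < s'" by force
    then obtain q where q: "s < real_of_rat q" "real_of_rat q < s'" using of_rat_dense by blast
    then have "q \<in> Q" unfolding Q_def using s'(1) less_imp_le[OF q(2)] by blast
    with d[OF this] q(1) show "\<exists>d\<in>d ` Q. s \<le> d" by (intro bexI[of _ "d q"]) auto
  qed
qed

context prob_space
begin

text \<open>A countable cofinal set of indices gives the same union, hence measurability. Running
  maxima along an enumeration turn it into an increasing sequence, and continuity from below keeps
  the bound \<open>q\<close> without any summation.\<close>

lemma prob_UN_mono: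
  fixes S :: "real set" and E :: "real \<Rightarrow> 'a set"
  assumes E: "\<And>s. s \<in> S \<Longrightarrow> E s \<in> events" "\<And>s t. s \<in> S \<Longrightarrow> t \<in> S \<Longrightarrow> s \<le> t \<Longrightarrow> E s \<subseteq> E t"
    and q: "\<And>s. s \<in> S \<Longrightarrow> prob (E s) \<le> q" "0 \<le> q"
  shows "(\<Union>s\<in>S. E s) \<in> events" "prob (\<Union>s\<in>S. E s) \<le> q"
proof -
  obtain D where D: "countable D" "D \<subseteq> S" "\<And>s. s \<in> S \<Longrightarrow> \<exists>d\<in>D. s \<le> d"
    by (rule countable_cofinal_real[of S]) blast
  have eq: "(\<Union>s\<in>S. E s) = (\<Union>s\<in>D. E s)"
  proof
    show "(\<Union>s\<in>S. E s) \<subseteq> (\<Union>s\<in>D. E s)"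
    proof
      fix x assume "x \<in> (\<Union>s\<in>S. E s)"
      then obtain s where s: "s \<in> S" "x \<in> E s" by blast
      obtain d where "d \<in> D" "s \<le> d" using D(3) s by blast
      then show "x \<in> (\<Union>s\<in>D. E s)" using E(2)[of s d] s D(2) by blast
    qed
  qed (use D(2) in blast)
  show ev: "(\<Union>s\<in>S. E s) \<in> events"
    unfolding eq using D E(1) by (intro sets.countable_UN'') auto
  show "prob (\<Union>s\<in>S. E s) \<le> q"
  proof (cases "D = {}")
    case True
    then show ?thesis unfolding eq using q by simp
  next
    case False
    define f where "f = from_nat_into D"
    have f: "range f = D" unfolding f_def using D(1) False by (simp add: range_from_nat_into)
    define g where "g n = Max (f ` {..n})" for n
    have gD: "g n \<in> D" for n
    proof -
      have "g n \<in> f ` {..n}" unfolding g_def by (intro Max_in) auto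
      then show ?thesis using f by blast
    qed
    have gm: "g m \<le> g n" if "m \<le> n" for m n
      unfolding g_def using that by (intro Max_mono) auto
    have "incseq (\<lambda>n. E (g n))"
      using E(2) gD gm D(2) by (intro monoI) (meson subsetD)
    moreover have r: "range (\<lambda>n. E (g n)) \<subseteq> events" using E(1) gD D(2) by blast
    ultimately have lim: "(\<lambda>n. prob (E (g n))) \<longlonglongrightarrow> prob (\<Union>n. E (g n))"
      by (intro finite_Lim_measure_incseq)
    have "(\<Union>n. E (g n)) = (\<Union>s\<in>D. E s)"
    proof
      show "(\<Union>s\<in>D. E s) \<subseteq> (\<Union>n. E (g n))"
      proof
        fix x assume "x \<in> (\<Union>s\<in>D. E s)"
        then obtain s where s: "s \<in> D" "x \<in> E s" by blast
        then obtain n where n: "s = f n" using f by blast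
        then have "s \<le> g n" unfolding g_def by simp
        then show "x \<in> (\<Union>n. E (g n))" using E(2)[of s "g n"] s gD[of n] D(2) by blast
      qed
    qed (use gD in blast)
    with lim have "(\<lambda>n. prob (E (g n))) \<longlonglongrightarrow> prob (\<Union>s\<in>S. E s)" using eq by simp
    then show ?thesis
      by (rule LIMSEQ_le_const2) (use q(1) gD D(2) in blast)
  qed
qed

lemma prob_UN_antimono:
  fixes S :: "real set" and E :: "real \<Rightarrow> 'a set"
  assumes E: "\<And>s. s \<in> S \<Longrightarrow> E s \<in> events" "\<And>s t. s \<in> S \<Longrightarrow> t \<in> S \<Longrightarrow> s \<le> t \<Longrightarrow> E t \<subseteq> E s"
    and q: "\<And>s. s \<in> S \<Longrightarrow> prob (E s) \<le> q" "0 \<le> q"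
  shows "(\<Union>s\<in>S. E s) \<in> events" "prob (\<Union>s\<in>S. E s) \<le> q"
proof -
  have eq: "(\<Union>s\<in>S. E s) = (\<Union>s\<in>uminus ` S. E (- s))" by auto
  show "(\<Union>s\<in>S. E s) \<in> events" "prob (\<Union>s\<in>S. E s) \<le> q"
    unfolding eq by (rule prob_UN_mono; use assms in force)+
qed

end

text \<open>Each term is repeated \<open>k\<close> times: this many consecutive blocks of times
  share one value of the rounded logarithm.\<close>

lemma summable_div:
  fixes f :: "nat \<Rightarrow> real"
  assumes "summable f" "\<And>n. 0 \<le> f n" "k > 0"
  shows "summable (\<lambda>l. f (l div k))"
proof (rule summableI_nonneg_bounded)
  fix n
  have "(\<Sum>l<n. f (l div k)) \<le> (\<Sum>l<n * k. f (l div k))"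
    using assms(2,3) by (intro sum_mono2) auto
  also have "\<dots> = (\<Sum>m<n. \<Sum>l = m * k..<m * k + k. f (l div k))"
    by (rule sum.nat_group[symmetric])
  also have "\<dots> = (\<Sum>m<n. \<Sum>l = m * k..<m * k + k. f m)"
  proof (intro sum.cong refl)
    fix m l assume "l \<in> {m * k..<m * k + k}"
    then have "l div k = m" by (intro div_nat_eqI) (auto simp: algebra_simps)
    then show "f (l div k) = f m" by simp
  qed
  also have "\<dots> = real k * (\<Sum>m<n. f m)" by (simp add: sum_distrib_left)
  also have "\<dots> \<le> real k * suminf f"
    using assms by (intro mult_left_mono sum_le_suminf) auto
  finally show "(\<Sum>l<n. f (l div k)) \<le> real k * suminf f" .
qed (use assms(2) in auto)

lemma Psi_class_at_top:
  assumes "\<psi> \<in> Psi_class"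
  shows "filterlim \<psi> at_top sequentially"
proof -
  have pos: "0 < \<psi> (Suc n)" for n using assms unfolding Psi_class_def by auto
  have "(\<lambda>n. 1 / \<psi> (Suc n)) \<longlonglongrightarrow> 0"
    using assms unfolding Psi_class_def by (intro summable_LIMSEQ_zero) auto
  then have "filterlim (\<lambda>n. inverse (1 / \<psi> (Suc n))) at_top sequentially"
    using pos by (intro filterlim_inverse_at_top) (auto intro: always_eventually)
  then have "filterlim (\<lambda>n. \<psi> (Suc n)) at_top sequentially" by simp
  then show ?thesis by (simp only: filterlim_sequentially_Suc)
qed

lemma power_sandwich:
  fixes r z :: real
  assumes "1 < r" "1 \<le> z"
  obtains j where "r ^ j \<le> z" "z < r ^ Suc j"
proof -
  obtain n where n: "z < r ^ n" using real_arch_pow assms(1) by blast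
  define m where "m = (LEAST n. z < r ^ n)"
  have m: "z < r ^ m" unfolding m_def using n by (rule LeastI)
  then have "m \<noteq> 0" using assms by (cases m) auto
  then obtain j where j: "m = Suc j" using not0_implies_Suc by blast
  then have "\<not> z < r ^ j" using not_less_Least[of j "\<lambda>n. z < r ^ n"] unfolding m_def by simp
  with m j show ?thesis by (intro that[of j]) auto
qed

section \<open>Visit counts above all levels simultaneously\<close>

locale property_D_system = property_C_system M T F nrm
  for M :: "'a measure" and T F nrm +
  fixes chi :: "'a \<Rightarrow> real" and K :: real
  assumes chi_measurable[measurable]: "chi \<in> borel_measurable M"
    and chi_nonneg: "\<And>x. x \<in> space M \<Longrightarrow> 0 \<le> chi x"
    and K_pos: "K > 0"
    and tail_F: "\<And>t. t > 0 \<Longrightarrow> indicator {x. t < chi x} \<in> F"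
    and tail_nrm: "\<And>t. t > 0 \<Longrightarrow> nrm (indicator {x. t < chi x}) \<le> K"
begin

definition G :: "real \<Rightarrow> real" where "G t = measure M {x \<in> space M. t < chi x}"

abbreviation V :: "real \<Rightarrow> nat \<Rightarrow> 'a \<Rightarrow> nat" where "V t \<equiv> visits T {y. t < chi y}"

lemma G_nonneg: "0 \<le> G t" unfolding G_def by simp

lemma G_antimono: "s \<le> t \<Longrightarrow> G t \<le> G s"
  unfolding G_def by (intro finite_measure_mono) auto

lemma V_antimono: "s \<le> t \<Longrightarrow> V t n x \<le> V s n x"
  by (intro visits_subset) auto

text \<open>Levels are selected by an inequality because \<open>G\<close> may jump over the value
  \<open>p\<close>.\<close>

definition high_visits :: "real \<Rightarrow> nat \<Rightarrow> real \<Rightarrow> 'a set" where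
  "high_visits e n p = (\<Union>t\<in>{t. 0 < t \<and> G t \<le> p}. {x \<in> space M. (1 + e) * (real n * p) \<le> real (V t n x)})"

definition low_visits :: "real \<Rightarrow> nat \<Rightarrow> real \<Rightarrow> 'a set" where
  "low_visits e n p = (\<Union>t\<in>{t. 0 < t \<and> p \<le> G t}. {x \<in> space M. real (V t n x) \<le> (1 - e) * (real n * p)})"

lemma uniform_deviation:
  assumes e: "0 < e" "e < 1"
  shows "\<exists>c>0. \<forall>n p. p > 0 \<longrightarrow> high_visits e n p \<in> events \<and> low_visits e n p \<in> events \<and>
    prob (high_visits e n p) \<le> exp (- c * (real n * p)) \<and> prob (low_visits e n p) \<le> exp (- c * (real n * p))"
proof (rule visits_deviation[OF K_pos e])
  fix c assume c: "c > 0"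
    "\<And>A n p. indicator A \<in> F \<Longrightarrow> nrm (indicator A) \<le> K \<Longrightarrow> p > 0 \<Longrightarrow> measure M {x \<in> space M. x \<in> A} \<le> p \<Longrightarrow>
       prob {x \<in> space M. (1 + e) * (real n * p) \<le> real (visits T A n x)} \<le> exp (- c * (real n * p))"
    "\<And>A n p. indicator A \<in> F \<Longrightarrow> nrm (indicator A) \<le> K \<Longrightarrow> p > 0 \<Longrightarrow> p \<le> measure M {x \<in> space M. x \<in> A} \<Longrightarrow>
       prob {x \<in> space M. real (visits T A n x) \<le> (1 - e) * (real n * p)} \<le> exp (- c * (real n * p))"
  have up: "prob {x \<in> space M. (1 + e) * (real n * p) \<le> real (V t n x)} \<le> exp (- c * (real n * p))"
    if "p > 0" "0 < t" "G t \<le> p" for n p t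
    using c(2)[OF tail_F[OF that(2)] tail_nrm[OF that(2)] that(1)] that(3) unfolding G_def by simp
  have low: "prob {x \<in> space M. real (V t n x) \<le> (1 - e) * (real n * p)} \<le> exp (- c * (real n * p))"
    if "p > 0" "0 < t" "p \<le> G t" for n p t
    using c(3)[OF tail_F[OF that(2)] tail_nrm[OF that(2)] that(1)] that(3) unfolding G_def by simp
  have mono_up: "{x \<in> space M. q \<le> real (V t n x)} \<subseteq> {x \<in> space M. q \<le> real (V s n x)}"
    and mono_low: "{x \<in> space M. real (V s n x) \<le> q} \<subseteq> {x \<in> space M. real (V t n x) \<le> q}" if "s \<le> t" for s t q n
  proof -
    have V: "real (V t n x) \<le> real (V s n x)" for x using V_antimono[OF that] by simp
    show "{x \<in> space M. q \<le> real (V t n x)} \<subseteq> {x \<in> space M. q \<le> real (V s n x)}"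
      "{x \<in> space M. real (V s n x) \<le> q} \<subseteq> {x \<in> space M. real (V t n x) \<le> q}"
      using order_trans[OF _ V] order_trans[OF V] by blast+
  qed
  show ?thesis
  proof (intro exI[of _ c] conjI allI impI c(1))
    fix n and p :: real assume p: "p > 0"
    show "high_visits e n p \<in> events"
      unfolding high_visits_def
      by (rule prob_UN_antimono(1)[where q = "exp (- c * (real n * p))"]) (use mono_up up p in auto)
    show "prob (high_visits e n p) \<le> exp (- c * (real n * p))"
      unfolding high_visits_def by (rule prob_UN_antimono(2)) (use mono_up up p in auto)
    show "low_visits e n p \<in> events"
      unfolding low_visits_def
      by (rule prob_UN_mono(1)[where q = "exp (- c * (real n * p))"]) (use mono_low low p in auto)
    show "prob (low_visits e n p) \<le> exp (- c * (real n * p))"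
      unfolding low_visits_def by (rule prob_UN_mono(2)) (use mono_low low p in auto)
  qed
qed

text \<open>Times are grouped into blocks of ratio \<open>R\<close> and the values of
  \<open>G\<close> into a grid of ratio \<open>r\<close>. Counts grow with time, so an upper bound
  at the end of a block and a lower bound at its beginning control the whole block; Borel-Cantelli
  over blocks concludes.\<close>

theorem tail_visits_uniform:
  assumes \<psi>: "\<psi> \<in> Psi_class" and e: "0 < e" "e < 1"
  obtains A where "A > 0"
    "AE x in M. \<forall>\<^sub>F n in sequentially. \<forall>t>0. A * ln (\<psi> (nat \<lfloor>ln (real n)\<rfloor>)) \<le> real n * G t \<longrightarrow>
       \<bar>real (V t n x) - real n * G t\<bar> \<le> e * (real n * G t)"
proof -
  \<comment> \<open>The upper estimate loses four factors of at most \<open>1 + d\<close>: the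
    deviation, the block length, the rounding of its end, and the grid of values. Their product is
    at most \<open>1 + 8 * d\<close>.\<close>
  define d where "d = e / 8"
  have d: "0 < d" "d < 1" "d \<le> 1 / 8" unfolding d_def using e by auto
  define r where "r = 1 + d"
  obtain c where c0: "c > 0" and dev: "\<forall>n p. p > 0 \<longrightarrow> high_visits d n p \<in> events \<and> low_visits d n p \<in> events \<and>
      prob (high_visits d n p) \<le> exp (- c * (real n * p)) \<and> prob (low_visits d n p) \<le> exp (- c * (real n * p))"
    using uniform_deviation[OF d(1,2)] by (elim exE conjE) (rule that)
  have c: "c > 0" "\<And>n p. p > 0 \<Longrightarrow> high_visits d n p \<in> events"
    "\<And>n p. p > 0 \<Longrightarrow> prob (high_visits d n p) \<le> exp (- c * (real n * p))"
    "\<And>n p. p > 0 \<Longrightarrow> low_visits d n p \<in> events"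
    "\<And>n p. p > 0 \<Longrightarrow> prob (low_visits d n p) \<le> exp (- c * (real n * p))"
    using c0 dev by simp_all
  obtain k0 where "1 / ln (1 + d) \<le> real k0" using real_arch_simple by blast
  then have k0: "1 \<le> real k0 * ln (1 + d)" using d by (simp add: divide_le_eq ln_gt_zero mult.commute)
  define k where "k = Suc k0"
  have k: "k > 0" unfolding k_def by simp
  \<comment> \<open>With a \<open>k\<close>-th root of Euler's number as ratio,
    \<open>l div k\<close> is exactly the rounded logarithm throughout block \<open>l\<close>, so
    that \<open>\<psi>\<close> enters with a single value.\<close>
  define R where "R = exp (1 / real k)"
  have R1: "R > 1" unfolding R_def using k by simp
  have R: "R \<le> 1 + d"
  proof -
    have "1 \<le> real k * ln (1 + d)" unfolding k_def using k0 d by (simp add: algebra_simps add_increasing)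
    then have "1 / real k \<le> ln (1 + d)" using k by (simp add: divide_le_eq mult.commute)
    then have "exp (1 / real k) \<le> exp (ln (1 + d))" by simp
    then show ?thesis unfolding R_def using d by simp
  qed
  \<comment> \<open>Chosen so that \<open>exp (- c * y l)\<close> is
    \<open>1 / \<psi> (l div k)\<close>.\<close>
  define y where "y l = ln (\<psi> (l div k)) / c" for l
  define E where "E l = exp (real l / real k)" for l
  have E0: "E l > 0" for l unfolding E_def by simp
  define p where "p l j = y l * r ^ j / E l" for l j
  define a where "a l = nat \<lceil>E l\<rceil>" for l
  define b where "b l = nat \<lceil>R * E l\<rceil>" for l
  have a: "E l \<le> real (a l)" for l unfolding a_def by (rule real_nat_ceiling_ge)
  have b: "R * E l \<le> real (b l)" for l unfolding b_def by (rule real_nat_ceiling_ge)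
  have b': "E l \<le> real (b l)" for l using b[of l] R1 E0[of l] mult_right_mono[of 1 R "E l"] by linarith
  define Up where "Up l j = high_visits d (b l) (p l j)" for l j
  define Low where "Low l j = low_visits d (a l) (p l j)" for l j
  \<comment> \<open>On initial blocks \<open>\<psi>\<close> may be at most 1, and the grid values
    would not be positive; as \<open>\<psi>\<close> tends to infinity, this concerns finitely many
    \<open>l\<close>.\<close>
  define Bad where "Bad l = (if y l > 0 then (\<Union>j. Up l j \<union> Low l j) else {})" for l
  have r: "r > 1" "r > 0" unfolding r_def using d by auto
  have ppos: "p l j > 0" if "y l > 0" for l j unfolding p_def using that r E0 by simp
  have Ep: "E l * p l j = y l * r ^ j" for l j unfolding p_def using E0[of l] by simp
  have ev: "Up l j \<in> events" "Low l j \<in> events" if "y l > 0" for l j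
    unfolding Up_def Low_def using c(2,4) ppos[OF that] by blast+
  have pr: "prob (Up l j) \<le> exp (- c * (y l * r ^ j))" "prob (Low l j) \<le> exp (- c * (y l * r ^ j))"
    if "y l > 0" for l j
  proof -
    have "prob (Up l j) \<le> exp (- c * (real (b l) * p l j))" unfolding Up_def using c(3) ppos[OF that] by blast
    also have "\<dots> \<le> exp (- c * (E l * p l j))"
      using b'[of l] ppos[OF that, of j] c(1) by (simp add: mult_right_mono)
    finally show "prob (Up l j) \<le> exp (- c * (y l * r ^ j))" unfolding Ep .
    have "prob (Low l j) \<le> exp (- c * (real (a l) * p l j))" unfolding Low_def using c(5) ppos[OF that] by blast
    also have "\<dots> \<le> exp (- c * (E l * p l j))"
      using a[of l] ppos[OF that, of j] c(1) by (simp add: mult_right_mono)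
    finally show "prob (Low l j) \<le> exp (- c * (y l * r ^ j))" unfolding Ep .
  qed
  have Bad_ev: "Bad l \<in> events" for l unfolding Bad_def using ev by auto
  have Bad_prob: "prob (Bad l) \<le> 4 * (1 / \<psi> (l div k))"
    if l: "1 < \<psi> (l div k)" "ln 2 \<le> d * ln (\<psi> (l div k))" for l
  proof -
    let ?\<psi> = "\<psi> (l div k)"
    have y: "y l > 0" unfolding y_def using l(1) c(1) by simp
    have cy: "c * y l = ln ?\<psi>" unfolding y_def using c(1) by simp
    have half: "exp (- c * (y l * r ^ j)) \<le> 1 / ?\<psi> * (1 / 2) ^ j" for j
    proof -
      \<comment> \<open>Bernoulli's inequality: once \<open>d * ln \<psi>\<close> exceeds
        \<open>ln 2\<close>, each further grid value gains at least a factor 1/2, and the sum over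
        \<open>j\<close> costs only a factor 2.\<close>
      have "1 + real j * d \<le> r ^ j" unfolding r_def using d by (intro Bernoulli_inequality) auto
      then have "ln ?\<psi> * (1 + real j * d) \<le> ln ?\<psi> * r ^ j" using l(1) by (intro mult_left_mono) auto
      moreover have "real j * ln 2 \<le> real j * (d * ln ?\<psi>)" using l(2) by (intro mult_left_mono) auto
      ultimately have "ln ?\<psi> + real j * ln 2 \<le> c * y l * r ^ j" unfolding cy by (simp add: algebra_simps)
      then have "exp (- c * (y l * r ^ j)) \<le> exp (- (ln ?\<psi> + real j * ln 2))" by (simp add: mult.assoc)
      also have "\<dots> = 1 / ?\<psi> * (1 / 2) ^ j"
      proof -
        have "exp (- (ln ?\<psi> + real j * ln 2)) = inverse (exp (ln ?\<psi>) * exp (real j * ln 2))"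
          by (simp only: exp_minus exp_add)
        also have "exp (real j * ln 2) = (exp (ln 2)) ^ j" by (rule exp_of_nat_mult)
        finally show ?thesis unfolding power_one_over using l(1) by (simp add: inverse_eq_divide)
      qed
      finally show ?thesis .
    qed
    let ?B = "\<lambda>j. Up l j \<union> Low l j"
    have Bj: "prob (?B j) \<le> 2 / ?\<psi> * (1 / 2) ^ j" for j
    proof -
      have "prob (?B j) \<le> prob (Up l j) + prob (Low l j)"
        using ev[OF y] by (rule measure_Un_le)
      then show ?thesis using pr[OF y, of j] half[of j] by simp
    qed
    have geo: "summable (\<lambda>j. 2 / ?\<psi> * (1 / 2 :: real) ^ j)"
      by (intro summable_mult summable_geometric) auto
    have sB: "summable (\<lambda>j. prob (?B j))"
      using Bj by (intro summable_comparison_test'[OF geo]) auto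
    have "prob (\<Union>j. ?B j) \<le> (\<Sum>j. prob (?B j))"
      using ev[OF y] sB by (intro finite_measure_subadditive_countably) auto
    also have "\<dots> \<le> (\<Sum>j. 2 / ?\<psi> * (1 / 2 :: real) ^ j)" using Bj sB geo by (intro suminf_le)
    also have "\<dots> = 2 / ?\<psi> * (\<Sum>j. (1 / 2 :: real) ^ j)" by (intro suminf_mult summable_geometric) auto
    also have "(\<Sum>j. (1 / 2 :: real) ^ j) = 2" by (simp add: suminf_geometric)
    finally show ?thesis unfolding Bad_def using y by simp
  qed
  have "eventually (\<lambda>m. max 2 (exp (ln 2 / d)) \<le> \<psi> m) sequentially"
    using Psi_class_at_top[OF \<psi>] unfolding filterlim_at_top by blast
  then obtain m0 where m0: "\<And>m. m \<ge> m0 \<Longrightarrow> max 2 (exp (ln 2 / d)) \<le> \<psi> m"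
    unfolding eventually_sequentially by blast
  have \<psi>1: "1 < \<psi> m" "ln 2 \<le> d * ln (\<psi> m)" if "m \<ge> m0" for m
  proof -
    show 1: "1 < \<psi> m" using m0[OF that] by simp
    have "ln (exp (ln 2 / d)) \<le> ln (\<psi> m)" using m0[OF that] 1 by (subst ln_le_cancel_iff) auto
    then show "ln 2 \<le> d * ln (\<psi> m)" using d by (simp add: divide_le_eq mult.commute)
  qed
  have div_ge: "l div k \<ge> m" if "l \<ge> m * k" for l m
    using div_le_mono[OF that, of k] k by simp
  have "summable (\<lambda>l. prob (Bad l))"
  proof -
    \<comment> \<open>The value of \<open>\<psi>\<close> at 0 is unconstrained and possibly
      negative, so it is replaced.\<close>
    define f where "f m = (if m = 0 then 0 else 1 / \<psi> m)" for m
    have "summable (\<lambda>n. f (Suc n))" using \<psi> unfolding Psi_class_def f_def by simp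
    then have "summable f" by (simp only: summable_Suc_iff)
    moreover have "0 \<le> f m" for m
      using \<psi> unfolding Psi_class_def f_def by (auto intro: less_imp_le)
    ultimately have "summable (\<lambda>l. 4 * f (l div k))" using summable_div k by (intro summable_mult) auto
    then show ?thesis
    proof (rule summable_comparison_test_ev[rotated])
      show "eventually (\<lambda>l. norm (prob (Bad l)) \<le> 4 * f (l div k)) sequentially"
      proof (rule eventually_sequentiallyI[of "Suc m0 * k"])
        fix l assume "l \<ge> Suc m0 * k"
        then have "l div k \<ge> Suc m0" by (rule div_ge)
        then show "norm (prob (Bad l)) \<le> 4 * f (l div k)"
          using Bad_prob[of l] \<psi>1[of "l div k"] unfolding f_def by simp
      qed
    qed
  qed
  then have AE: "AE x in M. eventually (\<lambda>l. x \<in> space M - Bad l) sequentially"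
    using Bad_ev by (intro borel_cantelli_AE1) (auto simp: less_top[symmetric])
  \<comment> \<open>From here on, rounding the end of a block up to an integer costs at most another
    factor \<open>R\<close>.\<close>
  obtain l1 where l1: "1 / (R * (R - 1)) * real k \<le> real l1" using real_arch_simple by blast
  have bR: "real (b l) \<le> R * (R * E l)" if "l \<ge> l1" for l
  proof -
    have "1 / (R * (R - 1)) * real k \<le> real l" using l1 that by linarith
    then have "1 / (R * (R - 1)) \<le> real l / real k" using k by (simp add: pos_le_divide_eq)
    also have "\<dots> \<le> E l" unfolding E_def using exp_ge_add_one_self[of "real l / real k"] by linarith
    finally have "1 \<le> E l * (R * (R - 1))" using R1 by (simp add: pos_divide_le_eq)
    moreover have "real (b l) < R * E l + 1"
    proof -
      have "0 \<le> R * E l" using R1 E0[of l] by simp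
      then have "real (b l) = real_of_int \<lceil>R * E l\<rceil>" unfolding b_def by (intro of_nat_nat) linarith
      then show ?thesis by linarith
    qed
    ultimately show ?thesis by (simp add: algebra_simps)
  qed
  have c1: "(1 + d) * (R * R) * r \<le> 1 + e" 
  proof -
    have "R * R \<le> (1 + d) * (1 + d)" using R R1 by (intro mult_mono) auto
    then have "(1 + d) * (R * R) * r \<le> (1 + d) * ((1 + d) * (1 + d)) * (1 + d)"
      unfolding r_def using d by (intro mult_right_mono mult_left_mono) auto
    also have "\<dots> = 1 + d * (4 + d * 6 + d * d * 4 + d * d * d)" by (simp add: algebra_simps)
    also have "\<dots> \<le> 1 + d * 8"
    proof -
      have "d * d \<le> 1 / 8 * (1 / 8)" using d by (intro mult_mono) auto
      moreover have "d * d * d \<le> 1 / 8 * (1 / 8) * (1 / 8)" using d by (intro mult_mono) auto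
      ultimately have "4 + d * 6 + d * d * 4 + d * d * d \<le> 8" using d by linarith
      then show ?thesis using d by (intro add_left_mono mult_left_mono) auto
    qed
    finally show ?thesis unfolding d_def by simp
  qed
  have c2: "(1 - e) * (R * r) \<le> 1 - d"
  proof -
    have "(1 - e) * (R * r) \<le> (1 - e) * ((1 + d) * (1 + d))"
      unfolding r_def using e d R R1 by (intro mult_left_mono mult_right_mono) auto
    also have "\<dots> = 1 - d * (6 + 15 * d + 8 * d * d)"
      unfolding d_def by (simp add: field_simps)
    also have "\<dots> \<le> 1 - d * 1" using d by (intro diff_left_mono mult_left_mono) auto
    finally show ?thesis by simp
  qed
  \<comment> \<open>\<open>R\<close> pays for passing from \<open>n\<close> to the block start
    \<open>E l\<close>: the hypothesis on \<open>t\<close> becomes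
    \<open>y l \<le> E l * G t\<close>, which puts \<open>G t\<close> above the bottom of the
    grid.\<close>
  define A where "A = R / c"
  have A: "A > 0" unfolding A_def using R1 c(1) by simp
  define L0 where "L0 = max l1 (m0 * k)"
  have good: "\<bar>real (V t n x) - real n * G t\<bar> \<le> e * (real n * G t)"
    if x: "x \<in> space M - Bad l" and l: "l \<ge> L0" "l = nat \<lfloor>real k * ln (real n)\<rfloor>" and n: "n \<ge> 1"
      and t: "t > 0" "A * ln (\<psi> (nat \<lfloor>ln (real n)\<rfloor>)) \<le> real n * G t" for x l n t
  proof -
    have lnn: "ln (real n) \<ge> 0" using n by simp
    have lk: "l div k = nat \<lfloor>ln (real n)\<rfloor>"
    proof -
      have "\<lfloor>(real k * ln (real n)) / real_of_int (int k)\<rfloor> = \<lfloor>real k * ln (real n)\<rfloor> div int k"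
        by (rule floor_divide_real_eq_div) simp
      moreover have "(real k * ln (real n)) / real_of_int (int k) = ln (real n)" using k by simp
      moreover have "int l = \<lfloor>real k * ln (real n)\<rfloor>" using lnn unfolding l(2) by simp
      ultimately have "\<lfloor>ln (real n)\<rfloor> = int (l div k)" by (simp add: zdiv_int)
      then show ?thesis by simp
    qed
    have ll: "real l \<le> real k * ln (real n)" "real k * ln (real n) < real l + 1"
      unfolding l(2) using lnn by (auto simp: of_nat_floor) 
    have En: "E l \<le> real n"
    proof -
      have "real l / real k \<le> ln (real n)" using ll(1) k by (simp add: divide_le_eq mult.commute)
      then have "E l \<le> exp (ln (real n))" unfolding E_def by simp
      then show ?thesis using n by simp
    qed
    have nE: "real n \<le> R * E l"
    proof -
      have "ln (real n) \<le> (real l + 1) / real k" using ll(2) k by (simp add: pos_le_divide_eq mult.commute)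
      then have "exp (ln (real n)) \<le> exp (1 / real k + real l / real k)"
        by (simp add: add_divide_distrib)
      then show ?thesis unfolding R_def E_def exp_add[symmetric] using n by simp
    qed
    have m: "l div k \<ge> m0" using div_ge l(1) unfolding L0_def by simp
    have y: "y l > 0" unfolding y_def using \<psi>1(1)[OF m] c(1) by simp
    have "R * y l = A * ln (\<psi> (nat \<lfloor>ln (real n)\<rfloor>))" unfolding y_def A_def lk by simp
    also have "\<dots> \<le> real n * G t" by (rule t(2))
    also have "\<dots> \<le> R * E l * G t" using nE G_nonneg by (intro mult_right_mono)
    finally have yE: "y l \<le> E l * G t" using R1 by (simp add: mult.assoc)
    then have "1 \<le> E l * G t / y l" using y by simp
    then obtain j where "r ^ j \<le> E l * G t / y l" "E l * G t / y l < r ^ Suc j"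
      using power_sandwich[OF r(1)] by blast
    then have j: "y l * r ^ j \<le> E l * G t" "E l * G t < y l * r ^ Suc j"
      using y by (simp_all only: pos_le_divide_eq pos_divide_less_eq mult.commute[of "y l"])
    have nG: "E l * G t \<le> real n * G t" using En G_nonneg by (intro mult_right_mono)
    have notbad: "x \<in> space M" "x \<notin> Up l i" "x \<notin> Low l i" for i
      using x y unfolding Bad_def by auto
    have "G t \<le> p l (Suc j)" unfolding p_def using j(2) E0[of l] by (simp add: pos_le_divide_eq mult.commute)
    then have up: "real (V t (b l) x) < (1 + d) * (real (b l) * p l (Suc j))"
      using notbad(1) notbad(2)[of "Suc j"] t(1) unfolding Up_def high_visits_def by force
    have "p l j \<le> G t" unfolding p_def using j(1) E0[of l] by (simp add: pos_divide_le_eq mult.commute)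
    then have low: "(1 - d) * (real (a l) * p l j) < real (V t (a l) x)"
      using notbad(1) notbad(3)[of j] t(1) unfolding Low_def low_visits_def by force
    have "n \<le> b l" using nE b[of l] by linarith
    then have "real (V t n x) \<le> real (V t (b l) x)" by (simp add: visits_mono)
    also have "\<dots> \<le> (1 + d) * (real (b l) * p l (Suc j))" using up by simp
    also have "\<dots> \<le> (1 + d) * (R * (R * E l) * p l (Suc j))"
      using bR[of l] l(1) ppos[OF y] d unfolding L0_def by (intro mult_left_mono mult_right_mono) (auto intro: less_imp_le)
    also have "\<dots> = (1 + d) * (R * R) * (y l * r ^ Suc j)" unfolding Ep[symmetric] by (simp add: mult_ac)
    also have "\<dots> = (1 + d) * (R * R) * r * (y l * r ^ j)" by (simp add: mult_ac)
    also have "\<dots> \<le> (1 + e) * (real n * G t)"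
    proof (rule mult_mono[OF c1 order_trans[OF j(1) nG]])
      show "0 \<le> 1 + e" "0 \<le> y l * r ^ j" using e y r by simp_all
    qed
    finally have 1: "real (V t n x) \<le> (1 + e) * (real n * G t)" .
    have "(1 - e) * (real n * G t) \<le> (1 - e) * (R * E l * G t)"
      using nE e G_nonneg by (intro mult_left_mono mult_right_mono) auto
    also have "\<dots> \<le> (1 - e) * (R * (y l * r ^ Suc j))"
      using j(2) e R1 by (simp add: mult.assoc)
    also have "\<dots> = (1 - e) * (R * r) * (y l * r ^ j)" by (simp add: mult_ac)
    also have "\<dots> \<le> (1 - d) * (y l * r ^ j)" using c2 y r by (intro mult_right_mono) auto
    also have "\<dots> \<le> (1 - d) * (real (a l) * p l j)"
      unfolding Ep[symmetric] using a[of l] ppos[OF y, of j] d by (intro mult_left_mono mult_right_mono) auto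
    also have "\<dots> \<le> real (V t (a l) x)" using low by simp
    also have "\<dots> \<le> real (V t n x)"
    proof -
      have "a l \<le> n" unfolding a_def using En by (simp add: nat_le_iff ceiling_le_iff)
      then show ?thesis by (simp add: visits_mono)
    qed
    finally have 2: "(1 - e) * (real n * G t) \<le> real (V t n x)" .
    from 1 2 show ?thesis by (simp add: abs_le_iff algebra_simps)
  qed
  have lim: "filterlim (\<lambda>n. nat \<lfloor>real k * ln (real n)\<rfloor>) sequentially sequentially"
  proof -
    have "filterlim (\<lambda>n. real k * ln (real n)) at_top sequentially"
      using k by (intro filterlim_tendsto_pos_mult_at_top[OF tendsto_const]
          filterlim_compose[OF ln_at_top filterlim_real_sequentially]) auto
    then show ?thesis
      by (intro filterlim_compose[OF filterlim_nat_sequentially] filterlim_compose[OF filterlim_floor_sequentially])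
  qed
  show ?thesis
  proof (rule that[OF A])
    show "AE x in M. \<forall>\<^sub>F n in sequentially. \<forall>t>0. A * ln (\<psi> (nat \<lfloor>ln (real n)\<rfloor>)) \<le> real n * G t \<longrightarrow>
       \<bar>real (V t n x) - real n * G t\<bar> \<le> e * (real n * G t)"
      using AE
    proof eventually_elim
      case (elim x)
      then have "eventually (\<lambda>l. x \<in> space M - Bad l \<and> l \<ge> L0) sequentially"
        by (intro eventually_conj eventually_ge_at_top)
      then have "\<forall>\<^sub>F n in sequentially. x \<in> space M - Bad (nat \<lfloor>real k * ln (real n)\<rfloor>) \<and> nat \<lfloor>real k * ln (real n)\<rfloor> \<ge> L0"
        using lim unfolding filterlim_iff by blast
      then show ?case using eventually_ge_at_top[of 1]
        by eventually_elim (use good in blast)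
    qed
  qed
qed

end

section \<open>Truncated sums\<close>

abbreviation ivl :: "real \<Rightarrow> real measure" where
  "ivl l \<equiv> restrict_space lborel {0<..l}"

lemma ivl_measurable[measurable]: "(\<lambda>t. t) \<in> borel_measurable (ivl l)"
  by (rule measurable_restrict_space1) simp

lemma space_ivl: "space (ivl l) = {0<..l}"
  by (simp add: space_restrict_space)

lemma finite_measure_ivl: "finite_measure (ivl l)"
proof (rule finite_measureI)
  show "emeasure (ivl l) (space (ivl l)) \<noteq> \<infinity>"
    by (cases "0 \<le> l") (simp_all add: space_ivl emeasure_restrict_space)
qed

lemma integral_ivl_less:
  assumes "0 < l" "0 \<le> y"
  shows "(\<integral>t. of_bool (t < y) \<partial>ivl l) = min y (l :: real)"
proof -
  have "(\<integral>t. of_bool (t < y) \<partial>ivl l) = (\<integral>t. indicator {0<..l} t *\<^sub>R (of_bool (t < y) :: real) \<partial>lborel)"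
    by (rule integral_restrict_space) simp
  also have "\<dots> = min y l"
  proof (cases "y \<le> l")
    case True
    then have "(\<lambda>t. indicator {0<..l} t *\<^sub>R (of_bool (t < y) :: real)) = indicator {0<..<y}"
      by (auto simp: indicator_def fun_eq_iff)
    then show ?thesis using True assms by simp
  next
    case False
    then have "(\<lambda>t. indicator {0<..l} t *\<^sub>R (of_bool (t < y) :: real)) = indicator {0<..l}"
      by (auto simp: indicator_def fun_eq_iff)
    then show ?thesis using False assms by simp
  qed
  finally show ?thesis .
qed

text \<open>The layer integral produces the capped variable, whereas truncation discards large
  values; the correction is the source of every boundary term \<open>l * G l\<close>.\<close>

lemma trunc_eq_min:
  assumes "0 \<le> chi x"
  shows "trunc l chi x = min (chi x) l - l * of_bool (l < chi x)"
  unfolding trunc_def indicator_def by auto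

context property_D_system
begin

lemma G_le_1: "G t \<le> 1"
  unfolding G_def by simp

lemma G_ivl_measurable[measurable]: "G \<in> borel_measurable (ivl l)"
proof -
  have "mono (\<lambda>t. - G t)" using G_antimono by (intro monoI) simp
  then have "(\<lambda>t. - G t) \<in> borel_measurable borel" by (rule borel_measurable_mono)
  then have "(\<lambda>t. - (- G t)) \<in> borel_measurable borel" by (rule borel_measurable_uminus)
  then have "G \<in> borel_measurable borel" by simp
  then show ?thesis by (intro measurable_restrict_space1) simp
qed

lemma G_integrable: "integrable (ivl l) G"
proof -
  interpret N: finite_measure "ivl l" by (rule finite_measure_ivl)
  show ?thesis using G_nonneg G_le_1 by (intro N.integrable_const_bound[where B = 1]) auto
qed

lemma less_ivl_integrable: "integrable (ivl l) (\<lambda>t. of_bool (t < y) :: real)"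
proof -
  interpret N: finite_measure "ivl l" by (rule finite_measure_ivl)
  have "(\<lambda>t. of_bool (t < y) :: real) \<in> borel_measurable (ivl l)" unfolding of_bool_def by measurable
  then show ?thesis by (intro N.integrable_const_bound[where B = 1]) auto
qed

lemma V_eq_sum: "real (V t n x) = (\<Sum>k<n. of_bool (t < chi ((T ^^ k) x)))"
  unfolding visits_def by simp

lemma V_ivl_integrable: "integrable (ivl l) (\<lambda>t. real (V t n x))"
  unfolding V_eq_sum by (intro Bochner_Integration.integrable_sum less_ivl_integrable)

lemma funpow_T_space: "x \<in> space M \<Longrightarrow> (T ^^ k) x \<in> space M"
  using measurable_space[OF measurable_funpow_T] .

lemma truncated_sum_layer_cake:
  assumes x: "x \<in> space M" and l: "0 < l"
  shows "truncated_sum T chi l n x = (\<integral>t. real (V t n x) \<partial>ivl l) - l * real (V l n x)"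
proof -
  have nn: "0 \<le> chi ((T ^^ k) x)" for k using chi_nonneg funpow_T_space[OF x] by blast
  have "(\<integral>t. real (V t n x) \<partial>ivl l) = (\<Sum>k<n. \<integral>t. of_bool (t < chi ((T ^^ k) x)) \<partial>ivl l)"
    unfolding V_eq_sum by (intro Bochner_Integration.integral_sum less_ivl_integrable)
  also have "\<dots> = (\<Sum>k<n. min (chi ((T ^^ k) x)) l)"
    using nn l by (intro sum.cong refl integral_ivl_less)
  finally show ?thesis
    unfolding truncated_sum_def V_eq_sum using nn
    by (simp add: trunc_eq_min sum_subtractf sum_distrib_left)
qed

definition trunc_mean :: "real \<Rightarrow> real" where "trunc_mean l = (\<integral>x. trunc l chi x \<partial>M)"

lemma trunc_measurable[measurable]: "trunc l chi \<in> borel_measurable M"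
proof -
  have "(\<lambda>x. chi x * indicator {y \<in> space M. chi y \<le> l} x) \<in> borel_measurable M" by measurable
  then show ?thesis
    by (rule measurable_cong[THEN iffD1, rotated]) (simp add: trunc_def indicator_def)
qed

lemma trunc_bounds: "x \<in> space M \<Longrightarrow> 0 \<le> l \<Longrightarrow> 0 \<le> trunc l chi x \<and> trunc l chi x \<le> l"
  using chi_nonneg unfolding trunc_def indicator_def by auto

lemma trunc_integrable: "0 \<le> l \<Longrightarrow> integrable M (trunc l chi)"
  using trunc_bounds by (intro integrable_const_bound[where B = l]) auto

lemma trunc_mean_layer_cake:
  assumes l: "0 < l"
  shows "trunc_mean l = (\<integral>t. G t \<partial>ivl l) - l * G l"
proof -
  interpret N: finite_measure "ivl l" by (rule finite_measure_ivl)
  interpret pair_sigma_finite M "ivl l" ..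
  interpret MN: finite_measure "M \<Otimes>\<^sub>M ivl l"
    by (rule finite_measure_pair_measure) unfold_locales
  have [measurable]: "snd \<in> borel_measurable (M \<Otimes>\<^sub>M ivl l)"
    using measurable_compose[OF measurable_snd ivl_measurable] by simp
  have ob: "(\<lambda>x. of_bool (t < chi x) :: real) \<in> borel_measurable M" for t unfolding of_bool_def by measurable
  have "(\<lambda>z. of_bool (snd z < chi (fst z)) :: real) \<in> borel_measurable (M \<Otimes>\<^sub>M ivl l)"
    unfolding of_bool_def by measurable
  then have int: "integrable (M \<Otimes>\<^sub>M ivl l) (\<lambda>(x, t). of_bool (t < chi x) :: real)"
    unfolding case_prod_beta by (intro MN.integrable_const_bound[where B = 1]) auto
  have Gt: "(\<integral>x. of_bool (t < chi x) \<partial>M) = G t" for t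
  proof -
    have "(\<integral>x. of_bool (t < chi x) \<partial>M) = (\<integral>x. indicator {x \<in> space M. t < chi x} x \<partial>M :: real)"
      by (intro Bochner_Integration.integral_cong refl) (simp add: indicator_def)
    then show ?thesis unfolding G_def by simp
  qed
  have "(\<integral>t. G t \<partial>ivl l) = (\<integral>t. (\<integral>x. of_bool (t < chi x) \<partial>M) \<partial>ivl l)" unfolding Gt ..
  also have "\<dots> = (\<integral>x. (\<integral>t. of_bool (t < chi x) \<partial>ivl l) \<partial>M)" by (rule Fubini_integral[OF int])
  also have "\<dots> = (\<integral>x. min (chi x) l \<partial>M)"
    using l chi_nonneg by (intro Bochner_Integration.integral_cong refl integral_ivl_less)
  finally have 1: "(\<integral>t. G t \<partial>ivl l) = (\<integral>x. min (chi x) l \<partial>M)" .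
  have "trunc_mean l = (\<integral>x. min (chi x) l - l * of_bool (l < chi x) \<partial>M)"
    unfolding trunc_mean_def using chi_nonneg by (intro Bochner_Integration.integral_cong refl trunc_eq_min)
  also have "\<dots> = (\<integral>x. min (chi x) l \<partial>M) - (\<integral>x. l * of_bool (l < chi x) \<partial>M)"
  proof (rule Bochner_Integration.integral_diff)
    show "integrable M (\<lambda>x. min (chi x) l)"
      using l chi_nonneg by (intro integrable_const_bound[where B = l]) auto
    show "integrable M (\<lambda>x. l * of_bool (l < chi x))"
      using ob by (intro integrable_mult_right integrable_const_bound[where B = 1]) auto
  qed
  also have "(\<integral>x. l * of_bool (l < chi x) \<partial>M) = l * G l" using Gt[of l] by simp
  finally show ?thesis unfolding 1 .
qed

lemma integral_truncated_sum:
  assumes "0 \<le> l"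
  shows "(\<integral>x. truncated_sum T chi l n x \<partial>M) = real n * trunc_mean l"
proof -
  have inv: "(\<integral>x. trunc l chi ((T ^^ k) x) \<partial>M) = trunc_mean l" for k
  proof (induction k)
    case 0
    then show ?case by (simp add: trunc_mean_def)
  next
    case (Suc k)
    have "(\<lambda>x. trunc l chi ((T ^^ k) x)) \<in> borel_measurable M" by measurable
    from integral_T[OF this] Suc show ?case by (simp add: funpow_swap1)
  qed
  have "integrable M (\<lambda>x. trunc l chi ((T ^^ k) x))" for k
  proof (rule integrable_const_bound[where B = l])
    show "AE x in M. norm (trunc l chi ((T ^^ k) x)) \<le> l"
      using trunc_bounds[OF funpow_T_space assms] by (intro AE_I2) auto
  qed measurable
  then show ?thesis unfolding truncated_sum_def by (simp add: Bochner_Integration.integral_sum inv)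
qed

text \<open>The errors of the layer integral and of the boundary term add up, whereas in the mean
  these terms are subtracted. As the integral of \<open>G\<close> is
  \<open>trunc_mean l + l * G l\<close>, the boundary term appears with coefficient 2.\<close>

lemma truncated_sum_deviation:
  assumes x: "x \<in> space M" and l: "0 < l"
    and dev: "\<And>t. 0 < t \<Longrightarrow> t \<le> l \<Longrightarrow> \<bar>real (V t n x) - real n * G t\<bar> \<le> e * (real n * G t)"
  shows "\<bar>truncated_sum T chi l n x - real n * trunc_mean l\<bar> \<le> e * (real n * (trunc_mean l + 2 * (l * G l)))"
proof -
  let ?I = "\<integral>t. G t \<partial>ivl l"
  have "\<bar>(\<integral>t. real (V t n x) \<partial>ivl l) - real n * ?I\<bar> = \<bar>\<integral>t. real (V t n x) - real n * G t \<partial>ivl l\<bar>"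
    using V_ivl_integrable G_integrable by simp
  also have "\<dots> \<le> (\<integral>t. \<bar>real (V t n x) - real n * G t\<bar> \<partial>ivl l)"
    by (rule integral_abs_bound)
  also have "\<dots> \<le> (\<integral>t. e * (real n * G t) \<partial>ivl l)"
  proof (rule integral_mono)
    show "integrable (ivl l) (\<lambda>t. \<bar>real (V t n x) - real n * G t\<bar>)"
      using V_ivl_integrable G_integrable by (intro integrable_abs Bochner_Integration.integrable_diff integrable_mult_right)
    show "integrable (ivl l) (\<lambda>t. e * (real n * G t))"
      using G_integrable by (intro integrable_mult_right)
    fix t assume "t \<in> space (ivl l)"
    then show "\<bar>real (V t n x) - real n * G t\<bar> \<le> e * (real n * G t)" using dev unfolding space_ivl by simp
  qed
  also have "\<dots> = e * (real n * ?I)" by simp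
  finally have 1: "\<bar>(\<integral>t. real (V t n x) \<partial>ivl l) - real n * ?I\<bar> \<le> e * (real n * ?I)" .
  have "l * \<bar>real (V l n x) - real n * G l\<bar> \<le> l * (e * (real n * G l))"
    using dev[of l] l by (intro mult_left_mono) auto
  then have 2: "\<bar>l * (real (V l n x) - real n * G l)\<bar> \<le> l * (e * (real n * G l))" 
    using l by (simp add: abs_mult)
  have "truncated_sum T chi l n x - real n * trunc_mean l =
      ((\<integral>t. real (V t n x) \<partial>ivl l) - real n * ?I) - l * (real (V l n x) - real n * G l)"
    unfolding truncated_sum_layer_cake[OF x l] trunc_mean_layer_cake[OF l] by (simp add: algebra_simps)
  then have "\<bar>truncated_sum T chi l n x - real n * trunc_mean l\<bar> \<le>
      \<bar>(\<integral>t. real (V t n x) \<partial>ivl l) - real n * ?I\<bar> + \<bar>l * (real (V l n x) - real n * G l)\<bar>"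
    by (simp only: abs_triangle_ineq4)
  also have "\<dots> \<le> e * (real n * ?I) + l * (e * (real n * G l))" using 1 2 by (rule add_mono)
  also have "\<dots> = e * (real n * (trunc_mean l + 2 * (l * G l)))"
    unfolding trunc_mean_layer_cake[OF l] by (simp add: algebra_simps)
  finally show ?thesis .
qed

lemma trunc_mean_mono:
  assumes "0 \<le> s" "s \<le> t" shows "trunc_mean s \<le> trunc_mean t"
  unfolding trunc_mean_def using assms chi_nonneg
  by (intro integral_mono trunc_integrable) (auto simp: trunc_def indicator_def)

text \<open>On the points with \<open>chi\<close> in (l/2, l] the truncated variable exceeds l/2;
  their measure is a difference of two tails.\<close>

lemma trunc_mean_ge:
  assumes "0 < l"
  shows "l / 2 * (G (l / 2) - G l) \<le> trunc_mean l"
proof -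
  let ?A = "{x \<in> space M. l / 2 < chi x} - {x \<in> space M. l < chi x}"
  have "measure M ?A = G (l / 2) - G l"
    unfolding G_def using assms by (intro finite_measure_Diff) auto
  then have "l / 2 * (G (l / 2) - G l) = (\<integral>x. l / 2 * indicator ?A x \<partial>M)" by simp
  also have "\<dots> \<le> trunc_mean l"
    unfolding trunc_mean_def
  proof (rule integral_mono)
    show "integrable M (\<lambda>x. l / 2 * indicator ?A x)"
      by (intro integrable_mult_right integrable_real_indicator) (auto simp: less_top[symmetric])
    show "integrable M (trunc l chi)" using assms by (intro trunc_integrable) simp
    fix x assume "x \<in> space M"
    then show "l / 2 * indicator ?A x \<le> trunc l chi x"
      using chi_nonneg[of x] assms unfolding trunc_def indicator_def by auto
  qed
  finally show ?thesis .
qed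

lemma trunc_mean_pos:
  assumes "0 < c" "measure M {x \<in> space M. 0 < chi x \<and> chi x \<le> c} > 0"
  shows "trunc_mean c > 0"
proof (rule ccontr)
  assume "\<not> trunc_mean c > 0"
  moreover have "0 \<le> trunc_mean c" unfolding trunc_mean_def using trunc_bounds[of _ c] assms
    by (intro Bochner_Integration.integral_nonneg_AE AE_I2) auto
  ultimately have "trunc_mean c = 0" by simp
  then have "AE x in M. trunc c chi x = 0"
    unfolding trunc_mean_def using integral_nonneg_eq_0_iff_AE[OF trunc_integrable[of c]] trunc_bounds[of _ c] assms by auto
  then have "AE x in M. \<not> (0 < chi x \<and> chi x \<le> c)"
    by eventually_elim (auto simp: trunc_def)
  then have "measure M {x \<in> space M. 0 < chi x \<and> chi x \<le> c} = 0"
    by (subst prob_eq_0) (auto elim: eventually_mono)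
  with assms show False by simp
qed

section \<open>Regularly varying tails\<close>

context
  fixes L :: "real \<Rightarrow> real" and \<alpha> :: real
  assumes alpha: "0 < \<alpha>" and slow: "slowly_varying L"
    and G_eq: "\<And>x. x > 0 \<Longrightarrow> G x = L x / x powr \<alpha>"
begin

lemma slow_half: "((\<lambda>x. L (x / 2) / L x) \<longlongrightarrow> 1) at_top"
  using slow[unfolded slowly_varying_def, rule_format, of "1 / 2"] by simp

text \<open>As division by zero yields 0, a limit 1 of the quotients of \<open>L\<close> forces
  \<open>L x\<close> to be nonzero for all large \<open>x\<close>. So \<open>G\<close> is positive
  arbitrarily far out, and by monotonicity everywhere.\<close>

lemma G_pos: "G t > 0"
proof -
  have "eventually (\<lambda>x. L (x / 2) / L x > 0) at_top"
    using slow_half by (rule order_tendstoD) simp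
  then have "eventually (\<lambda>x. L (x / 2) / L x > 0 \<and> x \<ge> max 1 t) at_top"
    by (intro eventually_conj eventually_ge_at_top)
  from eventually_happens'[OF trivial_limit_at_top_linorder this]
  obtain x where x: "L (x / 2) / L x > 0" "x \<ge> max 1 t" by blast
  then have "L x \<noteq> 0" by auto
  then have "G x \<noteq> 0" using G_eq[of x] x(2) by auto
  then have "G x > 0" using G_nonneg[of x] by simp
  with G_antimono[of t x] x(2) show ?thesis by simp
qed

lemma L_pos: "x > 0 \<Longrightarrow> L x > 0"
  using G_pos[of x] G_eq[of x] by (simp add: zero_less_divide_iff)

lemma G_halving:
  obtains \<eta> l0 where "\<eta> > 0" "l0 > 0" "\<And>l. l \<ge> l0 \<Longrightarrow> (1 + \<eta>) * G l \<le> G (l / 2)"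
proof -
  \<comment> \<open>The ratio \<open>G (l / 2) / G l\<close> tends to
    \<open>2 powr \<alpha>\<close>; \<open>1 + \<eta>\<close> is the midpoint between 1 and this
    limit.\<close>
  define \<eta> where "\<eta> = (2 powr \<alpha> - 1) / 2"
  have p: "1 < 2 powr \<alpha>" using alpha by simp
  have \<eta>: "\<eta> > 0" "1 + \<eta> < 2 powr \<alpha>" unfolding \<eta>_def using p by (auto simp: field_simps)
  have "eventually (\<lambda>x. (1 + \<eta>) / 2 powr \<alpha> < L (x / 2) / L x) at_top"
    using slow_half \<eta> by (intro order_tendstoD(1)[of _ 1]) auto
  then obtain l0 where l0: "\<And>l. l \<ge> l0 \<Longrightarrow> (1 + \<eta>) / 2 powr \<alpha> < L (l / 2) / L l"
    unfolding eventually_at_top_linorder by blast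
  show ?thesis
  proof (rule that[OF \<eta>(1)])
    show "max l0 1 > 0" by simp
    fix l assume l: "l \<ge> max l0 1"
    then have "(1 + \<eta>) / 2 powr \<alpha> < L (l / 2) / L l" using l0 by simp
    then have "(1 + \<eta>) * L l < 2 powr \<alpha> * L (l / 2)"
      using L_pos[of l] l by (simp add: field_simps)
    then have "(1 + \<eta>) * L l / l powr \<alpha> \<le> 2 powr \<alpha> * L (l / 2) / l powr \<alpha>"
      by (intro divide_right_mono) auto
    moreover have "G (l / 2) = 2 powr \<alpha> * L (l / 2) / l powr \<alpha>"
      using G_eq[of "l / 2"] l by (simp add: powr_divide)
    ultimately show "(1 + \<eta>) * G l \<le> G (l / 2)" using G_eq[of l] l by simp
  qed
qed

text \<open>A one-sided form of Karamata's theorem. For large \<open>l\<close> the mass between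
  \<open>l / 2\<close> and \<open>l\<close> is at least \<open>\<eta> * G l\<close>, which already
  makes the mean comparable to \<open>l * G l\<close>.\<close>

lemma tail_dominated:
  assumes c: "0 < c" "trunc_mean c > 0"
  obtains C where "C > 0" "\<And>l. l \<ge> c \<Longrightarrow> l * G l \<le> C * trunc_mean l"
proof -
  obtain \<eta> l0 where \<eta>: "\<eta> > 0" "l0 > 0" "\<And>l. l \<ge> l0 \<Longrightarrow> (1 + \<eta>) * G l \<le> G (l / 2)"
    by (rule G_halving) blast
  define C where "C = 2 / \<eta> + l0 / trunc_mean c"
  have pos: "0 < 2 / \<eta>" "0 < l0 / trunc_mean c" using \<eta> c by auto
  show ?thesis
  proof (rule that[of C])
    show "C > 0" unfolding C_def by (rule add_pos_pos[OF pos])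
    fix l assume l: "l \<ge> c"
    have ml: "trunc_mean c \<le> trunc_mean l" using trunc_mean_mono c l by simp
    show "l * G l \<le> C * trunc_mean l"
    proof (cases "l \<ge> l0")
      case True
      have "l / 2 * (\<eta> * G l) \<le> l / 2 * (G (l / 2) - G l)"
        using \<eta>(3)[OF True] l c by (intro mult_left_mono) (auto simp: algebra_simps)
      also have "\<dots> \<le> trunc_mean l" using trunc_mean_ge l c by simp
      finally have "l * G l \<le> 2 / \<eta> * trunc_mean l" using \<eta>(1) by (simp add: field_simps)
      also have "\<dots> \<le> C * trunc_mean l" unfolding C_def using pos ml c by (intro mult_right_mono) auto
      finally show ?thesis .
    next
      case False
      \<comment> \<open>On the bounded range the left side is at most \<open>l0\<close> and the mean
        at least \<open>trunc_mean c\<close>, whence the second summand of \<open>C\<close>.\<close>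
      have "l * G l \<le> l0 * 1" using False l c G_le_1 G_nonneg by (intro mult_mono) auto
      also have "\<dots> = l0 / trunc_mean c * trunc_mean c" using c by simp
      also have "\<dots> \<le> C * trunc_mean l" unfolding C_def using pos ml c by (intro mult_mono) auto
      finally show ?thesis .
    qed
  qed
qed

text \<open>The level \<open>c\<close> keeps the means \<open>trunc_mean (f n)\<close> away from 0
  and bounds the boundary term by a multiple of the mean, whether or not \<open>f\<close> tends to
  infinity. A relative error \<open>e\<close> of the counts then becomes
  \<open>e * (1 + 2 * C)\<close> for the sum.\<close>

theorem truncated_sum_strong_law:
  assumes c: "0 < c" "measure M {x \<in> space M. 0 < chi x \<and> chi x \<le> c} > 0"
    and fc: "\<forall>\<^sub>F n in sequentially. c \<le> f n"
    and \<psi>: "\<psi> \<in> Psi_class"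
    and growth: "(\<lambda>n. f n powr \<alpha> / L (f n)) \<in> o(\<lambda>n. real n / ln (\<psi> (nat \<lfloor>ln (real n)\<rfloor>)))"
  shows "AE x in M.
    (\<lambda>n. truncated_sum T chi (f n) n x / (\<integral>y. truncated_sum T chi (f n) n y \<partial>M)) \<longlonglongrightarrow> 1"
proof -
  have mc: "trunc_mean c > 0" by (rule trunc_mean_pos[OF c])
  obtain C where C: "C > 0" "\<And>l. l \<ge> c \<Longrightarrow> l * G l \<le> C * trunc_mean l"
    by (rule tail_dominated[OF c(1) mc]) blast
  have \<psi>1: "\<forall>\<^sub>F n in sequentially. 1 < \<psi> (nat \<lfloor>ln (real n)\<rfloor>)"
  proof -
    have "filterlim (\<lambda>n. ln (real n)) at_top sequentially"
      by (intro filterlim_compose[OF ln_at_top filterlim_real_sequentially])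
    then have "filterlim (\<lambda>n. nat \<lfloor>ln (real n)\<rfloor>) sequentially sequentially"
      by (intro filterlim_compose[OF filterlim_nat_sequentially] filterlim_compose[OF filterlim_floor_sequentially])
    with Psi_class_at_top[OF \<psi>] have "filterlim (\<lambda>n. \<psi> (nat \<lfloor>ln (real n)\<rfloor>)) at_top sequentially"
      by (rule filterlim_compose)
    then show ?thesis unfolding filterlim_at_top_dense by blast
  qed
  \<comment> \<open>\<open>f n powr \<alpha> / L (f n)\<close> is the reciprocal of
    \<open>G (f n)\<close>, so the growth condition yields this for every multiple \<open>A\<close>,
    in particular for the one that belongs to a given \<open>e\<close>.\<close>
  have level: "\<forall>\<^sub>F n in sequentially. A * ln (\<psi> (nat \<lfloor>ln (real n)\<rfloor>)) \<le> real n * G (f n)" if A: "A > 0" for A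
  proof -
    have "\<forall>\<^sub>F n in sequentially. norm (f n powr \<alpha> / L (f n)) \<le> (1 / A) * norm (real n / ln (\<psi> (nat \<lfloor>ln (real n)\<rfloor>)))"
      using landau_o.smallD[OF growth, of "1 / A"] A by simp
    with \<psi>1 fc show ?thesis
    proof eventually_elim
      case (elim n)
      let ?\<psi> = "ln (\<psi> (nat \<lfloor>ln (real n)\<rfloor>))"
      have \<psi>: "?\<psi> > 0" using elim(1) by simp
      have f: "f n > 0" using elim(2) c by simp
      have "G (f n) * (f n powr \<alpha> / L (f n)) = 1" using G_eq[OF f] L_pos[OF f] f by simp
      moreover have "f n powr \<alpha> / L (f n) \<le> (1 / A) * (real n / ?\<psi>)"
        using elim(3) L_pos[OF f] \<psi> f by (simp add: abs_of_pos)
      ultimately have "1 \<le> G (f n) * ((1 / A) * (real n / ?\<psi>))"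
        using mult_left_mono[OF _ G_nonneg[of "f n"]] by metis
      then show ?case using A \<psi> by (simp add: field_simps)
    qed
  qed
  have dev: "AE x in M. \<forall>\<^sub>F n in sequentially.
      \<bar>truncated_sum T chi (f n) n x / (real n * trunc_mean (f n)) - 1\<bar> \<le> e * (1 + 2 * C)"
    if e: "0 < e" "e < 1" for e
  proof -
    obtain A where A: "A > 0"
      "AE x in M. \<forall>\<^sub>F n in sequentially. \<forall>t>0. A * ln (\<psi> (nat \<lfloor>ln (real n)\<rfloor>)) \<le> real n * G t \<longrightarrow>
       \<bar>real (V t n x) - real n * G t\<bar> \<le> e * (real n * G t)"
      by (rule tail_visits_uniform[OF \<psi> e]) blast
    show ?thesis
      using A(2) AE_space
    proof eventually_elim
      case (elim x)
      show ?case using elim(1) level[OF A(1)] fc eventually_gt_at_top[of 0]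
      proof eventually_elim
        case (elim n)
        have f: "f n > 0" using elim(3) c by simp
        have mf: "trunc_mean (f n) > 0" using mc trunc_mean_mono[of c "f n"] c elim(3) by linarith
        have nm: "real n * trunc_mean (f n) > 0" using mf elim(4) by simp
        have "\<bar>truncated_sum T chi (f n) n x - real n * trunc_mean (f n)\<bar> \<le> e * (real n * (trunc_mean (f n) + 2 * (f n * G (f n))))"
        proof (rule truncated_sum_deviation[OF \<open>x \<in> space M\<close> f])
          fix t assume t: "0 < t" "t \<le> f n"
          \<comment> \<open>The threshold is met at \<open>f n\<close>, hence at every lower level,
            where \<open>G\<close> is at least as large.\<close>
          have "real n * G (f n) \<le> real n * G t" using G_antimono[OF t(2)] by (intro mult_left_mono) auto
          with elim(1,2) t(1) show "\<bar>real (V t n x) - real n * G t\<bar> \<le> e * (real n * G t)" by force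
        qed
        also have "\<dots> \<le> e * (real n * (trunc_mean (f n) + 2 * (C * trunc_mean (f n))))"
          using C(2)[OF elim(3)] e by (intro mult_left_mono add_left_mono) auto
        also have "\<dots> = e * (1 + 2 * C) * (real n * trunc_mean (f n))" by (simp add: algebra_simps)
        finally have "\<bar>truncated_sum T chi (f n) n x - real n * trunc_mean (f n)\<bar> / (real n * trunc_mean (f n)) \<le> e * (1 + 2 * C)"
          using nm by (simp only: pos_divide_le_eq)
        moreover have "\<bar>truncated_sum T chi (f n) n x / (real n * trunc_mean (f n)) - 1\<bar> =
            \<bar>(truncated_sum T chi (f n) n x - real n * trunc_mean (f n)) / (real n * trunc_mean (f n))\<bar>"
          using mf elim(4) by (simp add: diff_divide_distrib)
        ultimately show ?case using nm by (simp only: abs_divide abs_of_pos)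
      qed
    qed
  qed
  \<comment> \<open>The exceptional null set depends on the error, so only countably many are used;
    the shift by 2 keeps them strictly below 1.\<close>
  have "AE x in M. \<forall>j :: nat. \<forall>\<^sub>F n in sequentially.
      \<bar>truncated_sum T chi (f n) n x / (real n * trunc_mean (f n)) - 1\<bar> \<le> 1 / (real j + 2) * (1 + 2 * C)"
    unfolding AE_all_countable by (intro allI dev) auto
  then show ?thesis
  proof eventually_elim
    case (elim x)
    have "(\<lambda>n. truncated_sum T chi (f n) n x / (real n * trunc_mean (f n))) \<longlonglongrightarrow> 1"
    proof (rule tendstoI)
      fix \<epsilon> :: real assume \<epsilon>: "\<epsilon> > 0"
      obtain j :: nat where "(1 + 2 * C) / \<epsilon> < real j" using reals_Archimedean2 by blast
      then have "1 + 2 * C < (real j + 2) * \<epsilon>" using \<epsilon> C(1) by (simp add: pos_divide_less_eq algebra_simps)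
      then have j: "1 / (real j + 2) * (1 + 2 * C) < \<epsilon>" by (simp add: pos_divide_less_eq mult.commute)
      from elim have "\<forall>\<^sub>F n in sequentially.
        \<bar>truncated_sum T chi (f n) n x / (real n * trunc_mean (f n)) - 1\<bar> \<le> 1 / (real j + 2) * (1 + 2 * C)" by blast
      then show "\<forall>\<^sub>F n in sequentially. dist (truncated_sum T chi (f n) n x / (real n * trunc_mean (f n))) 1 < \<epsilon>"
        by eventually_elim (use j in \<open>simp add: dist_real_def\<close>)
    qed
    moreover have "\<forall>\<^sub>F n in sequentially. truncated_sum T chi (f n) n x / (real n * trunc_mean (f n)) =
        truncated_sum T chi (f n) n x / (\<integral>y. truncated_sum T chi (f n) n y \<partial>M)"
      using fc by eventually_elim (use c in \<open>simp add: integral_truncated_sum\<close>)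
    ultimately show ?case by (rule Lim_transform_eventually)
  qed
qed

end
end

section \<open>Passage from the distribution function to the tail\<close>

lemma one_minus_cdf_eq_tail:
  assumes "prob_space M" and [measurable]: "chi \<in> borel_measurable M"
  shows "1 - cdf (distr M borel chi) x = measure M {y \<in> space M. x < chi y}"
proof -
  interpret prob_space M by fact
  have "cdf (distr M borel chi) x = prob {y \<in> space M. chi y \<le> x}"
    unfolding cdf_def2 by (subst measure_distr) (auto intro!: arg_cong[where f = prob])
  moreover have "prob (space M - {y \<in> space M. chi y \<le> x}) = 1 - prob {y \<in> space M. chi y \<le> x}"
    by (rule prob_compl) measurable
  moreover have "space M - {y \<in> space M. chi y \<le> x} = {y \<in> space M. x < chi y}" by auto
  ultimately show ?thesis by simp
qed

theorem theorem2p5: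
  fixes M :: "'a measure" and T :: "'a \<Rightarrow> 'a"
    and F :: "('a \<Rightarrow> complex) set" and nrm :: "('a \<Rightarrow> complex) \<Rightarrow> real"
    and chi :: "'a \<Rightarrow> real" and L :: "real \<Rightarrow> real" and \<alpha> :: real
    and f :: "nat \<Rightarrow> real"
  assumes propD: "property_D M T F nrm chi"
    and alpha: "0 < \<alpha>" "\<alpha> < 1"
    and slow: "slowly_varying L"
    and tail: "\<And>x. x > 0 \<Longrightarrow> 1 - cdf (distr M borel chi) x = L x / x powr \<alpha>"
    and f_pos: "\<And>n. n \<ge> 1 \<Longrightarrow> f n > 0"
    and cdf_f_pos: "\<And>n. n \<ge> 1 \<Longrightarrow> cdf (distr M borel chi) (f n) > 0"
    and nondegenerate:
      "\<exists>c>0. measure M {x \<in> space M. 0 < chi x \<and> chi x \<le> c} > 0 \<and> (\<forall>\<^sub>F n in sequentially. c \<le> f n)"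
    and growth: "\<exists>\<psi>\<in>Psi_class.
      (\<lambda>n. f n powr \<alpha> / L (f n)) \<in> o(\<lambda>n. real n / ln (\<psi> (nat \<lfloor>ln (real n)\<rfloor>)))"
  shows "AE x in M.
    (\<lambda>n. truncated_sum T chi (f n) n x / (\<integral>y. truncated_sum T chi (f n) n y \<partial>M)) \<longlonglongrightarrow> 1"
proof -
  have C: "property_C M T F nrm" and chi: "chi \<in> borel_measurable M" "\<forall>x\<in>space M. 0 \<le> chi x"
    using propD unfolding property_D_def by blast+
  have "\<exists>K2>0. \<forall>l>0. indicator {x. chi x > l} \<in> F \<and> nrm (indicator {x. chi x > l}) \<le> K2"
    using propD unfolding property_D_def by blast
  then obtain K2 where K2: "K2 > 0"
    "\<forall>l>0. indicator {x. chi x > l} \<in> F \<and> nrm (indicator {x. chi x > l}) \<le> K2" by blast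
  interpret property_D_system M T F nrm chi K2
    by unfold_locales (use C chi K2 in auto)
  have G_eq: "G x = L x / x powr \<alpha>" if "x > 0" for x
    using tail[OF that] one_minus_cdf_eq_tail[OF prob_space_axioms chi(1), of x] unfolding G_def by simp
  obtain c where c: "c > 0" "measure M {x \<in> space M. 0 < chi x \<and> chi x \<le> c} > 0"
    "\<forall>\<^sub>F n in sequentially. c \<le> f n" using nondegenerate by blast
  obtain \<psi> where \<psi>: "\<psi> \<in> Psi_class"
    "(\<lambda>n. f n powr \<alpha> / L (f n)) \<in> o(\<lambda>n. real n / ln (\<psi> (nat \<lfloor>ln (real n)\<rfloor>)))"
    using growth by blast
  show ?thesis
    by (rule truncated_sum_strong_law[OF alpha(1) slow G_eq c \<psi>])
qed

end
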